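(* Let $p_1\equiv p_2\equiv p_3\equiv 3\pmod 4$ be distinct prime numbers such that $$\left(\frac{-p_1}{p_2}\right)=\left(\frac{-p_2}{p_3}\right)=-1\quad\text{and}\quad \left(\frac{-p_1}{p_3}\right)=\left(\frac{-p_1}{2}\right)=\left(\frac{-p_2}{2}\right)=\left(\frac{-p_3}{2}\right)=1.$$ Put $\mathbb{K}^+=\mathbb{Q}(\sqrt{p_1},\sqrt{p_2},\sqrt{p_3})$ and $\mathbb{K}=\mathbb{Q}(\sqrt{p_1},\sqrt{p_2},\sqrt{p_3},\sqrt{-1})$. Then there exists $\eta\in\{1,\varepsilon_{p_1}\}$ such that: 1) The unit group of $\mathbb{K}^+$ is $$E_{\mathbb{K}^+}=\Big\langle -1,\ \varepsilon_{p_1},\ \sqrt{\varepsilon_{p_1p_2}},\ \sqrt{\varepsilon_{p_1}\varepsilon_{p_2}},\ \sqrt{\varepsilon_{p_1p_3}},\ \sqrt{\varepsilon_{p_1}\varepsilon_{p_3}},\ \sqrt{\varepsilon_{p_2p_3}},\ \sqrt[4]{\eta^2\varepsilon_{p_1}^3\varepsilon_{p_2}\varepsilon_{p_3}\varepsilon_{p_1p_2p_3}}\Big\rangle.$$ 2) The unit group of $\mathbb{K}$ is $$E_{\mathbb{K}}=\Big\langle \zeta_4,\ \sqrt{\varepsilon_{p_1p_2}},\ \sqrt{\varepsilon_{p_1}\varepsilon_{p_2}},\ \sqrt{\varepsilon_{p_1p_3}},\ \sqrt{\varepsilon_{p_1}\varepsilon_{p_3}},\ \sqrt{\varepsilon_{p_2p_3}},\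 \sqrt[4]{\eta^2\varepsilon_{p_1}^3\varepsilon_{p_2}\varepsilon_{p_3}\varepsilon_{p_1p_2p_3}},\ \sqrt{\zeta_4\varepsilon_{p_1}}\Big\rangle.$$
   Context: $\left(\frac{\cdot}{\cdot}\right)$ is the Legendre symbol, extended to lower entry $2$ by the Kronecker symbol: for odd $a$, $\left(\frac a2\right)=1$ if $a\equiv\pm1\pmod 8$ and $-1$ if $a\equiv\pm3\pmod 8$. For a square-free integer $m>1$, $\varepsilon_m>1$ denotes the fundamental unit of $\mathbb{Q}(\sqrt m)$. $E_F$ denotes the group of units of the ring of integers of a number field $F$. $\zeta_4=\sqrt{-1}$ is a primitive fourth root of unity. $\sqrt{\cdot}$ and $\sqrt[4]{\cdot}$ of positive reals are the positive real roots. *)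

theory Defs
  imports
    "HOL-Analysis.Analysis"
    "HOL-Algebra.Generated_Groups"
    "HOL-Algebra.Generated_Fields"
    "HOL-Algebra.Algebraic_Closure_Type"
    "HOL-Number_Theory.Residues"
begin

text \<open>Number fields are subfields of \<open>\<complex>\<close>; \<open>\<complex>\<close> as a ring record is \<^const>\<open>ring_of_type_algebra\<close>.\<close>

abbreviation complex_ring :: "complex ring" where
  "complex_ring \<equiv> ring_of_type_algebra"

text \<open>A generated field contains the prime field, so this is \<open>\<rat>(S)\<close>.\<close>

definition rat_adjoin :: "complex set \<Rightarrow> complex set" where
  "rat_adjoin S = generate_field complex_ring S"

definition ring_of_integers :: "complex set \<Rightarrow> complex set" where
  "ring_of_integers F = {x \<in> F. algebraic_int x}"

definition unit_group :: "complex set \<Rightarrow> complex set" where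
  "unit_group F = Units (complex_ring \<lparr>carrier := ring_of_integers F\<rparr>)"

text \<open>The subgroup of the multiplicative group \<open>\<complex> - {0}\<close> generated by \<open>S\<close>.\<close>

definition mult_span :: "complex set \<Rightarrow> complex set" where
  "mult_span S = generate (units_of complex_ring) S"

text \<open>For square-free \<open>m > 1\<close>, the unique \<open>\<epsilon> > 1\<close> which together with \<open>-1\<close> generates the
  units of the ring of integers of \<open>\<rat>(\<surd>m)\<close>.\<close>

definition fundamental_unit :: "nat \<Rightarrow> real" where
  "fundamental_unit m =
     (THE \<epsilon>. \<epsilon> > 1 \<and>
        unit_group (rat_adjoin {complex_of_real (sqrt (real m))}) =
        mult_span {-1, complex_of_real \<epsilon>})"

text \<open>The Legendre symbol, with the Kronecker convention for the lower entry \<open>2\<close>, where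
  \<^const>\<open>Legendre\<close> would give the value \<open>1\<close> for every odd upper entry.\<close>

definition kronecker_symbol :: "int \<Rightarrow> nat \<Rightarrow> int" where
  "kronecker_symbol a p =
     (if p = 2 then
        if even a then 0
        else if [a = 1] (mod 8) \<or> [a = -1] (mod 8) then 1
        else -1
      else Legendre a (int p))"

end

theory Submission
  imports
    Defs
    "Jordan_Normal_Form.Char_Poly"
    "HOL-Analysis.Kronecker_Approximation_Theorem"
    "HOL-Computational_Algebra.Nth_Powers"
begin

text \<open>All three primes are \<open>7\<close> modulo \<open>8\<close>, and descent on \<open>x\<^sup>2 = m y\<^sup>2 + 1\<close> identifies the square roots of the
  quadratic fundamental units: \<open>\<surd>(2 \<epsilon>\<^sub>m)\<close> lies in \<open>\<rat>(\<surd>m)\<close> and has norm \<open>2\<close> for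
  \<open>m = p\<^sub>1, p\<^sub>2, p\<^sub>3, p\<^sub>1p\<^sub>2p\<^sub>3\<close>, and \<open>\<surd>\<epsilon>\<^sub>p\<^sub>q = a\<surd>p + b\<surd>q\<close> with \<open>p a\<^sup>2 - q b\<^sup>2 = 1\<close>, where the Legendre symbols
  decide the order of \<open>p\<close> and \<open>q\<close>, cyclically in the three primes.

  The fourth root lies in \<open>K\<^sup>+\<close> because the product \<open>X\<close> of the four elements \<open>\<surd>(2 \<epsilon>\<^sub>m)\<close> is a square in
  \<open>K\<^sup>+(\<surd>2)\<close>: by Hilbert 90 over \<open>\<rat>(\<surd>2)\<close> it is a rational integer \<open>c\<close> times a square, and since \<open>X / 4\<close>
  is a unit, the primes that divide the square-free part of \<open>c\<close> ramify. As \<open>2\<close> and \<open>\<epsilon>\<^sub>p\<^sub>1\<close> agree up to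
  squares of \<open>K\<^sup>+\<close>, \<open>X\<close> or \<open>\<epsilon>\<^sub>p\<^sub>1X\<close> is a square in \<open>K\<^sup>+\<close>; this is the choice of \<open>\<eta>\<close>.

  Conversely, by the identity \<open>u\<^sup>2 N(u) = N\<^sub>1(u) N\<^sub>2(u) N\<^sub>3(u)\<close> in biquadratic extensions, some power of \<open>u\<close>
  with exponent a power of \<open>2\<close> is a product of units of quadratic fields. It remains to see that only
  the obvious elements of the group generated by the given units are squares in the field, which
  follows by taking relative norms and comparing signs.\<close>

text \<open>The norm computation is decisive because the equations p a^2 - q b^2 = 1 are oriented
  cyclically. The norm that negates one root \<surd>p sends exactly one of the three
  \<surd>\<epsilon>_pq to -1, a different one for each p, so positivity of squares in the real field
  fixes these exponents one by one. The exponents of \<surd>(\<epsilon>_p1 \<epsilon>_p2) and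
  \<surd>(\<epsilon>_p1 \<epsilon>_p3) reappear in norms as exponents of \<epsilon>_p1, which is no
  square as it lies in the class of 2. The fourth root has norm \<plusminus>\<surd>(\<epsilon>_p2
  \<epsilon>_p3), which leads back to these generators. No rank or regulator is computed: a subgroup
  that contains a fixed 2-power of every unit is the whole group once it contains every unit whose
  square it contains. Automorphisms are replaced by conjugation in quadratic coordinates. One of the
  three cyclic symbols is not assumed; it follows from reciprocity, which the descent
  supplies.\<close>

hide_const (open) Polynomials.lead_coeff Polynomials.degree up_ring.monom up_ring.coeff

subsection \<open>Subfields, unit groups and multiplicative spans\<close>

lemma complex_ring_simps [simp]:
  "carrier complex_ring = UNIV" "x \<otimes>\<^bsub>complex_ring\<^esub> y = x * y" "x \<oplus>\<^bsub>complex_ring\<^esub> y = x + y"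
  "\<one>\<^bsub>complex_ring\<^esub> = 1" "\<zero>\<^bsub>complex_ring\<^esub> = 0"
  by (simp_all add: ring_of_type_algebra_def)

lemma complex_ring_uminus [simp]: "\<ominus>\<^bsub>complex_ring\<^esub> x = - x"
proof -
  interpret ring "complex_ring" by (rule ring_from_type_algebra)
  have "x \<oplus>\<^bsub>complex_ring\<^esub> (- x) = \<zero>\<^bsub>complex_ring\<^esub>" by simp
  then show ?thesis
    using minus_equality[of "-x" x] by (simp add: add.commute)
qed

lemma complex_ring_inv [simp]: "x \<noteq> 0 \<Longrightarrow> inv\<^bsub>complex_ring\<^esub> x = inverse x"
proof -
  interpret field "complex_ring" by (rule field_from_type_algebra)
  assume "x \<noteq> 0"
  then show ?thesis using comm_inv_char[of x "inverse x"] by simp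
qed

text \<open>Subfields of \<complex> as bare sets. With \<open>inverse 0 = 0\<close>, closure under
  inverses is stated for all elements alike.\<close>

definition closed_field :: "complex set \<Rightarrow> bool" where
  "closed_field P \<longleftrightarrow> 1 \<in> P \<and> (\<forall>x\<in>P. - x \<in> P \<and> inverse x \<in> P) \<and>
     (\<forall>x\<in>P. \<forall>y\<in>P. x + y \<in> P \<and> x * y \<in> P)"

lemma closed_field_rat_adjoin: "closed_field (rat_adjoin S)"
proof -
  interpret field "complex_ring" by (rule field_from_type_algebra)
  have z: "0 \<in> rat_adjoin S"
    using zero_in_generate by (simp add: rat_adjoin_def)
  show ?thesis
    unfolding closed_field_def
  proof (intro conjI ballI)
    show "1 \<in> rat_adjoin S"
      using generate_field.one[of complex_ring S] by (simp add: rat_adjoin_def)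
  next
    fix x assume x: "x \<in> rat_adjoin S"
    then show "- x \<in> rat_adjoin S"
      using generate_field.a_inv[of x complex_ring S] by (simp add: rat_adjoin_def)
    show "inverse x \<in> rat_adjoin S"
      using generate_field.m_inv[of x complex_ring S] x z by (cases "x = 0") (auto simp: rat_adjoin_def)
    fix y assume y: "y \<in> rat_adjoin S"
    show "x + y \<in> rat_adjoin S"
      using generate_field.eng_add[of x complex_ring S y] x y by (simp add: rat_adjoin_def)
    show "x * y \<in> rat_adjoin S"
      using generate_field.eng_mult[of x complex_ring S y] x y by (simp add: rat_adjoin_def)
  qed
qed

lemma rat_adjoin_incl: "S \<subseteq> rat_adjoin S"
  unfolding rat_adjoin_def by (auto intro: generate_field.incl)

lemma closed_fieldD:
  assumes "closed_field P"
  shows "1 \<in> P" "x \<in> P \<Longrightarrow> - x \<in> P" "x \<in> P \<Longrightarrow> inverse x \<in> P"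
    "x \<in> P \<Longrightarrow> y \<in> P \<Longrightarrow> x + y \<in> P" "x \<in> P \<Longrightarrow> y \<in> P \<Longrightarrow> x * y \<in> P"
  using assms by (auto simp: closed_field_def)

lemma closed_field_more:
  assumes P: "closed_field P"
  shows "0 \<in> P" "x \<in> P \<Longrightarrow> y \<in> P \<Longrightarrow> x - y \<in> P" "x \<in> P \<Longrightarrow> y \<in> P \<Longrightarrow> x / y \<in> P"
    "x \<in> P \<Longrightarrow> x ^ n \<in> P" "of_nat k \<in> P" "of_int i \<in> P" "numeral w \<in> P"
    "x \<in> P \<Longrightarrow> x powi i \<in> P"
proof -
  note [intro] = closed_fieldD[OF P]
  have "1 + - 1 \<in> P" by blast
  then show z: "0 \<in> P" by simp
  show m: "x - y \<in> P" if "x \<in> P" "y \<in> P" for x y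
  proof -
    have "x + - y \<in> P" using that by blast
    then show ?thesis by simp
  qed
  show d: "x / y \<in> P" if "x \<in> P" "y \<in> P" for x y
    unfolding divide_inverse using that by blast
  show pw: "x ^ n \<in> P" if "x \<in> P" for x n
    using that by (induction n) auto
  show n: "of_nat k \<in> P" for k
    using z by (induction k) auto
  show i: "of_int i \<in> P" for i
  proof (cases i)
    case (nonneg k)
    then show ?thesis using n[of k] by simp
  next
    case (neg k)
    have "- (of_nat (Suc k)) \<in> P" using n[of "Suc k"] by blast
    then show ?thesis using neg by simp
  qed
  show "numeral w \<in> P"
    using n[of "numeral w"] by simp
  show "x powi i \<in> P" if "x \<in> P" for x
    unfolding power_int_def using that pw by auto
qed

lemmas closed_field_intros = closed_fieldD closed_field_more

lemma Rats_subset_closed_field: "closed_field P \<Longrightarrow> \<rat> \<subseteq> P"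
  by (auto elim!: Rats_cases' intro: closed_field_intros)

lemma rat_adjoin_subset:
  assumes P: "closed_field P" and S: "S \<subseteq> P"
  shows "rat_adjoin S \<subseteq> P"
proof
  fix x assume "x \<in> rat_adjoin S"
  then have "x \<in> generate_field complex_ring S" by (simp add: rat_adjoin_def)
  then show "x \<in> P"
    by induction (use S closed_fieldD[OF P] in auto)
qed

lemma rat_adjoin_mono: "S \<subseteq> T \<Longrightarrow> rat_adjoin S \<subseteq> rat_adjoin T"
  by (meson closed_field_rat_adjoin rat_adjoin_incl rat_adjoin_subset order_trans)

lemma rat_adjoin_empty: "rat_adjoin {} = \<rat>"
proof
  have "closed_field \<rat>" by (auto simp: closed_field_def)
  then show "rat_adjoin {} \<subseteq> \<rat>" by (intro rat_adjoin_subset) auto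
  show "\<rat> \<subseteq> rat_adjoin {}" using Rats_subset_closed_field[OF closed_field_rat_adjoin] .
qed

text \<open>The inverse lies in the field anyway, so being a unit depends on the integrality of
  \<open>u\<close> and \<open>inverse u\<close> alone. This is what carries units from one field to
  another.\<close>

lemma mem_unit_group_iff:
  assumes F: "closed_field F"
  shows "u \<in> unit_group F \<longleftrightarrow> u \<in> F \<and> u \<noteq> 0 \<and> algebraic_int u \<and> algebraic_int (inverse u)"
proof -
  have "u \<in> unit_group F \<longleftrightarrow> u \<in> F \<and> algebraic_int u \<and> (\<exists>v\<in>F. algebraic_int v \<and> v * u = 1 \<and> u * v = 1)"
    by (auto simp: unit_group_def Units_def ring_of_integers_def ring_of_type_algebra_def)
  also have "\<dots> \<longleftrightarrow> u \<in> F \<and> u \<noteq> 0 \<and> algebraic_int u \<and> algebraic_int (inverse u)"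
    using closed_fieldD(3)[OF F, of u]
    by (metis inverse_unique left_inverse mult.commute mult_zero_left zero_neq_one)
  finally show ?thesis .
qed

lemma units_of_complex_ring [simp]:
  "carrier (units_of complex_ring) = - {0}" "x \<otimes>\<^bsub>units_of complex_ring\<^esub> y = x * y"
  "\<one>\<^bsub>units_of complex_ring\<^esub> = 1"
  using field.field_Units[OF field_from_type_algebra[where 'a = complex]]
  by (auto simp: units_of_def)

lemma inv_units_of_complex_ring [simp]: "x \<noteq> 0 \<Longrightarrow> inv\<^bsub>units_of complex_ring\<^esub> x = inverse x"
proof -
  assume x: "x \<noteq> 0"
  interpret ring "complex_ring" by (rule ring_from_type_algebra)
  interpret G: group "units_of complex_ring" by (rule units_group)
  show ?thesis using G.inv_equality[of "inverse x" x] x by simp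
qed

lemma mult_span_closed:
  assumes S: "0 \<notin> S"
  shows "1 \<in> mult_span S" "x \<in> mult_span S \<Longrightarrow> x \<noteq> 0"
    "x \<in> mult_span S \<Longrightarrow> inverse x \<in> mult_span S"
    "x \<in> mult_span S \<Longrightarrow> y \<in> mult_span S \<Longrightarrow> x * y \<in> mult_span S"
proof -
  show "1 \<in> mult_span S"
    using generate.one[of "units_of complex_ring" S] by (simp add: mult_span_def)
  interpret ring "complex_ring" by (rule ring_from_type_algebra)
  interpret G: group "units_of complex_ring" by (rule units_group)
  have sub: "S \<subseteq> carrier (units_of complex_ring)" using S by auto
  show nz: "x \<noteq> 0" if "x \<in> mult_span S" for x
    using G.generate_in_carrier[OF sub, of x] that by (simp add: mult_span_def)
  show "inverse x \<in> mult_span S" if "x \<in> mult_span S"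
    using G.generate_m_inv_closed[OF sub, of x] that nz[OF that] by (simp add: mult_span_def)
  show "x * y \<in> mult_span S" if "x \<in> mult_span S" "y \<in> mult_span S"
    using generate.eng[of x "units_of complex_ring" S y] that by (simp add: mult_span_def)
qed

lemma mult_span_incl: "S \<subseteq> mult_span S"
  unfolding mult_span_def by (auto intro: generate.incl)

lemma mult_span_powi:
  assumes S: "0 \<notin> S" and x: "x \<in> mult_span S"
  shows "x powi k \<in> mult_span S"
proof -
  have pw: "y ^ n \<in> mult_span S" if "y \<in> mult_span S" for y n
    using that by (induction n) (auto intro: mult_span_closed[OF S])
  show ?thesis unfolding power_int_def
    using pw[OF x] pw[OF mult_span_closed(3)[OF S x]] by auto
qed

lemma mult_span_subset:
  assumes S: "0 \<notin> S" and sub: "S \<subseteq> P" and P: "1 \<in> P" "\<And>x. x \<in> P \<Longrightarrow> inverse x \<in> P"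
    "\<And>x y. x \<in> P \<Longrightarrow> y \<in> P \<Longrightarrow> x * y \<in> P"
  shows "mult_span S \<subseteq> P"
proof
  fix x assume "x \<in> mult_span S"
  then have "x \<in> generate (units_of complex_ring) S" by (simp add: mult_span_def)
  then show "x \<in> P"
  proof induction
    case (inv h)
    then have "h \<noteq> 0" using S by auto
    then show ?case using inv sub P by auto
  qed (use sub P in auto)
qed

lemma mult_span_empty: "mult_span {} = {1}"
proof -
  have "mult_span {} \<subseteq> {1}" by (rule mult_span_subset) auto
  then show ?thesis using mult_span_closed(1)[of "{}"] by auto
qed

text \<open>Peels off one generator; iteration writes every element of a finitely generated group as
  a word with integer exponents.\<close>

lemma mult_span_insert:
  assumes S: "0 \<notin> S" and g: "g \<noteq> 0"
  shows "mult_span (insert g S) = {g powi k * x | k x. x \<in> mult_span S}" (is "_ = ?R")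
proof
  note c = mult_span_closed[OF S]
  show "mult_span (insert g S) \<subseteq> ?R"
  proof (rule mult_span_subset)
    show "0 \<notin> insert g S" using S g by auto
    have "g = g powi 1 * 1" by simp
    then have 1: "g \<in> ?R" using c(1) by blast
    have "x \<in> ?R" if "x \<in> S" for x
    proof -
      have "x = g powi 0 * x" by simp
      then show ?thesis using mult_span_incl[of S] that by blast
    qed
    with 1 show "insert g S \<subseteq> ?R" by blast
    have "1 = g powi 0 * 1" by simp
    then show "1 \<in> ?R" using c(1) by blast
  next
    fix x assume "x \<in> ?R"
    then obtain k y where x: "x = g powi k * y" and y: "y \<in> mult_span S" by blast
    have "inverse x = g powi (-k) * inverse y"
      by (simp add: x power_int_minus)
    then show "inverse x \<in> ?R" using c(3)[OF y] by blast
    fix x' assume "x' \<in> ?R"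
    then obtain k' y' where x': "x' = g powi k' * y'" and y': "y' \<in> mult_span S" by blast
    have "x * x' = g powi (k + k') * (y * y')"
      using g by (simp add: x x' power_int_add)
    then show "x * x' \<in> ?R" using c(4)[OF y y'] by blast
  qed
  show "?R \<subseteq> mult_span (insert g S)"
  proof
    fix x assume "x \<in> ?R"
    then obtain k y where x: "x = g powi k * y" and y: "y \<in> mult_span S" by blast
    have z: "0 \<notin> insert g S" using S g by auto
    have "mult_span S \<subseteq> mult_span (insert g S)"
      by (rule mult_span_subset[OF S]) (use mult_span_incl[of "insert g S"] mult_span_closed[OF z] in auto)
    moreover have "g powi k \<in> mult_span (insert g S)"
      by (rule mult_span_powi[OF z]) (use mult_span_incl[of "insert g S"] in auto)
    ultimately show "x \<in> mult_span (insert g S)"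
      using x y mult_span_closed(4)[OF z] by auto
  qed
qed

subsection \<open>Algebraic integers form a ring\<close>

definition int_span :: "complex set \<Rightarrow> complex set" where
  "int_span B = {\<Sum>b\<in>B. of_int (c b) * b | c. True}"

lemma int_spanI: "x = (\<Sum>b\<in>B. of_int (c b) * b) \<Longrightarrow> x \<in> int_span B"
  by (auto simp: int_span_def)

lemma int_spanE:
  assumes "x \<in> int_span B"
  obtains c where "x = (\<Sum>b\<in>B. of_int (c b) * b)"
  using assms by (auto simp: int_span_def)

lemma int_span_closed:
  shows "0 \<in> int_span B" "x \<in> int_span B \<Longrightarrow> y \<in> int_span B \<Longrightarrow> x + y \<in> int_span B"
    "x \<in> int_span B \<Longrightarrow> of_int k * x \<in> int_span B"
proof -
  show "0 \<in> int_span B" by (rule int_spanI[of _ "\<lambda>_. 0"]) simp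
  show "x + y \<in> int_span B" if x: "x \<in> int_span B" and y: "y \<in> int_span B"
  proof -
    obtain c where c: "x = (\<Sum>b\<in>B. of_int (c b) * b)" using x by (rule int_spanE)
    obtain d where d: "y = (\<Sum>b\<in>B. of_int (d b) * b)" using y by (rule int_spanE)
    show ?thesis
      by (rule int_spanI[of _ "\<lambda>b. c b + d b"]) (simp add: c d sum.distrib distrib_right)
  qed
  show "of_int k * x \<in> int_span B" if x: "x \<in> int_span B"
  proof -
    obtain c where c: "x = (\<Sum>b\<in>B. of_int (c b) * b)" using x by (rule int_spanE)
    show ?thesis
      by (rule int_spanI[of _ "\<lambda>b. k * c b"]) (simp add: c sum_distrib_left mult.assoc)
  qed
qed

lemma int_span_sum: "(\<And>i. i \<in> I \<Longrightarrow> f i \<in> int_span B) \<Longrightarrow> sum f I \<in> int_span B"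
  by (induction I rule: infinite_finite_induct) (auto intro: int_span_closed)

lemma int_span_incl: "finite B \<Longrightarrow> b \<in> B \<Longrightarrow> b \<in> int_span B"
  by (rule int_spanI[of _ "\<lambda>b'. if b' = b then 1 else 0"])
     (simp add: if_distrib[of of_int] if_distrib[of "\<lambda>x. x * _"] cong: if_cong)

lemma int_span_mult:
  assumes "\<And>b. b \<in> B \<Longrightarrow> x * b \<in> int_span B" and "y \<in> int_span B"
  shows "x * y \<in> int_span B"
proof -
  obtain c where "y = (\<Sum>b\<in>B. of_int (c b) * b)" using assms(2) by (rule int_spanE)
  then have "x * y = (\<Sum>b\<in>B. of_int (c b) * (x * b))"
    by (simp add: sum_distrib_left algebra_simps)
  also have "\<dots> \<in> int_span B" by (intro int_span_sum int_span_closed(3) assms(1))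
  finally show ?thesis .
qed

text \<open>The generators, listed as a vector, form an eigenvector of an integer matrix with
  eigenvalue \<open>x\<close>, so \<open>x\<close> is a root of the characteristic polynomial, which
  is monic over \<int>. The generators may be linearly dependent; \<open>b0\<close> ensures that the
  eigenvector is nonzero.\<close>

lemma algebraic_int_if_stable:
  assumes B: "finite B" "b0 \<in> B" "b0 \<noteq> 0" and st: "\<And>b. b \<in> B \<Longrightarrow> x * b \<in> int_span B"
  shows "algebraic_int x"
proof -
  obtain bs where bs: "set bs = B" "distinct bs"
    using finite_distinct_list[OF B(1)] by blast
  define n where "n = length bs"
  have "\<forall>b\<in>B. \<exists>c. x * b = (\<Sum>b'\<in>B. of_int (c b') * b')"
    using st unfolding int_span_def by blast
  then obtain c where c: "\<And>b. b \<in> B \<Longrightarrow> x * b = (\<Sum>b'\<in>B. of_int (c b b') * b')" by metis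
  define A where "A = mat n n (\<lambda>(i, j). c (bs ! i) (bs ! j))"
  have A: "A \<in> carrier_mat n n" by (simp add: A_def)
  define A' :: "complex mat" where "A' = map_mat of_int A"
  have A': "A' \<in> carrier_mat n n" using A by (simp add: A'_def)
  define v where "v = vec n (\<lambda>i. bs ! i)"
  have "v \<noteq> 0\<^sub>v n"
  proof -
    obtain i where "i < n" "bs ! i = b0" using B bs by (metis in_set_conv_nth n_def)
    then have "v $ i \<noteq> 0\<^sub>v n $ i" using B by (simp add: v_def)
    then show ?thesis by metis
  qed
  moreover have "A' *\<^sub>v v = x \<cdot>\<^sub>v v"
  proof (rule eq_vecI)
    fix i assume "i < dim_vec (x \<cdot>\<^sub>v v)"
    then have i: "i < n" by (simp add: v_def)
    then have mem: "bs ! i \<in> B" using bs by (auto simp: n_def)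
    have "(A' *\<^sub>v v) $ i = (\<Sum>j<n. of_int (c (bs ! i) (bs ! j)) * bs ! j)"
      using i by (simp add: A'_def A_def v_def scalar_prod_def atLeast0LessThan)
    also have "\<dots> = (\<Sum>b'\<in>B. of_int (c (bs ! i) b') * b')"
      by (rule sum.reindex_bij_betw[of "\<lambda>j. bs ! j" "{..<n}" B "\<lambda>b'. of_int (c (bs ! i) b') * b'"])
         (use bs bij_betw_nth[of bs "{..<n}" B] in \<open>auto simp: n_def\<close>)
    also have "\<dots> = x * bs ! i" using c[OF mem] by simp
    finally show "(A' *\<^sub>v v) $ i = (x \<cdot>\<^sub>v v) $ i" using i by (simp add: v_def)
  qed (simp add: A'_def A_def v_def)
  ultimately have "eigenvector A' v x"
    using A' by (auto simp: eigenvector_def v_def)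
  then have "poly (char_poly A') x = 0"
    using eigenvalue_root_char_poly[OF A'] by (auto simp: eigenvalue_def)
  moreover have "char_poly A' = map_poly of_int (char_poly A)"
    unfolding A'_def by (rule of_int_hom.char_poly_hom[OF A])
  moreover have "lead_coeff (char_poly A) = 1"
    using degree_monic_char_poly[OF A] by simp
  ultimately show ?thesis
    unfolding algebraic_int_altdef_ipoly by metis
qed

text \<open>The monomials x^i y^j below the degrees of two monic equations span one lattice that is
  stable under both numbers, hence under their sum and product.\<close>

lemma algebraic_int_common_lattice:
  fixes x y :: complex
  assumes x: "algebraic_int x" and y: "algebraic_int y"
  obtains B where "finite B" "1 \<in> B" "\<And>b. b \<in> B \<Longrightarrow> x * b \<in> int_span B"
    "\<And>b. b \<in> B \<Longrightarrow> y * b \<in> int_span B"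
proof -
  have red: "\<exists>n c. n > 0 \<and> z ^ n = (\<Sum>i<n. of_int (c i) * z ^ i)" if "algebraic_int z" for z :: complex
  proof -
    from that obtain p :: "int poly" where p: "poly (map_poly of_int p) z = 0" "lead_coeff p = 1"
      unfolding algebraic_int_altdef_ipoly by blast
    define n where "n = degree p"
    \<comment> \<open>A monic constant polynomial is 1 and has no root.\<close>
    have "n > 0"
    proof (rule ccontr)
      assume "\<not> n > 0"
      then obtain a where "p = [:a:]" by (metis n_def not_gr_zero degree_eq_zeroE)
      then have "p = 1" using p(2) by simp
      then show False using p(1) by simp
    qed
    moreover have "0 = (\<Sum>i\<le>n. of_int (coeff p i) * z ^ i)"
      using p(1) by (simp add: poly_altdef degree_map_poly coeff_map_poly n_def)
    then have "0 = (\<Sum>i<n. of_int (coeff p i) * z ^ i) + z ^ n"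
      using p(2) by (simp add: n_def lessThan_Suc_atMost[symmetric])
    then have "z ^ n = - (\<Sum>i<n. of_int (coeff p i) * z ^ i)"
      by (metis add.commute eq_neg_iff_add_eq_0)
    then have "z ^ n = (\<Sum>i<n. of_int (- coeff p i) * z ^ i)"
      by (simp add: sum_negf)
    ultimately show ?thesis by (intro exI[of _ n] exI[of _ "\<lambda>i. - coeff p i"] conjI)
  qed
  obtain n c where n: "n > 0" "x ^ n = (\<Sum>i<n. of_int (c i) * x ^ i)" using red[OF x] by blast
  obtain m d where m: "m > 0" "y ^ m = (\<Sum>i<m. of_int (d i) * y ^ i)" using red[OF y] by blast
  define B where "B = (\<lambda>(i, j). x ^ i * y ^ j) ` ({..<n} \<times> {..<m})"
  have fin: "finite B" by (simp add: B_def)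
  have mem: "x ^ i * y ^ j \<in> int_span B" if "i < n" "j < m" for i j
    using that by (intro int_span_incl fin) (auto simp: B_def)
  show ?thesis
  proof (rule that[OF fin])
    show "1 \<in> B" unfolding B_def using n m by (auto intro!: image_eqI[of _ _ "(0, 0)"])
  next
    fix b assume "b \<in> B"
    then obtain i j where b: "b = x ^ i * y ^ j" and ij: "i < n" "j < m" by (auto simp: B_def)
    show "x * b \<in> int_span B"
    proof (cases "Suc i < n")
      case True
      then show ?thesis using mem[of "Suc i" j] ij b by (simp add: mult.assoc)
    next
      case False
      then have n': "n = Suc i" using ij by simp
      have "x * b = x ^ n * y ^ j" unfolding b n' by simp
      also have "\<dots> = (\<Sum>i<n. of_int (c i) * (x ^ i * y ^ j))"
        by (simp add: n(2) sum_distrib_right mult.assoc)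
      also have "\<dots> \<in> int_span B" by (intro int_span_sum int_span_closed(3) mem) (use ij in auto)
      finally show ?thesis .
    qed
    show "y * b \<in> int_span B"
    proof (cases "Suc j < m")
      case True
      then show ?thesis using mem[of i "Suc j"] ij b by (simp add: mult_ac)
    next
      case False
      then have m': "m = Suc j" using ij by simp
      have "y * b = x ^ i * y ^ m" unfolding b m' by simp
      also have "\<dots> = (\<Sum>j<m. of_int (d j) * (x ^ i * y ^ j))"
        by (simp add: m(2) sum_distrib_left mult_ac)
      also have "\<dots> \<in> int_span B" by (intro int_span_sum int_span_closed(3) mem) (use ij in auto)
      finally show ?thesis .
    qed
  qed
qed

lemma algebraic_int_add:
  fixes x y :: complex
  assumes "algebraic_int x" "algebraic_int y"
  shows "algebraic_int (x + y)"
proof -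
  obtain B where B: "finite B" "1 \<in> B" "\<And>b. b \<in> B \<Longrightarrow> x * b \<in> int_span B"
    "\<And>b. b \<in> B \<Longrightarrow> y * b \<in> int_span B"
    by (rule algebraic_int_common_lattice[OF assms], rule that)
  show ?thesis
  proof (rule algebraic_int_if_stable[OF B(1,2)])
    fix b assume "b \<in> B"
    then show "(x + y) * b \<in> int_span B"
      unfolding distrib_right by (intro int_span_closed(2) B(3,4))
  qed simp
qed

lemma algebraic_int_mult:
  fixes x y :: complex
  assumes "algebraic_int x" "algebraic_int y"
  shows "algebraic_int (x * y)"
proof -
  obtain B where B: "finite B" "1 \<in> B" "\<And>b. b \<in> B \<Longrightarrow> x * b \<in> int_span B"
    "\<And>b. b \<in> B \<Longrightarrow> y * b \<in> int_span B"
    by (rule algebraic_int_common_lattice[OF assms], rule that)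
  show ?thesis
  proof (rule algebraic_int_if_stable[OF B(1,2)])
    fix b assume "b \<in> B"
    then show "(x * y) * b \<in> int_span B"
      unfolding mult.assoc using int_span_mult[OF B(3) B(4)] by blast
  qed simp
qed

lemma algebraic_int_diff:
  fixes x y :: complex
  shows "algebraic_int x \<Longrightarrow> algebraic_int y \<Longrightarrow> algebraic_int (x - y)"
  using algebraic_int_add[of x "- y"] by simp

lemma algebraic_int_of_power2: "algebraic_int (x ^ 2) \<Longrightarrow> algebraic_int (x :: complex)"
  using algebraic_int_root[of "x ^ 2" "monom 1 2" x] by (auto simp: poly_monom degree_monom_eq)

subsection \<open>Quadratic and biquadratic extensions\<close>

text \<open>Intended for \<open>s ^ 2 \<in> F\<close>, where this set is already the field generated
  by \<open>s\<close> over \<open>F\<close>.\<close>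

definition adj :: "complex set \<Rightarrow> complex \<Rightarrow> complex set" where
  "adj F s = {x + y * s | x y. x \<in> F \<and> y \<in> F}"

lemma adjI: "x \<in> F \<Longrightarrow> y \<in> F \<Longrightarrow> x + y * s \<in> adj F s"
  by (auto simp: adj_def)

lemma adjE:
  assumes "z \<in> adj F s"
  obtains x y where "x \<in> F" "y \<in> F" "z = x + y * s"
  using assms by (auto simp: adj_def)

lemma adj_trivial:
  assumes F: "closed_field F" and s: "s \<in> F"
  shows "adj F s = F"
proof
  show "adj F s \<subseteq> F" using F s by (auto elim!: adjE intro!: closed_field_intros)
  show "F \<subseteq> adj F s"
  proof
    fix x assume "x \<in> F"
    then show "x \<in> adj F s" using adjI[of x F 0 s] closed_field_more(1)[OF F] by simp
  qed
qed

text \<open>A genuine quadratic extension with a chosen square root; its conjugation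
  \<open>cj\<close> plays the part of the nontrivial automorphism.\<close>

locale quad_ext =
  fixes F :: "complex set" and s :: complex
  assumes F: "closed_field F" and s2: "s ^ 2 \<in> F" and s_notin: "s \<notin> F"
begin

lemmas F_intros = closed_field_intros[OF F]

lemma coords_unique:
  assumes "x + y * s = x' + y' * s" "x \<in> F" "y \<in> F" "x' \<in> F" "y' \<in> F"
  shows "x = x' \<and> y = y'"
proof -
  have "y = y'"
  proof (rule ccontr)
    assume ne: "y \<noteq> y'"
    have "(y - y') * s = x' - x" using assms(1) by (simp add: algebra_simps)
    then have "s = (x' - x) / (y - y')" using ne by (simp add: field_simps)
    also have "\<dots> \<in> F" using assms by (intro F_intros)
    finally show False using s_notin by simp
  qed
  then show ?thesis using assms(1) by simp
qed

text \<open>Read off from the unique coordinates, hence specified only on \<open>adj F s\<close>;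
  this is why the rules below carry membership premises.\<close>

definition cj :: "complex \<Rightarrow> complex" where
  "cj z = (THE w. \<exists>x\<in>F. \<exists>y\<in>F. z = x + y * s \<and> w = x - y * s)"

lemma cj_eq: "x \<in> F \<Longrightarrow> y \<in> F \<Longrightarrow> cj (x + y * s) = x - y * s"
  unfolding cj_def using coords_unique by (intro the_equality) blast+

lemma cj_base: "x \<in> F \<Longrightarrow> cj x = x"
  using cj_eq[of x 0] F_intros by simp

lemma base_subset: "x \<in> F \<Longrightarrow> x \<in> adj F s"
  using adjI[of x F 0 s] F_intros by simp

lemma gen_in: "s \<in> adj F s"
  using adjI[of 0 F 1 s] F_intros by simp

lemma mult_coords:
  "(x + y * s) * (x' + y' * s) = (x * x' + y * y' * s ^ 2) + (x * y' + y * x') * s"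
  by (simp add: algebra_simps power2_eq_square)

lemma nonzero_norm:
  assumes "x \<in> F" "y \<in> F" "x + y * s \<noteq> 0"
  shows "x ^ 2 - y ^ 2 * s ^ 2 \<noteq> 0"
proof
  assume "x ^ 2 - y ^ 2 * s ^ 2 = 0"
  then have "(x + y * s) * (x - y * s) = 0" by (simp add: algebra_simps power2_eq_square)
  then have "x + (- y) * s = 0 + 0 * s" using assms by simp
  then have "x = 0 \<and> - y = 0" using assms by (intro coords_unique) (auto intro: F_intros)
  then show False using assms by simp
qed

lemma closed_field_adj: "closed_field (adj F s)"
  unfolding closed_field_def
proof (intro conjI ballI)
  show "1 \<in> adj F s" using base_subset F_intros by blast
next
  fix z assume "z \<in> adj F s"
  then obtain x y where z: "x \<in> F" "y \<in> F" "z = x + y * s" by (rule adjE)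
  have "- z = (- x) + (- y) * s" using z by simp
  then show "- z \<in> adj F s" using z adjI F_intros by metis
  show "inverse z \<in> adj F s"
  proof (cases "z = 0")
    case True
    then show ?thesis using base_subset F_intros by simp
  next
    case False
    define n where "n = x ^ 2 - y ^ 2 * s ^ 2"
    have n: "n \<noteq> 0" "n \<in> F"
      using nonzero_norm z False s2 by (auto simp: n_def intro!: F_intros)
    have "z * (x / n + (- y / n) * s) = 1"
      using n(1) unfolding z(3) mult_coords by (simp add: field_simps) (simp add: n_def algebra_simps power2_eq_square)
    then have "inverse z = x / n + (- y / n) * s" by (rule inverse_unique)
    then show ?thesis using z n adjI[of "x / n" F "- y / n" s] by (auto intro: F_intros)
  qed
  fix w assume "w \<in> adj F s"
  then obtain x' y' where w: "x' \<in> F" "y' \<in> F" "w = x' + y' * s" by (rule adjE)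
  have "z + w = (x + x') + (y + y') * s" using z w by (simp add: algebra_simps)
  then show "z + w \<in> adj F s" using z w adjI F_intros by metis
  show "z * w \<in> adj F s"
    unfolding z(3) w(3) mult_coords using z w s2 by (intro adjI) (blast intro: F_intros)+
qed

lemma cj_add: "z \<in> adj F s \<Longrightarrow> w \<in> adj F s \<Longrightarrow> cj (z + w) = cj z + cj w"
proof (elim adjE)
  fix x y x' y'
  assume h: "x \<in> F" "y \<in> F" "z = x + y * s" "x' \<in> F" "y' \<in> F" "w = x' + y' * s"
  have e: "z + w = (x + x') + (y + y') * s" using h by (simp add: algebra_simps)
  have c: "cj ((x + x') + (y + y') * s) = (x + x') - (y + y') * s"
    using h by (intro cj_eq) (blast intro: F_intros)+
  have "cj z = x - y * s" "cj w = x' - y' * s" using h by (simp_all add: cj_eq)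
  then show ?thesis unfolding e c by (simp add: algebra_simps)
qed

lemma cj_mult: "z \<in> adj F s \<Longrightarrow> w \<in> adj F s \<Longrightarrow> cj (z * w) = cj z * cj w"
proof (elim adjE)
  fix x y x' y'
  assume h: "x \<in> F" "y \<in> F" "z = x + y * s" "x' \<in> F" "y' \<in> F" "w = x' + y' * s"
  have e: "cj (z * w) = (x * x' + y * y' * s ^ 2) - (x * y' + y * x') * s"
    unfolding h(3,6) mult_coords using h s2 by (intro cj_eq) (blast intro: F_intros)+
  have c: "cj z = x - y * s" "cj w = x' - y' * s" using h by (simp_all add: cj_eq)
  show ?thesis unfolding e c by (simp add: algebra_simps power2_eq_square)
qed

lemma cj_closed: "z \<in> adj F s \<Longrightarrow> cj z \<in> adj F s"
proof (elim adjE)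
  fix x y assume h: "x \<in> F" "y \<in> F" "z = x + y * s"
  have "cj z = x + (- y) * s" using h cj_eq by simp
  then show ?thesis using h adjI F_intros by metis
qed

lemma norm_in_base: "z \<in> adj F s \<Longrightarrow> z * cj z \<in> F"
proof (elim adjE)
  fix x y assume h: "x \<in> F" "y \<in> F" "z = x + y * s"
  have e: "cj z = x - y * s" using h by (simp add: cj_eq)
  have "z * cj z = x ^ 2 - y ^ 2 * s ^ 2"
    unfolding e unfolding h(3) by (simp add: algebra_simps power2_eq_square)
  moreover have "x ^ 2 - y ^ 2 * s ^ 2 \<in> F" using h s2 by (blast intro: F_intros)
  ultimately show ?thesis by simp
qed

lemma cj_inverse: "z \<in> adj F s \<Longrightarrow> cj (inverse z) = inverse (cj z)"
proof (cases "z = 0")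
  case True
  then show ?thesis using cj_base[of 0] F_intros(6) by simp
next
  case False
  assume z: "z \<in> adj F s"
  have "cj z * cj (inverse z) = cj (z * inverse z)"
    using z closed_fieldD(3)[OF closed_field_adj] by (simp add: cj_mult)
  also have "\<dots> = 1" using False cj_base F_intros(1) by simp
  finally show ?thesis by (rule inverse_unique[symmetric])
qed

lemma cj_power: "z \<in> adj F s \<Longrightarrow> cj (z ^ n) = cj z ^ n"
proof (induction n)
  case 0
  then show ?case using cj_base[of 1] F_intros(1) by simp
next
  case (Suc n)
  then show ?case using closed_field_more(4)[OF closed_field_adj] by (simp add: cj_mult)
qed

lemma cj_powi: "z \<in> adj F s \<Longrightarrow> cj (z powi k) = cj z powi k"
  unfolding power_int_def
  using cj_power closed_fieldD(3)[OF closed_field_adj] by (auto simp: cj_inverse)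

lemma cj_poly:
  assumes z: "z \<in> adj F s"
  shows "(\<forall>i. Polynomial.coeff p i \<in> F) \<Longrightarrow> poly p z \<in> adj F s \<and> cj (poly p z) = poly p (cj z)"
proof (induction p)
  case 0
  then show ?case using cj_base[of 0] base_subset F_intros by simp
next
  case (pCons a p)
  have a: "a \<in> F" using pCons.prems by (metis coeff_pCons_0)
  have "\<forall>i. Polynomial.coeff p i \<in> F" using pCons.prems by (metis coeff_pCons_Suc)
  then have IH: "poly p z \<in> adj F s" "cj (poly p z) = poly p (cj z)" using pCons.IH by auto
  have zp: "z * poly p z \<in> adj F s" by (rule closed_fieldD(5)[OF closed_field_adj z IH(1)])
  then have "a + z * poly p z \<in> adj F s" using closed_fieldD(4)[OF closed_field_adj] base_subset a by blast
  moreover have "cj (a + z * poly p z) = a + cj z * poly p (cj z)"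
    using zp a z IH base_subset by (simp add: cj_add cj_mult cj_base)
  ultimately show ?case by simp
qed

text \<open>The conjugate is a root of the same monic integer polynomial, since its coefficients lie
  in \<open>F\<close>.\<close>

lemma cj_algebraic_int:
  assumes z: "z \<in> adj F s" and "algebraic_int z"
  shows "algebraic_int (cj z)"
proof -
  obtain p where p: "Polynomial.lead_coeff p = 1" "\<forall>i. Polynomial.coeff p i \<in> \<int>" "poly p z = 0"
    using assms(2) by (auto elim: algebraic_int.cases)
  have "Polynomial.coeff p i \<in> F" for i
    using p(2) F_intros(11) by (metis Ints_cases)
  then have "cj (poly p z) = poly p (cj z)" using cj_poly[OF z, of p] by blast
  then have "poly p (cj z) = 0" using p(3) cj_base[of 0] F_intros(6) by simp
  then show ?thesis using p by (intro algebraic_int.intros)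
qed

lemma cj_unit:
  assumes "u \<in> unit_group (adj F s)"
  shows "cj u \<in> unit_group (adj F s)" "u * cj u \<in> unit_group F"
proof -
  have u: "u \<in> adj F s" "u \<noteq> 0" "algebraic_int u" "algebraic_int (inverse u)"
    using assms mem_unit_group_iff[OF closed_field_adj] by auto
  have i: "algebraic_int (inverse (cj u))" 
    using cj_algebraic_int[of "inverse u"] u closed_fieldD(3)[OF closed_field_adj] cj_inverse by metis
  have "cj u * cj (inverse u) = 1"
    using cj_mult[OF u(1) closed_fieldD(3)[OF closed_field_adj u(1)]] u(2) cj_base[of 1] F_intros(1) by simp
  then have nz: "cj u \<noteq> 0" by auto
  show "cj u \<in> unit_group (adj F s)"
    using u i nz cj_algebraic_int cj_closed mem_unit_group_iff[OF closed_field_adj] by auto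
  show "u * cj u \<in> unit_group F"
    using u i nz cj_algebraic_int norm_in_base by (auto simp: mem_unit_group_iff F intro!: algebraic_int_mult)
qed

text \<open>In a square (x + y s)^2 that lies in \<open>F\<close>, the mixed coefficient 2 x y must
  vanish. This is one step of Kummer theory.\<close>

lemma square_in_ext:
  assumes "n \<in> F" "n = v ^ 2" "v \<in> adj F s"
  obtains x where "x \<in> F" "n = x ^ 2 \<or> n = x ^ 2 * s ^ 2"
proof -
  obtain x y where v: "x \<in> F" "y \<in> F" "v = x + y * s" using assms(3) by (rule adjE)
  have "n + 0 * s = (x ^ 2 + y ^ 2 * s ^ 2) + (2 * x * y) * s"
    using assms(2) v by (simp add: algebra_simps power2_eq_square)
  then have "n = x ^ 2 + y ^ 2 * s ^ 2 \<and> 0 = 2 * x * y"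
    by (rule coords_unique) (use v assms s2 in \<open>auto intro!: F_intros\<close>)
  then show ?thesis using v that by auto
qed

end

lemma closed_field_adj:
  assumes "closed_field F" "s ^ 2 \<in> F"
  shows "closed_field (adj F s)"
proof (cases "s \<in> F")
  case True
  then show ?thesis using assms adj_trivial by simp
next
  case False
  then interpret quad_ext F s using assms by unfold_locales
  show ?thesis by (rule closed_field_adj)
qed

lemma rat_adjoin_insert:
  assumes "s ^ 2 \<in> rat_adjoin S"
  shows "rat_adjoin (insert s S) = adj (rat_adjoin S) s"
proof
  note c = closed_field_intros[OF closed_field_rat_adjoin]
  have 1: "rat_adjoin S \<subseteq> adj (rat_adjoin S) s"
  proof
    fix x assume "x \<in> rat_adjoin S"
    then show "x \<in> adj (rat_adjoin S) s" using adjI[of x _ 0 s] c by simp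
  qed
  have 2: "s \<in> adj (rat_adjoin S) s" using adjI[of 0 "rat_adjoin S" 1 s] c by simp
  show "rat_adjoin (insert s S) \<subseteq> adj (rat_adjoin S) s"
  proof (rule rat_adjoin_subset)
    show "closed_field (adj (rat_adjoin S) s)"
      by (rule closed_field_adj[OF closed_field_rat_adjoin assms])
    show "insert s S \<subseteq> adj (rat_adjoin S) s"
      using 1 2 rat_adjoin_incl[of S] by blast
  qed
  have "rat_adjoin S \<subseteq> rat_adjoin (insert s S)" by (rule rat_adjoin_mono) auto
  moreover have "s \<in> rat_adjoin (insert s S)" using rat_adjoin_incl by blast
  ultimately show "adj (rat_adjoin S) s \<subseteq> rat_adjoin (insert s S)"
    using closed_fieldD(4,5)[OF closed_field_rat_adjoin[of "insert s S"]]
    unfolding adj_def by blast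
qed

text \<open>Let \<sigma> and \<tau> negate t and s. The norm N = u \<sigma>(u) satisfies \<tau>(N) =
  \<tau>(u) \<tau>\<sigma>(u), so u^2 is the product of the inverse of \<tau>(N), of u \<tau>(u) and
  of u \<tau>\<sigma>(u). The norm down to \<open>F\<close> is thus absorbed into the first
  factor.\<close>

lemma biquadratic_unit_square:
  assumes F: "closed_field F" and s: "s ^ 2 \<in> F" and t: "t ^ 2 \<in> F"
    and n1: "s \<notin> adj F t" and n2: "t \<notin> adj F s" and n3: "s \<notin> adj F (s * t)"
    and u: "u \<in> unit_group (adj (adj F s) t)"
  obtains a b c where "a \<in> unit_group (adj F s)" "b \<in> unit_group (adj F t)"
    "c \<in> unit_group (adj F (s * t))" "u ^ 2 = a * b * c"
proof -
  note FI = closed_field_intros[OF F]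
  have base: "x \<in> adj F r" if "x \<in> F" for x r
    using adjI[OF that FI(6)] by simp
  have gen: "r \<in> adj F r" for r using adjI[OF FI(6) FI(1)] by simp
  have st2: "(s * t) ^ 2 \<in> F" unfolding power_mult_distrib using s t by (rule FI(5))
  interpret S: quad_ext F s using base n1 by (intro quad_ext.intro F s) auto
  interpret ST: quad_ext "adj F s" t
    by (intro quad_ext.intro closed_field_adj[OF F s] base[OF t] n2)
  interpret TS: quad_ext "adj F t" s
    by (intro quad_ext.intro closed_field_adj[OF F t] base[OF s] n1)
  interpret PS: quad_ext "adj F (s * t)" s
    by (intro quad_ext.intro closed_field_adj[OF F st2] base[OF s] n3)
  have s0: "s \<noteq> 0" using S.s_notin FI(6) by auto
  have "u \<in> adj (adj F s) t" using u mem_unit_group_iff[OF ST.closed_field_adj] by simp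
  then obtain x y z w where h: "x \<in> F" "y \<in> F" "z \<in> F" "w \<in> F"
    and ue: "u = (x + y * s) + (z + w * s) * t" by (auto elim!: adjE)
  have uT: "u = (x + z * t) + (y + w * t) * s" by (simp add: ue algebra_simps)
  \<comment> \<open>Over F(s t) the summand z t has to appear as a multiple of s: z t = (z / s^2) (s
    t) s.\<close>
  have zt: "(y + (z / s ^ 2) * (s * t)) * s = y * s + z * t"
    using s0 by (simp add: distrib_right power2_eq_square)
  have uP: "u = (x + w * (s * t)) + (y + (z / s ^ 2) * (s * t)) * s"
    unfolding zt by (simp add: ue algebra_simps)
  have zs: "z / s ^ 2 \<in> F" by (rule FI(8)[OF h(3) s])
  have inT: "u \<in> adj (adj F t) s" unfolding uT using h by (intro adjI)
  have inP: "u \<in> adj (adj F (s * t)) s" unfolding uP using h zs by (intro adjI)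
  have u': "u \<in> unit_group (adj (adj F t) s)" "u \<in> unit_group (adj (adj F (s * t)) s)"
    using u inT inP mem_unit_group_iff[OF ST.closed_field_adj] mem_unit_group_iff[OF TS.closed_field_adj]
      mem_unit_group_iff[OF PS.closed_field_adj] by simp_all
  have cS: "ST.cj u = (x + y * s) - (z + w * s) * t"
    unfolding ue using h by (intro ST.cj_eq adjI)
  have cT: "TS.cj u = (x + z * t) - (y + w * t) * s"
    unfolding uT using h by (intro TS.cj_eq adjI)
  have cP: "PS.cj u = (x + w * (s * t)) - (y + (z / s ^ 2) * (s * t)) * s"
    unfolding uP using h zs by (intro PS.cj_eq adjI)
  have cP': "PS.cj u = (x + w * (s * t)) - (y * s + z * t)"
    unfolding cP zt ..
  define N where "N = u * ST.cj u"
  have NU: "N \<in> unit_group (adj F s)" unfolding N_def by (rule ST.cj_unit(2)[OF u])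
  have Ne: "N = (x ^ 2 + y ^ 2 * s ^ 2 - (z ^ 2 + w ^ 2 * s ^ 2) * t ^ 2) + (2 * x * y - 2 * z * w * t ^ 2) * s"
    unfolding N_def cS unfolding ue by (simp add: algebra_simps power2_eq_square)
  have cN: "S.cj N = (x ^ 2 + y ^ 2 * s ^ 2 - (z ^ 2 + w ^ 2 * s ^ 2) * t ^ 2) - (2 * x * y - 2 * z * w * t ^ 2) * s"
    unfolding Ne using h s t by (intro S.cj_eq) (blast intro: FI)+
  have cNU: "S.cj N \<in> unit_group (adj F s)" by (rule S.cj_unit(1)[OF NU])
  then have cNU': "S.cj N \<noteq> 0" "inverse (S.cj N) \<in> unit_group (adj F s)"
    using closed_fieldD(3)[OF S.closed_field_adj] mem_unit_group_iff[OF S.closed_field_adj] by auto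
  have "S.cj N = TS.cj u * PS.cj u"
    unfolding cN cT cP' by (simp add: algebra_simps power2_eq_square)
  then have "u ^ 2 = inverse (S.cj N) * (u * TS.cj u) * (u * PS.cj u)"
    using cNU'(1) by (simp add: power2_eq_square field_simps)
  then show ?thesis
    using that[OF cNU'(2) TS.cj_unit(2)[OF u'(1)] PS.cj_unit(2)[OF u'(2)]] by blast
qed

subsection \<open>Multiquadratic fields\<close>

text \<open>\<open>csqrt\<close> treats radicands of both signs uniformly: \<open>rt d\<close> is a
  nonnegative real, or a positive multiple of \<i> for negative \<open>d\<close>.\<close>

definition rt :: "int \<Rightarrow> complex" where "rt d = csqrt (of_int d)"

lemma rt_square [simp]: "rt d ^ 2 = of_int d" "rt d * rt d = of_int d"
  by (simp_all add: rt_def flip: power2_eq_square)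

lemma rt_nonneg: "d \<ge> 0 \<Longrightarrow> rt d = of_real (sqrt (of_int d))"
  unfolding rt_def using of_real_sqrt[of "of_int d"] by simp

text \<open>On the principal branch the product rule gains a sign when both radicands are negative,
  so one of them is kept nonnegative.\<close>

lemma rt_mult: "d \<ge> 0 \<Longrightarrow> rt (d * e) = rt d * rt e"
proof -
  assume d: "d \<ge> 0"
  show ?thesis
  proof (cases "e \<ge> 0")
    case True
    then show ?thesis using d by (simp add: rt_nonneg real_sqrt_mult)
  next
    case False
    have neg: "rt k = \<i> * of_real (sqrt (of_int (- k)))" if "k \<le> 0" for k
      unfolding rt_def using csqrt_of_real_nonpos[of "of_int k"] that by simp
    have "d * e \<le> 0" using d False by (simp add: mult_nonneg_nonpos)
    then show ?thesis using d False neg[of "d * e"] neg[of e]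
      real_sqrt_mult[of "of_int d" "- of_int e"] by (simp add: rt_nonneg)
  qed
qed

definition QF :: "int set \<Rightarrow> complex set" where "QF D = rat_adjoin (rt ` D)"

lemma closed_field_QF: "closed_field (QF D)"
  by (simp add: QF_def closed_field_rat_adjoin)

lemmas QF_intros = closed_field_intros[OF closed_field_QF]

lemma rt_in_QF: "d \<in> D \<Longrightarrow> rt d \<in> QF D"
  unfolding QF_def by (rule subsetD[OF rat_adjoin_incl]) simp

lemma QF_insert: "QF (insert d D) = adj (QF D) (rt d)"
proof -
  have "rt d ^ 2 \<in> rat_adjoin (rt ` D)" using closed_field_more(6)[OF closed_field_rat_adjoin] by simp
  then show ?thesis unfolding QF_def image_insert by (rule rat_adjoin_insert)
qed

lemma QF_empty: "QF {} = \<rat>" by (simp add: QF_def rat_adjoin_empty)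

lemma QF_mono: "D \<subseteq> D' \<Longrightarrow> QF D \<subseteq> QF D'"
  unfolding QF_def by (rule rat_adjoin_mono) auto

text \<open>Removing one radicand d at a time, \<open>square_in_ext\<close> leaves n or n / d as a
  square one level lower; the radicands collected on the way form \<open>S\<close>. Over \<rat> a
  square root of an integer is an integer.\<close>

lemma kummer_QF:
  assumes "finite D" "0 \<notin> D" "n \<noteq> 0" "of_int n = v ^ 2" "v \<in> QF D"
  shows "\<exists>S\<subseteq>D. \<exists>k. n * \<Prod>S = k ^ 2"
  using assms
proof (induction D arbitrary: n v rule: finite_induct)
  case empty
  then have "algebraic_int (v ^ 2)" "v \<in> \<rat>" by (auto simp: QF_empty simp flip: empty.prems(3))
  then have "v \<in> \<int>" using algebraic_int_of_power2 rational_algebraic_int_is_int by blast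
  then obtain k where "v = of_int k" by (rule Ints_cases)
  then have "n = k ^ 2" using empty.prems by (metis of_int_eq_iff of_int_power)
  then show ?case by auto
next
  case (insert d D)
  show ?case
  proof (cases "rt d \<in> QF D")
    case True
    then have "v \<in> QF D" using insert.prems adj_trivial[OF closed_field_QF] by (simp add: QF_insert)
    then obtain S k where "S \<subseteq> D" "n * \<Prod>S = k ^ 2" using insert.IH[of n v] insert.prems by auto
    then show ?thesis by blast
  next
    case False
    then interpret quad_ext "QF D" "rt d"
      using closed_field_QF QF_intros by unfold_locales auto
    have "of_int n \<in> QF D" by (rule QF_intros)
    then obtain x where x: "x \<in> QF D" "of_int n = x ^ 2 \<or> of_int n = x ^ 2 * rt d ^ 2"
      using square_in_ext[of "of_int n" v] insert.prems by (auto simp: QF_insert)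
    from x(2) show ?thesis
    proof
      assume "of_int n = x ^ 2"
      then obtain S k where "S \<subseteq> D" "n * \<Prod>S = k ^ 2" using insert.IH[of n x] insert.prems x by auto
      then show ?thesis by blast
    next
      assume "of_int n = x ^ 2 * rt d ^ 2"
      \<comment> \<open>Multiplying by d instead of dividing keeps the number an integer.\<close>
      then have "of_int (n * d) = (x * of_int d) ^ 2" by (simp add: power2_eq_square)
      moreover have "x * of_int d \<in> QF D" by (rule QF_intros(5)[OF x(1) QF_intros(11)])
      ultimately obtain S k where S: "S \<subseteq> D" "n * d * \<Prod>S = k ^ 2"
        using insert.IH[of "n * d" "x * of_int d"] insert.prems by auto
      have "finite S" "d \<notin> S" using S insert.hyps finite_subset[of S D] by auto
      then have "n * \<Prod>(insert d S) = k ^ 2" using S by (simp add: mult.assoc)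
      then show ?thesis using S by blast
    qed
  qed
qed

text \<open>Sign characters of \<open>\<rat>\<^sup>*\<close> modulo squares stand in for Galois automorphisms: they certify
  that a radicand is independent of others.\<close>

definition mult_char :: "(int \<Rightarrow> int) \<Rightarrow> bool" where
  "mult_char \<phi> \<longleftrightarrow> (\<forall>a b. a \<noteq> 0 \<longrightarrow> b \<noteq> 0 \<longrightarrow> \<phi> (a * b) = \<phi> a * \<phi> b) \<and> (\<forall>a. a \<noteq> 0 \<longrightarrow> \<phi> a * \<phi> a = 1)"

lemma mult_charD:
  assumes "mult_char \<phi>"
  shows "a \<noteq> 0 \<Longrightarrow> b \<noteq> 0 \<Longrightarrow> \<phi> (a * b) = \<phi> a * \<phi> b" "a \<noteq> 0 \<Longrightarrow> \<phi> a * \<phi> a = 1"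
  using assms by (auto simp: mult_char_def)

lemma mult_char_times: "mult_char \<phi> \<Longrightarrow> mult_char \<psi> \<Longrightarrow> mult_char (\<lambda>n. \<phi> n * \<psi> n)"
proof -
  assume \<phi>: "mult_char \<phi>" and \<psi>: "mult_char \<psi>"
  have "\<phi> a * \<psi> a * (\<phi> a * \<psi> a) = (\<phi> a * \<phi> a) * (\<psi> a * \<psi> a)" for a
    by (simp only: mult_ac)
  then show ?thesis
    unfolding mult_char_def using mult_charD[OF \<phi>] mult_charD[OF \<psi>] by (auto simp: mult_ac)
qed

lemma mult_char_sgn: "mult_char sgn"
  unfolding mult_char_def by (simp add: sgn_mult)

lemma mult_char_valuation:
  assumes "prime_elem (p :: int)"
  shows "mult_char (\<lambda>n. (-1) ^ multiplicity p n)"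
  unfolding mult_char_def using assms
  by (auto simp: prime_elem_multiplicity_mult_distrib power_add simp flip: power_mult_distrib)

lemma mult_char_square: "mult_char \<phi> \<Longrightarrow> k \<noteq> 0 \<Longrightarrow> \<phi> (k ^ 2) = 1"
  by (auto simp: mult_char_def power2_eq_square)

lemma mult_char_prod:
  assumes "mult_char \<phi>" "finite S" "0 \<notin> S" "\<And>e. e \<in> S \<Longrightarrow> \<phi> e = 1"
  shows "\<phi> (\<Prod>S) = 1"
  using assms(2-)
proof (induction rule: finite_induct)
  case empty
  show ?case using assms(1) by (auto simp: mult_char_def) (metis mult.right_neutral one_neq_zero)
next
  case (insert x F)
  have "\<Prod>F \<noteq> 0" using insert by auto
  then show ?case using insert assms(1) by (auto simp: mult_char_def)
qed

text \<open>A root would give d * \<Prod>S = k^2 with S among the radicands of the field; the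
  character is -1 on the left and 1 on the right.\<close>

lemma nonsquare_QF:
  assumes "mult_char \<phi>" "\<phi> d = -1" "\<And>e. e \<in> D \<Longrightarrow> \<phi> e = 1" "finite D" "0 \<notin> D" "d \<noteq> 0" "v \<in> QF D"
  shows "v ^ 2 \<noteq> of_int d"
proof
  assume "v ^ 2 = of_int d"
  then obtain S k where S: "S \<subseteq> D" "d * \<Prod>S = k ^ 2"
    using kummer_QF[of D d v] assms by auto
  have fin: "finite S" "0 \<notin> S" using S assms finite_subset[of S D] by auto
  then have nz: "\<Prod>S \<noteq> 0" by simp
  have "\<phi> (\<Prod>S) = 1" using mult_char_prod[OF assms(1) fin] assms(3) S(1) by blast
  then have "\<phi> (d * \<Prod>S) = -1"
    using assms(2,6) nz mult_charD(1)[OF assms(1)] by simp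
  moreover have "k \<noteq> 0" using S nz assms(6) by auto
  then have "\<phi> (k ^ 2) = 1" by (rule mult_char_square[OF assms(1)])
  ultimately show False by (simp add: S(2))
qed

lemma rt_notin_QF:
  assumes "mult_char \<phi>" "\<phi> d = -1" "\<And>e. e \<in> D \<Longrightarrow> \<phi> e = 1" "finite D" "0 \<notin> D" "d \<noteq> 0"
  shows "rt d \<notin> QF D"
proof
  assume "rt d \<in> QF D"
  from nonsquare_QF[OF assms this] show False by simp
qed

text \<open>The characters \<phi> and \<psi> separate d and e over the field of \<open>D\<close>.
  Their product is -1 on d and 1 on d * e, which settles the third subfield.\<close>

lemma biquadratic_QF:
  assumes D: "finite D" "0 \<notin> D" "d > 0" "e \<noteq> 0"
    and \<phi>: "mult_char \<phi>" "\<phi> d = -1" "\<phi> e = 1" "\<And>x. x \<in> D \<Longrightarrow> \<phi> x = 1"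
    and \<psi>: "mult_char \<psi>" "\<psi> d = 1" "\<psi> e = -1" "\<And>x. x \<in> D \<Longrightarrow> \<psi> x = 1"
    and u: "u \<in> unit_group (QF (insert d (insert e D)))"
  obtains a b c where "a \<in> unit_group (QF (insert d D))" "b \<in> unit_group (QF (insert e D))"
    "c \<in> unit_group (QF (insert (d * e) D))" "u ^ 2 = a * b * c"
proof -
  have de: "rt (d * e) = rt d * rt e" using D by (simp add: rt_mult)
  show ?thesis
  proof (rule biquadratic_unit_square[of "QF D" "rt d" "rt e" u])
    show "rt d \<notin> adj (QF D) (rt e)"
      unfolding QF_insert[symmetric] by (rule rt_notin_QF[OF \<phi>(1,2)]) (use D \<phi> in auto)
    show "rt e \<notin> adj (QF D) (rt d)"
      unfolding QF_insert[symmetric] by (rule rt_notin_QF[OF \<psi>(1,3)]) (use D \<psi> in auto)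
    have de1: "\<phi> (d * e) = -1" "\<psi> (d * e) = -1"
      using D(3,4) \<phi>(2,3) \<psi>(2,3) mult_charD(1)[OF \<phi>(1), of d e] mult_charD(1)[OF \<psi>(1), of d e] by simp_all
    show "rt d \<notin> adj (QF D) (rt d * rt e)"
      unfolding QF_insert[symmetric] de[symmetric]
      by (rule rt_notin_QF[OF mult_char_times[OF \<phi>(1) \<psi>(1)]]) (use D \<phi> \<psi> de1 in auto)
    show "u \<in> unit_group (adj (adj (QF D) (rt d)) (rt e))"
      using u by (simp add: insert_commute[of d e] QF_insert)
    fix a b c
    assume "a \<in> unit_group (adj (QF D) (rt d))" "b \<in> unit_group (adj (QF D) (rt e))"
      "c \<in> unit_group (adj (QF D) (rt d * rt e))" "u\<^sup>2 = a * b * c"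
    then show thesis by (intro that[of a b c]) (simp_all add: QF_insert de)
  qed (use closed_field_QF QF_intros in auto)
qed

subsection \<open>Pell's equation\<close>

text \<open>Infinitely many good approximations h / k of \<surd>m give values h^2 - m k^2 in a
  bounded range. Two of them with the same value N that are congruent modulo N have a quotient of
  norm 1 with integral coordinates.\<close>

lemma pell_solution_exists:
  assumes irr: "sqrt (real m) \<notin> \<rat>"
  obtains x y :: int where "x ^ 2 - int m * y ^ 2 = 1" "y \<noteq> 0"
proof -
  let ?w = "sqrt (real m)"
  define f where "f = (\<lambda>(h, k). h ^ 2 - int m * k ^ 2)"
  \<comment> \<open>Equal images mean equal norm N and congruent coordinates modulo N, the condition
    under which the quotient is integral.\<close>
  define g where "g = (\<lambda>(h, k). (f (h, k), h mod f (h, k), k mod f (h, k)))"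
  \<comment> \<open>As \<bar>h - k \<surd>m\<bar> < 1 / k and \<bar>h + k \<surd>m\<bar> \<le> 1 + 2
    k \<surd>m, the product is at most 1 + 2 \<surd>m.\<close>
  define B where "B = \<lceil>2 * ?w + 1\<rceil>"
  have f_eq: "real_of_int (f (h, k)) = (of_int h - of_int k * ?w) * (of_int h + of_int k * ?w)" for h k
    by (simp add: f_def algebra_simps power2_eq_square)
  have bound: "\<bar>f (h, k)\<bar> \<le> B" if "(h, k) \<in> approx_set ?w" for h k
  proof -
    have k: "k > 0" and d: "\<bar>?w - of_int h / of_int k\<bar> < 1 / (of_int k)\<^sup>2"
      using that by (auto simp: approx_set_def)
    define e where "e = of_int h - of_int k * ?w"
    have "\<bar>e\<bar> = of_int k * \<bar>?w - of_int h / of_int k\<bar>"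
      using k by (simp add: e_def abs_mult_pos' field_simps abs_minus_commute flip: abs_mult_pos)
    also have "\<dots> < of_int k * (1 / (of_int k)\<^sup>2)"
      using k d by (intro mult_strict_left_mono) auto
    finally have e: "\<bar>e\<bar> < 1 / of_int k" using k by (simp add: power2_eq_square)
    have k1: "1 / real_of_int k \<le> 1" using k by (simp add: field_simps)
    then have e1: "\<bar>e\<bar> \<le> 1" using e by linarith
    have "\<bar>of_int h + of_int k * ?w\<bar> = \<bar>e + 2 * of_int k * ?w\<bar>"
      by (simp add: e_def)
    also have "\<dots> \<le> 1 + 2 * of_int k * ?w"
      using e1 k abs_triangle_ineq[of e "2 * of_int k * ?w"] by (simp add: abs_mult)
    finally have s: "\<bar>of_int h + of_int k * ?w\<bar> \<le> 1 + 2 * of_int k * ?w" .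
    have "\<bar>real_of_int (f (h, k))\<bar> = \<bar>e\<bar> * \<bar>of_int h + of_int k * ?w\<bar>"
      by (simp add: f_eq e_def abs_mult)
    also have "\<dots> \<le> 1 / of_int k * (1 + 2 * of_int k * ?w)"
      using e s k by (intro mult_mono) auto
    also have "\<dots> = 1 / of_int k + 2 * ?w" using k by (simp add: distrib_left)
    also have "\<dots> \<le> 1 + 2 * ?w" using k1 by simp
    also have "\<dots> \<le> of_int B" unfolding B_def by linarith
    finally show ?thesis by linarith
  qed
  have fnz: "f (h, k) \<noteq> 0" if "(h, k) \<in> approx_set ?w" for h k
  proof
    have k: "k > 0" using that by (auto simp: approx_set_def)
    assume "f (h, k) = 0"
    then have "of_int h = of_int k * ?w \<or> of_int h = - of_int k * ?w"
      using f_eq[of h k] by auto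
    then have "?w = of_int h / of_int k \<or> ?w = - of_int h / of_int k"
      using k by (auto simp: field_simps)
    then show False using irr by auto
  qed
  have inf: "infinite (approx_set ?w)"
    using irr rational_iff_finite_approx_set by blast
  have "g ` approx_set ?w \<subseteq> {-B..B} \<times> {-B..B} \<times> {-B..B}"
  proof
    fix z assume "z \<in> g ` approx_set ?w"
    then obtain h k where hk: "(h, k) \<in> approx_set ?w" "z = g (h, k)" by auto
    have "\<bar>a mod f (h, k)\<bar> \<le> \<bar>f (h, k)\<bar>" for a
      using abs_mod_less[OF fnz[OF hk(1)], of a] by simp
    then have "a mod f (h, k) \<in> {-B..B}" for a
      using bound[OF hk(1)] by (smt (verit) atLeastAtMost_iff)
    moreover have "f (h, k) \<in> {-B..B}" using bound[OF hk(1)] by (simp add: abs_le_iff)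
    ultimately show "z \<in> {-B..B} \<times> {-B..B} \<times> {-B..B}"
      unfolding hk(2) g_def by simp
  qed
  then have "finite (g ` approx_set ?w)" by (rule finite_subset) auto
  then obtain a where a: "a \<in> approx_set ?w" "infinite {b \<in> approx_set ?w. g b = g a}"
    using pigeonhole_infinite[OF inf] by blast
  obtain b where b: "b \<in> approx_set ?w" "g b = g a" "b \<noteq> a"
  proof -
    have "infinite ({b \<in> approx_set ?w. g b = g a} - {a})" using a(2) by simp
    then have "{b \<in> approx_set ?w. g b = g a} - {a} \<noteq> {}" by (metis finite.emptyI)
    then show ?thesis using that by blast
  qed
  obtain h k where hk: "a = (h, k)" by (cases a)
  obtain h' k' where hk': "b = (h', k')" by (cases b)
  define N where "N = f (h, k)"
  have N: "h ^ 2 - int m * k ^ 2 = N" by (simp add: N_def f_def)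
  have N': "h' ^ 2 - int m * k' ^ 2 = N" "h' mod N = h mod N" "k' mod N = k mod N"
    using b(2) by (auto simp: g_def hk hk' N_def f_def)
  have N0: "N \<noteq> 0" using fnz a(1) by (simp add: hk N_def)
  have kpos: "k > 0" "k' > 0" using a(1) b(1) by (auto simp: hk hk' approx_set_def)
  have d1: "N dvd h' - h" "N dvd k' - k" using N' by (simp_all add: mod_eq_dvd_iff)
  have "h * h' - int m * k * k' = N + (h * (h' - h) - int m * k * (k' - k))"
    using N by (simp add: algebra_simps power2_eq_square)
  then have "N dvd h * h' - int m * k * k'" using d1 by simp
  then obtain A where A: "h * h' - int m * k * k' = N * A" by blast
  have "h * k' - h' * k = h * (k' - k) - (h' - h) * k" by (simp add: algebra_simps)
  then have "N dvd h * k' - h' * k" using d1 by simp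
  then obtain C where C: "h * k' - h' * k = N * C" by blast
  \<comment> \<open>Multiplicativity of the norm, for (h - k \<surd>m) (h' + k' \<surd>m).\<close>
  have "(h * h' - int m * k * k') ^ 2 - int m * (h * k' - h' * k) ^ 2
      = (h ^ 2 - int m * k ^ 2) * (h' ^ 2 - int m * k' ^ 2)"
    by (simp add: algebra_simps power2_eq_square)
  then have "N ^ 2 * (A ^ 2 - int m * C ^ 2) = N ^ 2 * 1"
    unfolding A C N N'(1) by (simp add: algebra_simps power2_eq_square)
  then have pell: "A ^ 2 - int m * C ^ 2 = 1" using N0 by simp
  \<comment> \<open>A vanishing C makes the two pairs proportional, and equal norms then make them
    equal.\<close>
  have "C \<noteq> 0"
  proof
    assume "C = 0"
    then have e: "h * k' = h' * k" using C by simp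
    have "N * k' ^ 2 = (h * k') ^ 2 - int m * k ^ 2 * k' ^ 2"
      unfolding N[symmetric] by (simp add: algebra_simps)
    also have "\<dots> = N * k ^ 2"
      unfolding e N'(1)[symmetric] by (simp add: algebra_simps)
    finally have "k' ^ 2 = k ^ 2" using N0 by simp
    then have "k' = k" using kpos by (simp add: power2_eq_iff_nonneg)
    then have "h = h'" using e kpos by simp
    then show False using b(3) \<open>k' = k\<close> by (simp add: hk hk')
  qed
  then show ?thesis using that pell by blast
qed

subsection \<open>Units of quadratic fields\<close>

text \<open>Trace and norm are rational algebraic integers, hence integers, and the norm is
  invertible. The coordinates may still be half-integral; this is resolved later by
  congruences.\<close>

lemma quadratic_unit_form:
  assumes d: "rt d \<notin> \<rat>" and u: "u \<in> unit_group (QF {d})"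
  obtains x y :: real and t n :: int where "x \<in> \<rat>" "y \<in> \<rat>" "u = of_real x + of_real y * rt d"
    "2 * x = of_int t" "x ^ 2 - of_int d * y ^ 2 = of_int n" "\<bar>n\<bar> = 1"
proof -
  have clR: "closed_field \<rat>" using closed_field_QF[of "{}"] by (simp add: QF_empty)
  interpret quad_ext "\<rat>" "rt d"
    using d by (intro quad_ext.intro clR) auto
  have E: "QF {d} = adj \<rat> (rt d)" using QF_insert[of d "{}"] by (simp add: QF_empty)
  have u': "u \<in> unit_group (adj \<rat> (rt d))" using u E by simp
  then have ui: "u \<in> adj \<rat> (rt d)" "algebraic_int u"
    using mem_unit_group_iff[OF closed_field_adj] by auto
  from ui(1) obtain x y where xy: "x \<in> \<rat>" "y \<in> \<rat>" "u = x + y * rt d" by (rule adjE)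
  have re: "z = of_real (Re z)" "Re z \<in> \<rat>" if "z \<in> \<rat>" for z :: complex
    using that by (auto elim!: Rats_cases')
  have c: "cj u = x - y * rt d" unfolding xy(3) using xy by (intro cj_eq)
  have ci: "algebraic_int (cj u)" by (rule cj_algebraic_int[OF ui])
  have "algebraic_int (u + cj u)" by (rule algebraic_int_add[OF ui(2) ci])
  moreover have "u + cj u = 2 * x" unfolding c unfolding xy(3) by simp
  moreover have "2 * x \<in> \<rat>" using xy by simp
  ultimately obtain t where t: "2 * x = of_int t"
    using rational_algebraic_int_is_int by (metis Ints_cases)
  have N: "u * cj u = x ^ 2 - of_int d * y ^ 2"
    unfolding c unfolding xy(3) using rt_square(1)[of d] by (simp add: algebra_simps power2_eq_square)
  have nu: "u * cj u \<in> unit_group \<rat>" by (rule cj_unit(2)[OF u'])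
  then have nu': "u * cj u \<in> \<rat>" "algebraic_int (u * cj u)" "algebraic_int (inverse (u * cj u))" "u * cj u \<noteq> 0"
    using mem_unit_group_iff[OF clR] by auto
  then obtain n where n: "u * cj u = of_int n" using rational_algebraic_int_is_int by (metis Ints_cases)
  have "inverse (u * cj u) \<in> \<rat>" by (rule Rats_inverse[OF nu'(1)])
  then obtain n' where n': "inverse (u * cj u) = of_int n'"
    using nu'(3) rational_algebraic_int_is_int by (metis Ints_cases)
  have "(of_int (n * n') :: complex) = 1" using n n' nu'(4) by (metis of_int_mult right_inverse)
  then have "n * n' = 1" by (metis of_int_eq_1_iff)
  then have "\<bar>n\<bar> = 1" using zmult_eq_1_iff by auto
  moreover have "2 * Re x = of_int t" using arg_cong[OF t, of Re] by simp
  moreover have "(of_real ((Re x) ^ 2 - of_int d * (Re y) ^ 2) :: complex) = of_real (of_int n)"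
    using N n re(1)[OF xy(1)] re(1)[OF xy(2)] by simp
  then have "(Re x) ^ 2 - of_int d * (Re y) ^ 2 = of_int n" by (simp only: of_real_eq_iff)
  ultimately show ?thesis
    using that[of "Re x" "Re y" t n] xy re by auto
qed

lemma algebraic_int_rt: "algebraic_int (rt d)"
  by (rule algebraic_int_of_power2) (simp add: int_imp_algebraic_int)

lemma algebraic_int_of_int: "algebraic_int (of_int k :: complex)"
  by (simp add: int_imp_algebraic_int)

lemma quadratic_unit_intro:
  assumes "x ^ 2 - d * y ^ 2 = 1"
  shows "of_int x + of_int y * rt d \<in> unit_group (QF {d})"
proof -
  let ?u = "of_int x + of_int y * rt d" and ?v = "of_int x + of_int (-y) * rt d"
  have "?u * ?v = of_int (x ^ 2 - d * y ^ 2)"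
    using rt_square(1)[of d] by (simp add: algebra_simps power2_eq_square)
  then have uv: "?u * ?v = 1" using assms by simp
  then have i: "inverse ?u = ?v" by (rule inverse_unique)
  have "?u \<noteq> 0" using uv by auto
  moreover have "?u \<in> QF {d}" using rt_in_QF[of d "{d}"] by (intro QF_intros) auto
  moreover have "algebraic_int ?u" "algebraic_int ?v"
    by (intro algebraic_int_add algebraic_int_mult algebraic_int_rt algebraic_int_of_int)+
  ultimately show ?thesis unfolding mem_unit_group_iff[OF closed_field_QF] using i by simp
qed

lemma unit_group_closed:
  assumes F: "closed_field F"
  shows "1 \<in> unit_group F" "u \<in> unit_group F \<Longrightarrow> v \<in> unit_group F \<Longrightarrow> u * v \<in> unit_group F"
    "u \<in> unit_group F \<Longrightarrow> inverse u \<in> unit_group F" "u \<in> unit_group F \<Longrightarrow> - u \<in> unit_group F"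
    "u \<in> unit_group F \<Longrightarrow> u powi k \<in> unit_group F"
proof -
  note m = mem_unit_group_iff[OF F] and c = closed_fieldD[OF F]
  show one: "1 \<in> unit_group F" unfolding m using c by simp
  show mu: "u * v \<in> unit_group F" if "u \<in> unit_group F" "v \<in> unit_group F" for u v
    using that unfolding m by (auto intro: c algebraic_int_mult)
  show inv: "inverse u \<in> unit_group F" if "u \<in> unit_group F" for u
    using that unfolding m by (auto intro: c)
  show "- u \<in> unit_group F" if "u \<in> unit_group F"
    using that unfolding m by (auto intro: c)
  have pw: "u ^ n \<in> unit_group F" if "u \<in> unit_group F" for u n
    using that by (induction n) (auto intro: one mu)
  show "u powi k \<in> unit_group F" if "u \<in> unit_group F"
    unfolding power_int_def using that pw inv by auto
qed

text \<open>Such a unit is a root of X^2 - t X + n with n = 1 or n = -1, and its conjugate has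
  absolute value 1 / u < 1, which bounds t. Hence there is a least unit above 1 as soon as there is
  any.\<close>

lemma finite_units_bounded:
  assumes d: "rt (int m) \<notin> \<rat>"
  shows "finite {u :: real. 1 < u \<and> u \<le> B \<and> of_real u \<in> unit_group (QF {int m})}" (is "finite ?S")
proof -
  define b where "b = \<lceil>B + 1\<rceil>"
  have "?S \<subseteq> (\<Union>(t, n)\<in>{-b..b} \<times> {-1, 1}. {u. poly [:of_int n, - of_int t, 1:] u = 0})"
  proof
    fix u assume u: "u \<in> ?S"
    then have un: "of_real u \<in> unit_group (QF {int m})" by blast
    obtain x y :: real and t n :: int where "x \<in> \<rat>" "y \<in> \<rat>"
      and h: "complex_of_real u = of_real x + of_real y * rt (int m)" "2 * x = of_int t"
        "x ^ 2 - of_int (int m) * y ^ 2 = of_int n" "\<bar>n\<bar> = 1"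
      by (rule quadratic_unit_form[OF d un])
    have "complex_of_real u = of_real (x + y * sqrt m)" using h(1) by (simp add: rt_nonneg)
    then have ux: "u = x + y * sqrt m" by (simp only: of_real_eq_iff)
    have "of_int n = u * (2 * x - u)"
      unfolding ux using h(3) by (simp add: algebra_simps power2_eq_square)
    then have q: "of_int n = u * (of_int t - u)" by (simp only: h(2))
    have "\<bar>of_int n :: real\<bar> = 1" using h(4) by linarith
    then have "u * \<bar>of_int t - u\<bar> = 1" using u by (simp add: q abs_mult)
    then have "\<bar>of_int t - u\<bar> = 1 / u" using u by (simp add: field_simps)
    moreover have "1 / u \<le> 1" using u by simp
    ultimately have "\<bar>of_int t - u\<bar> \<le> 1" by linarith
    then have "\<bar>of_int t :: real\<bar> \<le> B + 1" using u by auto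
    then have "\<bar>t\<bar> \<le> b" unfolding b_def by linarith
    moreover have "n = -1 \<or> n = 1" using h(4) by linarith
    moreover have "poly [:of_int n, - of_int t, 1:] u = 0" using q by (simp add: algebra_simps)
    ultimately show "u \<in> (\<Union>(t, n)\<in>{-b..b} \<times> {-1, 1}. {u. poly [:of_int n, - of_int t, 1:] u = 0})"
      by (intro UN_I[of "(t, n)"]) (auto simp: abs_le_iff)
  qed
  moreover have "finite (\<Union>(t, n)\<in>{-b..b} \<times> {-1, 1}. {u :: real. poly [:of_int n, - of_int t, 1:] u = 0})"
  proof (intro finite_UN_I)
    fix z :: "int \<times> int"
    show "finite (case z of (t, n) \<Rightarrow> {u :: real. poly [:of_int n, - of_int t, 1:] u = 0})"
      by (cases z) (simp add: poly_roots_finite del: poly_pCons)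
  qed simp
  ultimately show ?thesis by (rule finite_subset)
qed

lemma mult_span_neg1:
  assumes "e \<noteq> 0"
  shows "mult_span {-1, e} = {e powi k | k. True} \<union> {- (e powi k) | k. True}"
proof -
  have pm: "(-1 :: complex) powi j = 1 \<or> (-1 :: complex) powi j = -1" for j :: int
    by (cases "even j") (auto simp: power_int_minus_left)
  have 1: "mult_span {e} = {e powi k | k. True}"
    using mult_span_insert[of "{}" e] assms by (auto simp: mult_span_empty)
  have "mult_span {-1, e} = {(-1) powi j * x | j x. x \<in> mult_span {e}}"
    using assms by (intro mult_span_insert) auto
  also have "\<dots> = {e powi k | k. True} \<union> {- (e powi k) | k. True}" (is "?L = ?R")
  proof
    show "?L \<subseteq> ?R" unfolding 1 using pm by (auto, metis mult_1 mult_minus1)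
    have "e powi k = (-1) powi 0 * (e powi k)" "- (e powi k) = (-1) powi 1 * (e powi k)" for k
      by simp_all
    then show "?R \<subseteq> ?L" unfolding 1 by blast
  qed
  finally show ?thesis .
qed

text \<open>The least unit above 1 exists by Pell's equation and finiteness, and every positive unit
  is a power of it. This shows that the definite description in \<open>fundamental_unit\<close> has
  a unique referent.\<close>

lemma fundamental_unit:
  assumes d: "rt (int m) \<notin> \<rat>"
  shows "fundamental_unit m > 1"
    "unit_group (QF {int m}) = mult_span {-1, of_real (fundamental_unit m)}"
proof -
  define U where "U = unit_group (QF {int m})"
  note Uc = unit_group_closed[OF closed_field_QF[of "{int m}"], folded U_def]
  define S where "S = {u :: real. 1 < u \<and> of_real u \<in> U}"
  have "sqrt (real m) \<notin> \<rat>"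
  proof
    assume "sqrt (real m) \<in> \<rat>"
    then have "complex_of_real (sqrt (real m)) \<in> \<rat>" by (auto elim!: Rats_cases')
    then show False using d by (simp add: rt_nonneg)
  qed
  then obtain x y where xy: "x ^ 2 - int m * y ^ 2 = 1" "y \<noteq> 0" by (rule pell_solution_exists)
  have m0: "m > 0" using d by (cases m) (auto simp: rt_def)
  have "x \<noteq> 0"
  proof
    assume "x = 0"
    moreover have "int m * y ^ 2 \<ge> 0" by (intro mult_nonneg_nonneg) auto
    ultimately show False using xy(1) by (simp only: zero_power2)
  qed
  then have x1: "\<bar>x\<bar> \<ge> 1" by linarith
  define u0 where "u0 = of_int \<bar>x\<bar> + of_int \<bar>y\<bar> * sqrt (real m)"
  have "of_int \<bar>x\<bar> + of_int \<bar>y\<bar> * rt (int m) \<in> U"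
    unfolding U_def using xy by (intro quadratic_unit_intro) simp
  moreover have "complex_of_real u0 = of_int \<bar>x\<bar> + of_int \<bar>y\<bar> * rt (int m)"
    by (simp add: u0_def rt_nonneg del: of_int_abs)
  ultimately have u0U: "of_real u0 \<in> U" by simp
  have "real_of_int \<bar>y\<bar> * sqrt (real m) > 0" using xy m0 by simp
  then have u01: "u0 > 1" unfolding u0_def using x1 by linarith
  define T where "T = {u \<in> S. u \<le> u0}"
  have "T = {u. 1 < u \<and> u \<le> u0 \<and> of_real u \<in> unit_group (QF {int m})}"
    by (auto simp: T_def S_def U_def)
  then have finT: "finite T" using finite_units_bounded[OF d, of u0] by simp
  have u0T: "u0 \<in> T" using u0U u01 by (simp add: T_def S_def)
  define \<epsilon> where "\<epsilon> = Min T"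
  have \<epsilon>T: "\<epsilon> \<in> T" unfolding \<epsilon>_def using finT u0T by (intro Min_in) auto
  have \<epsilon>_le: "\<epsilon> \<le> u" if "u \<in> S" for u
  proof (cases "u \<le> u0")
    case True
    then show ?thesis unfolding \<epsilon>_def using that finT by (intro Min_le) (auto simp: T_def)
  next
    case False
    then show ?thesis using \<epsilon>T by (auto simp: T_def)
  qed
  have \<epsilon>: "\<epsilon> > 1" "of_real \<epsilon> \<in> U" using \<epsilon>T by (auto simp: T_def S_def)
  have pos_case: "\<exists>k. v = \<epsilon> powi k" if v: "v > 0" "of_real v \<in> U" for v :: real
  proof -
    \<comment> \<open>Dividing by this power moves v into the interval from 1 to \<epsilon>, where
      minimality leaves only 1.\<close>
    define k where "k = \<lfloor>log \<epsilon> v\<rfloor>"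
    define w where "w = v * \<epsilon> powi (- k)"
    have pk: "\<epsilon> powi j = \<epsilon> powr (of_int j)" for j using \<epsilon> by (simp add: powr_real_of_int')
    have "of_real w \<in> U" unfolding w_def using v \<epsilon> Uc(2,5) by (simp add: of_real_power_int[symmetric] del: of_real_power_int)
       (metis Uc(2) Uc(5) of_real_power_int)
    moreover have "w = \<epsilon> powr (log \<epsilon> v - of_int k)"
      using v \<epsilon> by (simp add: w_def pk powr_diff powr_minus field_simps)
    then have w: "1 \<le> w" "w < \<epsilon>"
      using \<epsilon> powr_less_mono[of "log \<epsilon> v - of_int k" 1 \<epsilon>] ge_one_powr_ge_zero[of \<epsilon> "log \<epsilon> v - of_int k"]
      unfolding k_def by (auto simp: floor_less_iff) linarith+
    ultimately have "w = 1" using \<epsilon>_le[of w] by (force simp: S_def)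
    then have "v = \<epsilon> powi k" using \<epsilon> by (simp add: w_def power_int_minus field_simps)
    then show ?thesis by blast
  qed
  have realU: "\<exists>v. u = of_real v" if "u \<in> U" for u
    using quadratic_unit_form[OF d that[unfolded U_def]] by (metis of_real_add of_real_mult rt_nonneg of_nat_0_le_iff)
  have Ueq: "U = mult_span {-1, of_real \<epsilon>}"
  proof
    have e0: "complex_of_real \<epsilon> \<noteq> 0" using \<epsilon> by simp
    show "U \<subseteq> mult_span {-1, of_real \<epsilon>}"
    proof
      fix u assume u: "u \<in> U"
      then obtain v where v: "u = of_real v" using realU by blast
      have "v \<noteq> 0" using u v unfolding U_def mem_unit_group_iff[OF closed_field_QF] by auto
      then consider "v > 0" | "- v > 0" by linarith
      then show "u \<in> mult_span {-1, of_real \<epsilon>}"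
      proof cases
        case 1
        then obtain k where "v = \<epsilon> powi k" using pos_case u v by blast
        then have "u = of_real \<epsilon> powi k" by (simp add: v)
        then show ?thesis unfolding mult_span_neg1[OF e0] by blast
      next
        case 2
        moreover have "of_real (- v) \<in> U" using Uc(4) u v by simp
        ultimately obtain k where "- v = \<epsilon> powi k" using pos_case by blast
        then have "v = - (\<epsilon> powi k)" by simp
        then have "u = - (of_real \<epsilon> powi k)" by (simp add: v)
        then show ?thesis unfolding mult_span_neg1[OF e0] by blast
      qed
    qed
    show "mult_span {-1, of_real \<epsilon>} \<subseteq> U"
      by (rule mult_span_subset) (use \<epsilon> Uc in auto)
  qed
  have QFm: "rat_adjoin {complex_of_real (sqrt (real m))} = QF {int m}"
    by (simp add: QF_def rt_nonneg)
  have "fundamental_unit m = \<epsilon>"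
    unfolding fundamental_unit_def QFm U_def[symmetric]
  proof (rule the_equality)
    show "1 < \<epsilon> \<and> U = mult_span {- 1, complex_of_real \<epsilon>}" using \<epsilon> Ueq by blast
    fix e assume e: "1 < e \<and> U = mult_span {- 1, complex_of_real e}"
    then have "of_real e \<in> U" using mult_span_incl by blast
    then have le: "\<epsilon> \<le> e" using e by (intro \<epsilon>_le) (auto simp: S_def)
    have "of_real \<epsilon> \<in> mult_span {- 1, complex_of_real e}" using e \<epsilon> by blast
    then obtain k where "complex_of_real \<epsilon> = of_real e powi k \<or> complex_of_real \<epsilon> = - (of_real e powi k)"
      using e by (subst (asm) mult_span_neg1) auto
    then have "complex_of_real \<epsilon> = of_real (e powi k) \<or> complex_of_real \<epsilon> = of_real (- (e powi k))"
      by simp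
    then have "\<epsilon> = e powi k \<or> \<epsilon> = - (e powi k)" by (simp only: of_real_eq_iff)
    moreover have "e powi k > 0" using e by simp
    ultimately have k: "\<epsilon> = e powi k" using \<epsilon> by linarith
    \<comment> \<open>A positive exponent gives e \<le> \<epsilon>, and the minimality of \<epsilon>
      gives the converse.\<close>
    have "k > 0"
    proof (rule ccontr)
      assume "\<not> k > 0"
      then have "e powi k \<le> e powi 0" using e by (intro power_int_increasing) auto
      then show False using k \<epsilon> by simp
    qed
    then have "e powi 1 \<le> e powi k" using e by (intro power_int_increasing) auto
    then show "e = \<epsilon>" using k le by simp
  qed
  then show "fundamental_unit m > 1" "unit_group (QF {int m}) = mult_span {-1, of_real (fundamental_unit m)}"
    using \<epsilon> Ueq by (auto simp: U_def)
qed

lemma rt_notin_Rats: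
  assumes "squarefree m" "m > 1"
  shows "rt (int m) \<notin> \<rat>"
proof
  assume "rt (int m) \<in> \<rat>"
  then obtain k where k: "rt (int m) = of_int k"
    using rational_algebraic_int_is_int[OF algebraic_int_rt] by (metis Ints_cases)
  have "(of_int (k ^ 2) :: complex) = of_int (int m)" using rt_square(1)[of "int m"] k by simp
  then have "k ^ 2 = int m" by (simp only: of_int_eq_iff)
  then have "(nat \<bar>k\<bar>) ^ 2 = m" by (metis nat_int nat_power_eq abs_ge_zero power2_abs)
  then have "nat \<bar>k\<bar> ^ 2 dvd m" by simp
  then have "nat \<bar>k\<bar> dvd 1" using assms(1) squarefreeD by blast
  then show False using \<open>(nat \<bar>k\<bar>) ^ 2 = m\<close> assms(2) by simp
qed

subsection \<open>Quadratic residues and descent\<close>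

text \<open>By Fermat, a root x of -1 gives 1 = (x^2)^((p - 1) / 2) = -1 modulo p, since (p - 1) / 2
  is odd.\<close>

lemma minus_one_nonresidue:
  assumes p: "Factorial_Ring.prime p" "p mod 4 = 3"
  shows "\<not> QuadRes (int p) (-1)"
proof
  assume "QuadRes (int p) (-1)"
  then obtain x where x: "[x ^ 2 = -1] (mod int p)" unfolding QuadRes_def by blast
  define n where "n = nat \<bar>x\<bar>"
  have n: "int n ^ 2 = x ^ 2" by (simp add: n_def)
  have "\<not> p dvd n"
  proof
    assume "p dvd n"
    then have "int p dvd int n ^ 2" by (simp add: power2_eq_square)
    then have "[x ^ 2 = 0] (mod int p)" by (simp add: n cong_0_iff)
    then have "[-1 = (0::int)] (mod int p)" using x by (metis cong_sym cong_trans)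
    then have "int p dvd 1" by (simp add: cong_0_iff)
    then show False using p by auto
  qed
  then have "[n ^ (p - 1) = 1] (mod p)" using fermat_theorem p by blast
  then have f: "[int n ^ (p - 1) = 1] (mod int p)" by (metis cong_int_iff of_nat_1 of_nat_power)
  define k where "k = p div 4"
  have p1: "p - 1 = 2 * (2 * k + 1)" using p(2) unfolding k_def by presburger
  have "int n ^ (p - 1) = (x ^ 2) ^ (2 * k + 1)" by (simp only: p1 power_mult n)
  moreover have "[(x ^ 2) ^ (2 * k + 1) = (-1) ^ (2 * k + 1)] (mod int p)" using x by (rule cong_pow)
  ultimately have "[1 = (-1 :: int)] (mod int p)" using f by (simp add: cong_def)
  then have "int p dvd 2" by (simp add: cong_iff_dvd_diff)
  then have "int p \<le> 2" by (rule zdvd_imp_le) simp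
  then have "p \<le> 2" by simp
  then show False using p(2) by (cases "p = 0"; cases "p = 1"; cases "p = 2") auto
qed

lemma QuadRes_of_mult_square:
  assumes p: "Factorial_Ring.prime p" and c: "[c * b ^ 2 = s ^ 2] (mod int p)" and s: "\<not> int p dvd s"
  shows "QuadRes (int p) c"
proof -
  have "\<not> int p dvd b"
  proof
    assume "int p dvd b"
    then have "int p dvd c * b ^ 2" by (simp add: power2_eq_square)
    then have "int p dvd s ^ 2" using c cong_dvd_iff by blast
    then show False using s p by (simp add: prime_dvd_power_iff)
  qed
  moreover have "Factorial_Ring.prime (int p)" using p by simp
  ultimately have "coprime (int p) b" by (intro prime_imp_coprime)
  then have "coprime b (int p)" by (simp only: coprime_commute)
  then obtain b' where b': "[b * b' = 1] (mod int p)" using cong_solve_coprime_int by blast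
  have "[(s * b') ^ 2 = c * b ^ 2 * b' ^ 2] (mod int p)"
    using cong_mult[OF cong_sym[OF c] cong_refl[of "b' ^ 2"]] by (simp add: power_mult_distrib)
  also have "c * b ^ 2 * b' ^ 2 = c * (b * b') ^ 2" by (simp add: power_mult_distrib)
  also have "[c * (b * b') ^ 2 = c * 1 ^ 2] (mod int p)"
    by (intro cong_mult cong_refl cong_pow b')
  finally show ?thesis unfolding QuadRes_def by auto
qed

lemma QuadRes_neg_cancel:
  assumes p: "Factorial_Ring.prime p" and c: "QuadRes (int p) c" "QuadRes (int p) (- c)" "\<not> int p dvd c"
  shows "QuadRes (int p) (-1)"
proof -
  obtain x y where x: "[x ^ 2 = c] (mod int p)" and y: "[y ^ 2 = - c] (mod int p)"
    using c unfolding QuadRes_def by blast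
  have "[- (x ^ 2) = - c] (mod int p)" using x by (simp add: cong_minus_minus_iff)
  then have "[(-1) * x ^ 2 = y ^ 2] (mod int p)" using y by (simp add: cong_def)
  moreover have "\<not> int p dvd y"
  proof
    assume "int p dvd y"
    then have "int p dvd y ^ 2" by (simp add: power2_eq_square)
    then have "int p dvd - c" using y cong_dvd_iff by blast
    then show False using c by simp
  qed
  ultimately show ?thesis using QuadRes_of_mult_square[OF p] by blast
qed

lemma square_mod_8: "(a :: nat) ^ 2 mod 8 = (if odd a then 1 else if 4 dvd a then 0 else 4)"
proof -
  have "a mod 8 = 0 \<or> a mod 8 = 1 \<or> a mod 8 = 2 \<or> a mod 8 = 3 \<or> a mod 8 = 4 \<or> a mod 8 = 5 \<or> a mod 8 = 6 \<or> a mod 8 = 7"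
    by presburger
  moreover have "a ^ 2 mod 8 = (a mod 8) ^ 2 mod 8" by (simp add: power_mod)
  moreover have "odd a \<longleftrightarrow> odd (a mod 8)" "4 dvd a \<longleftrightarrow> 4 dvd (a mod 8)" by presburger+
  ultimately show ?thesis by (elim disjE) simp_all
qed

lemma square_mod_8_cases: "(a :: nat) ^ 2 mod 8 = 0 \<or> a ^ 2 mod 8 = 1 \<or> a ^ 2 mod 8 = 4"
  by (simp add: square_mod_8)

text \<open>The square of the reduced denominator divides m.\<close>

lemma rational_of_squarefree_mult_square:
  assumes m: "squarefree m" and r: "r \<in> \<rat>" "real m * r ^ 2 = of_int j"
  obtains k :: int where "r = of_int k"
proof -
  obtain a b where ab: "r = of_int a / of_int b" "b > 0" "coprime a b"
    using r(1) by (elim Rats_cases') auto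
  have "real m * (of_int a) ^ 2 = of_int j * (of_int b) ^ 2"
    using r(2) ab(2) unfolding ab(1) by (simp add: field_simps)
  then have "real_of_int (int m * a ^ 2) = real_of_int (j * b ^ 2)" by simp
  then have "int m * a ^ 2 = j * b ^ 2" by (simp only: of_int_eq_iff)
  then have "b ^ 2 dvd int m * a ^ 2" by simp
  moreover have "coprime (b ^ 2) (a ^ 2)" using ab(3) by (simp add: coprime_commute)
  ultimately have "b ^ 2 dvd int m" by (simp add: coprime_dvd_mult_left_iff)
  then have "(nat b) ^ 2 dvd m" using ab(2)
    by (metis abs_of_pos int_dvd_int_iff int_nat_eq less_le_not_le nat_0_le of_nat_power)
  then have "nat b dvd 1" using m squarefreeD by blast
  then have "b = 1" using ab(2) by simp
  then show ?thesis using ab(1) that by simp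
qed

text \<open>Half-integral coordinates would mean odd t and a, and then t^2 - m a^2 = 1 - m is 0 or 2
  modulo 8, whereas 4 n is 4. Norm -1 would make -1 a residue modulo p.\<close>

lemma fundamental_unit_form:
  assumes m: "squarefree m" "m mod 8 = 1 \<or> m mod 8 = 7"
    and p: "Factorial_Ring.prime p" "p dvd m" "p mod 4 = 3"
  obtains x y :: nat where "fundamental_unit m = real x + real y * sqrt (real m)"
    "x ^ 2 = m * y ^ 2 + 1" "y > 0"
proof -
  have m0: "m > 0" using m by (cases m) auto
  have m1: "m > 1"
  proof (rule ccontr)
    assume "\<not> m > 1"
    then have "m = 1" using m0 by simp
    then show False using p by auto
  qed
  have irr: "rt (int m) \<notin> \<rat>" by (rule rt_notin_Rats[OF m(1) m1])
  define e where "e = fundamental_unit m"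
  have e1: "e > 1" unfolding e_def by (rule fundamental_unit(1)[OF irr])
  have "of_real e \<in> mult_span {-1, complex_of_real e}" using mult_span_incl by blast
  then have eU: "of_real e \<in> unit_group (QF {int m})"
    unfolding e_def fundamental_unit(2)[OF irr] .
  obtain x y :: real and t n :: int where xy: "x \<in> \<rat>" "y \<in> \<rat>"
    and h: "complex_of_real e = of_real x + of_real y * rt (int m)" "2 * x = of_int t"
      "x ^ 2 - of_int (int m) * y ^ 2 = of_int n" "\<bar>n\<bar> = 1"
    by (rule quadratic_unit_form[OF irr eU])
  have "complex_of_real e = of_real (x + y * sqrt m)" using h(1) by (simp add: rt_nonneg)
  then have ex: "e = x + y * sqrt m" by (simp only: of_real_eq_iff)
  have q: "real m * (2 * y) ^ 2 = of_int (t ^ 2 - 4 * n)"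
  proof -
    have "of_int (t ^ 2 - 4 * n) = (2 * x) ^ 2 - 4 * (x ^ 2 - of_int (int m) * y ^ 2)"
      unfolding h(2,3) by simp
    then show ?thesis by (simp add: power2_eq_square algebra_simps)
  qed
  have "2 * y \<in> \<rat>" using xy by simp
  then obtain a :: int where y2: "2 * y = of_int a"
    using rational_of_squarefree_mult_square[OF m(1) _ q] by blast
  have "real_of_int (t ^ 2 - int m * a ^ 2) = real_of_int (4 * n)"
    using q unfolding y2 by simp
  then have ta: "t ^ 2 - int m * a ^ 2 = 4 * n" by (simp only: of_int_eq_iff)
  have n1: "n = 1 \<or> n = -1" using h(4) by linarith
  have "even t"
  proof (rule ccontr)
    assume t: "odd t"
    have "int m * a ^ 2 = t ^ 2 - 4 * n" using ta by simp
    moreover have "odd (t ^ 2 - 4 * n)" using t by simp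
    ultimately have "odd (int m * a ^ 2)" by simp
    then have a: "odd a" by auto
    have sq: "z ^ 2 mod 8 = 1" if "odd z" for z :: int
    proof -
      obtain j where j: "z = 2 * j + 1" using \<open>odd z\<close> by (elim oddE)
      have "even (j * (j + 1))" by simp
      then obtain i where "j * (j + 1) = 2 * i" by (elim evenE)
      then have "z ^ 2 = 8 * i + 1" unfolding j by (simp add: power2_eq_square algebra_simps)
      then show ?thesis by simp
    qed
    have "(t ^ 2 - int m * a ^ 2) mod 8 = (t ^ 2 mod 8 - (int m * a ^ 2) mod 8) mod 8"
      by (rule mod_diff_eq[symmetric])
    also have "(int m * a ^ 2) mod 8 = ((int m mod 8) * (a ^ 2 mod 8)) mod 8"
      by (rule mod_mult_eq[symmetric])
    also have "\<dots> = int m mod 8" unfolding sq[OF a] by simp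
    finally have "(4 * n) mod 8 = (1 - int m mod 8) mod 8" unfolding ta sq[OF t] .
    moreover have "(4 * n) mod 8 = 4" using n1 by auto
    moreover have "int m mod 8 = int (m mod 8)" by (simp add: zmod_int)
    then have "int m mod 8 = 1 \<or> int m mod 8 = 7" using m(2) by (metis of_nat_1 of_nat_numeral)
    then have "(1 - int m mod 8) mod 8 \<noteq> 4"
    proof
      assume h: "int m mod 8 = 1"
      show ?thesis unfolding h by simp
    next
      assume h: "int m mod 8 = 7"
      show ?thesis unfolding h by simp
    qed
    ultimately show False by metis
  qed
  moreover have "even a"
  proof -
    have "4 dvd t ^ 2" using \<open>even t\<close> by (auto elim!: evenE simp: power2_eq_square)
    moreover have "int m * a ^ 2 = t ^ 2 - 4 * n" using ta by simp
    ultimately have "4 dvd int m * a ^ 2" by (simp add: dvd_diff)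
    then have "even (int m * a ^ 2)" by (meson dvd_trans even_numeral)
    moreover have "odd (int m)" using m(2) by presburger
    ultimately show ?thesis by auto
  qed
  ultimately obtain X' Y' where XY: "t = 2 * X'" "a = 2 * Y'" by (auto elim!: evenE)
  have XYn: "X' ^ 2 - int m * Y' ^ 2 = n" using ta unfolding XY by (simp add: power2_eq_square)
  have "n \<noteq> -1"
  proof
    assume "n = -1"
    then have "X' ^ 2 - (-1) = int m * Y' ^ 2" using XYn by simp
    moreover have "int p dvd int m * Y' ^ 2" using p(2) by simp
    ultimately have "[X' ^ 2 = -1] (mod int p)" by (simp add: cong_iff_dvd_diff)
    then show False using minus_one_nonresidue[OF p(1,3)] unfolding QuadRes_def by blast
  qed
  then have n: "n = 1" using n1 by simp
  have xX: "x = of_int X'" "y = of_int Y'" using h(2) y2 XY by simp_all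
  have "(x - y * sqrt m) * e = 1"
    unfolding ex using h(3) n by (simp add: algebra_simps power2_eq_square)
  then have inv: "x - y * sqrt m = 1 / e" using e1 by (intro iffD2[OF nonzero_eq_divide_eq]) auto
  have "1 / e > 0" using e1 by simp
  then have "x > 0" using ex inv e1 by linarith
  have "1 / e < 1" using e1 by simp
  then have "y * sqrt m > 0" using ex inv e1 by linarith
  then have "y > 0" using m0 by (simp add: zero_less_mult_iff)
  have pos: "X' > 0" "Y' > 0" using \<open>x > 0\<close> \<open>y > 0\<close> xX by simp_all
  show ?thesis
  proof (rule that[of "nat X'" "nat Y'"])
    show "fundamental_unit m = real (nat X') + real (nat Y') * sqrt (real m)"
      using ex pos xX by (simp add: e_def)
    have "int ((nat X') ^ 2) = int (m * (nat Y') ^ 2 + 1)" using pos XYn n by simp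
    then show "(nat X') ^ 2 = m * (nat Y') ^ 2 + 1" by (simp only: of_nat_eq_iff)
    show "nat Y' > 0" using pos by simp
  qed
qed

lemma fundamental_unit_powers:
  assumes d: "rt (int m) \<notin> \<rat>" and u: "u \<in> unit_group (QF {int m})"
  obtains k where "u = of_real (fundamental_unit m) powi k \<or> u = - (of_real (fundamental_unit m) powi k)"
proof -
  have "complex_of_real (fundamental_unit m) \<noteq> 0" using fundamental_unit(1)[OF d] by simp
  then show ?thesis
    using u that mult_span_neg1 unfolding fundamental_unit(2)[OF d] by blast
qed

text \<open>An element of norm 1 is up to sign a power \<epsilon>^k, and \<epsilon>^(2 k) never
  equals \<epsilon>. This excludes the trivial factorization in the descent.\<close>

lemma fundamental_unit_not_square:
  assumes d: "rt (int m) \<notin> \<rat>" and ab: "a ^ 2 = int m * b ^ 2 + 1"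
  shows "(of_int a + of_int b * sqrt (real m)) ^ 2 \<noteq> fundamental_unit m"
proof
  define e where "e = fundamental_unit m"
  have e1: "e > 1" unfolding e_def by (rule fundamental_unit(1)[OF d])
  assume "(of_int a + of_int b * sqrt (real m)) ^ 2 = fundamental_unit m"
  then have sq: "(of_int a + of_int b * sqrt (real m)) ^ 2 = e" by (simp add: e_def)
  have "of_int a + of_int b * rt (int m) \<in> unit_group (QF {int m})"
    using ab by (intro quadratic_unit_intro) simp
  then obtain k where "of_int a + of_int b * rt (int m) = of_real e powi k \<or>
      of_int a + of_int b * rt (int m) = - (of_real e powi k)"
    unfolding e_def by (rule fundamental_unit_powers[OF d])
  then have "(of_int a + of_int b * rt (int m)) ^ 2 = of_real e powi k * of_real e powi k"
    by (auto simp: power2_eq_square)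
  then have "complex_of_real ((of_int a + of_int b * sqrt (real m)) ^ 2) = of_real (e powi k * e powi k)"
    by (simp add: rt_nonneg)
  then have "e = e powi k * e powi k" unfolding sq by (simp only: of_real_eq_iff)
  moreover have "e powi (k + k) = e powi k * e powi k"
    by (rule power_int_add) (use e1 in simp)
  ultimately have e: "e powi (k + k) = e" by metis
  show False
  proof (cases "k > 0")
    case True
    then have "e powi 1 < e powi (k + k)" using e1 by (intro power_int_strict_increasing) auto
    then show False using e by simp
  next
    case False
    then have "e powi (k + k) \<le> e powi 0" using e1 by (intro power_int_increasing) auto
    then show False using e e1 by simp
  qed
qed

text \<open>Once m is distributed over the two factors, the cofactors are coprime with a square
  product, hence squares.\<close>

lemma coprime_factors_split:
  fixes A B m Y' :: nat
  assumes "coprime A B" "A * B = m * Y' ^ 2" "m > 0"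
  obtains d1 d2 a b where "d1 * d2 = m" "A = d1 * a ^ 2" "B = d2 * b ^ 2" "a * b = Y'"
proof -
  have "m dvd A * B" using assms(2) by simp
  then obtain d1 d2 where d: "m = d1 * d2" "d1 dvd A" "d2 dvd B" using division_decomp by blast
  then obtain A' B' where AB: "A = d1 * A'" "B = d2 * B'" by (auto elim!: dvdE)
  have "(d1 * d2) * (A' * B') = (d1 * d2) * Y' ^ 2"
    using assms(2) unfolding AB d(1) by (simp add: mult_ac)
  then have sq: "A' * B' = Y' ^ 2" using assms(3) d(1) by simp
  have "coprime A' B'" using assms(1) unfolding AB by simp
  moreover have "is_nth_power 2 (A' * B')" unfolding sq by simp
  ultimately have "is_nth_power 2 A'" "is_nth_power 2 B'"
    by (simp_all add: is_nth_power_mult_coprime_nat_iff)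
  then obtain a b where ab: "A' = a ^ 2" "B' = b ^ 2" by (auto simp: is_nth_power_def)
  have "(a * b) ^ 2 = Y' ^ 2" using sq by (simp add: ab power_mult_distrib)
  then have "a * b = Y'" by (simp add: power2_eq_iff_nonneg)
  then show ?thesis using that d AB ab by blast
qed

text \<open>In (x + 1) (x - 1) = m y^2 the two factors are coprime if x is even, and their halves
  are coprime if x is odd; each is then a divisor of m times a square. \<open>e\<close> is the
  difference of these coprime factors.\<close>

lemma pell_descent:
  fixes m x y :: nat
  assumes eq: "x ^ 2 = m * y ^ 2 + 1" and m: "odd m" and y: "y > 0"
  obtains d1 d2 a b e where "d1 * d2 = m" "d1 * a ^ 2 = d2 * b ^ 2 + e"
    "e * x = d1 * a ^ 2 + d2 * b ^ 2" "e * y = 2 * a * b" "odd x \<and> e = 1 \<or> even x \<and> e = 2"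
proof -
  have m0: "m > 0" using m by (cases m) auto
  have "m * y ^ 2 > 0" using m0 y by simp
  then have "1 < x ^ 2" using eq by linarith
  then have x1: "x > 1" by (metis One_nat_def less_one nat_neq_iff one_power2 power2_less_imp_less zero_le zero_power2 not_less_zero)
  show ?thesis
  proof (cases "odd x")
    case True
    then obtain B where B: "x = 2 * B + 1" by (elim oddE)
    have B0: "B > 0" using x1 B by simp
    have "even (m * y ^ 2)" using eq True by (metis even_Suc even_power Suc_eq_plus1 pos2)
    then have "even y" using m by auto
    then obtain Y' where Y': "y = 2 * Y'" by (elim evenE)
    have "(B + 1) * B = m * Y' ^ 2" using eq unfolding B Y' by (simp add: power2_eq_square algebra_simps)
    moreover have "coprime (B + 1) B" by simp
    ultimately obtain d1 d2 a b where h: "d1 * d2 = m" "B + 1 = d1 * a ^ 2" "B = d2 * b ^ 2" "a * b = Y'"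
      using coprime_factors_split m0 by metis
    show ?thesis
      by (rule that[of d1 d2 a b 1]) (use h B Y' True in auto)
  next
    case False
    define B where "B = x - 1"
    have B: "x = B + 1" using x1 by (simp add: B_def)
    have "odd B" using False B by simp
    have "(B + 2) * B = m * y ^ 2" using eq unfolding B by (simp add: power2_eq_square algebra_simps)
    moreover have "coprime (B + 2) B"
    proof -
      have "gcd (B + 2) B = gcd 2 B" by (metis add.commute gcd_add1)
      also have "gcd 2 B = 1" using \<open>odd B\<close> by (simp flip: coprime_iff_gcd_eq_1)
      finally show ?thesis by (simp only: coprime_iff_gcd_eq_1)
    qed
    ultimately obtain d1 d2 a b where h: "d1 * d2 = m" "B + 2 = d1 * a ^ 2" "B = d2 * b ^ 2" "a * b = y"
      using coprime_factors_split m0 by metis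
    show ?thesis
      by (rule that[of d1 d2 a b 2]) (use h B False in auto)
  qed
qed

lemma sqrt_from_descent:
  assumes "d1 * d2 = m" "e * x = d1 * a ^ 2 + d2 * b ^ 2" "e * y = 2 * a * b"
  shows "(real a * sqrt d1 + real b * sqrt d2) ^ 2 = real e * (real x + real y * sqrt m)"
proof -
  have "(real a * sqrt d1 + real b * sqrt d2) ^ 2
      = real (d1 * a ^ 2 + d2 * b ^ 2) + real (2 * a * b) * sqrt (real (d1 * d2))"
    by (simp add: power2_eq_square algebra_simps real_sqrt_mult)
  then show ?thesis unfolding assms(2,3)[symmetric] assms(1) by (simp add: algebra_simps)
qed

subsection \<open>Square roots of fundamental units\<close>

lemma prime_7_facts:
  assumes "Factorial_Ring.prime (p :: nat)" "p mod 8 = 7"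
  shows "p mod 4 = 3" "odd p" "p > 1" "squarefree p"
proof -
  show "p mod 4 = 3" "odd p" using assms(2) by presburger+
  show "p > 1" using assms(1) prime_gt_1_nat by blast
  show "squarefree p" using assms(1) by (rule squarefree_prime)
qed

lemma dvd_two_primes:
  assumes "Factorial_Ring.prime (p :: nat)" "Factorial_Ring.prime q" "d dvd p * q"
  shows "d = 1 \<or> d = p \<or> d = q \<or> d = p * q"
proof -
  obtain b c where bc: "d = b * c" "b dvd p" "c dvd q" using division_decomp[OF assms(3)] by blast
  have "b = 1 \<or> b = p" "c = 1 \<or> c = q" using bc assms(1,2) by (auto simp: prime_nat_iff)
  then show ?thesis using bc(1) by auto
qed

lemma dvd_three_primes:
  assumes "Factorial_Ring.prime (p :: nat)" "Factorial_Ring.prime q" "Factorial_Ring.prime r" "d dvd p * q * r"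
  shows "d \<in> {1, p, q, p * q, r, p * r, q * r, p * q * r}"
proof -
  obtain b c where bc: "d = b * c" "b dvd p * q" "c dvd r" using division_decomp[OF assms(4)] by blast
  have "b = 1 \<or> b = p \<or> b = q \<or> b = p * q" using dvd_two_primes[OF assms(1,2) bc(2)] .
  moreover have "c = 1 \<or> c = r" using bc assms(3) by (auto simp: prime_nat_iff)
  ultimately show ?thesis using bc(1) by auto
qed

text \<open>If d1 = 7 modulo 8, then d2 = 1 and a^2 + b^2 = -e modulo 8, but a sum of two squares is
  never 6 or 7 modulo 8.\<close>

lemma descent_first_factor:
  assumes "d1 * a ^ 2 = d2 * b ^ 2 + (e :: nat)" "d1 * d2 mod 8 = 7" "e = 1 \<or> e = 2"
  shows "d1 mod 8 \<noteq> 7"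
proof
  assume d1: "d1 mod 8 = 7"
  have d2: "d2 mod 8 = 1"
  proof -
    have "d2 mod 8 < 8" by simp
    then have "d2 mod 8 \<in> {0,1,2,3,4,5,6,7}" by auto
    moreover have "(7 * (d2 mod 8)) mod 8 = 7" using assms(2) d1 by (metis mod_mult_eq mod_mult_right_eq)
    ultimately show ?thesis by auto
  qed
  have "(7 * (a ^ 2 mod 8)) mod 8 = (1 * (b ^ 2 mod 8) + e) mod 8"
    using assms(1) d1 d2 by (metis mod_mult_eq mod_add_left_eq)
  then show False using assms(3) square_mod_8_cases[of a] square_mod_8_cases[of b] by auto
qed

lemma cong_from_descent:
  assumes "d1 * a ^ 2 = d2 * b ^ 2 + (e :: nat)" "p dvd d1"
  shows "[- int d2 * int b ^ 2 = int e] (mod int p)"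
proof -
  have "int e - (- int d2 * int b ^ 2) = int (d1 * a ^ 2)" using assms(1) by simp
  also have "int p dvd \<dots>" using assms(2) by (simp only: int_dvd_int_iff) simp
  finally show ?thesis by (simp add: cong_iff_dvd_diff dvd_diff_commute)
qed

text \<open>The descent leaves d1 = 1, as d1 = p fails modulo 8, and e = 2, as e = 1 would make the
  fundamental unit a square.\<close>

lemma prime_fundamental_unit:
  assumes p: "Factorial_Ring.prime p" "p mod 8 = 7"
  obtains a b where "a ^ 2 = p * b ^ 2 + (2 :: nat)" "(real a + real b * sqrt p) ^ 2 = 2 * fundamental_unit p"
proof -
  note pf = prime_7_facts[OF p]
  have irr: "rt (int p) \<notin> \<rat>" by (rule rt_notin_Rats[OF pf(4,3)])
  obtain x y where xy: "fundamental_unit p = real x + real y * sqrt (real p)" "x ^ 2 = p * y ^ 2 + 1" "y > 0"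
    using fundamental_unit_form[OF pf(4) _ p(1) _ pf(1)] p(2) by auto
  obtain d1 d2 a b e :: nat where d: "d1 * d2 = p" "d1 * a ^ 2 = d2 * b ^ 2 + e"
    "e * x = d1 * a ^ 2 + d2 * b ^ 2" "e * y = 2 * a * b" "odd x \<and> e = 1 \<or> even x \<and> e = 2"
    by (rule pell_descent[OF xy(2) pf(2) xy(3)])
  have "d1 mod 8 \<noteq> 7" using descent_first_factor[OF d(2)] d(1,5) p(2) by auto
  then have "d1 \<noteq> p" using p(2) by auto
  moreover have "d1 dvd p" using d(1) by auto
  ultimately have d1: "d1 = 1" using p(1) unfolding prime_nat_iff by blast
  then have d2: "d2 = p" using d(1) by simp
  have sq: "(real a + real b * sqrt p) ^ 2 = real e * fundamental_unit p"
    using sqrt_from_descent[OF d(1,3,4)] by (simp add: d1 d2 xy(1))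
  have "e \<noteq> 1"
  proof
    assume "e = 1"
    then have "int (a ^ 2) = int (p * b ^ 2 + 1)" using d(2) d1 d2 by simp
    then show False using fundamental_unit_not_square[OF irr, of "int a" "int b"] sq \<open>e = 1\<close> by simp
  qed
  then have "e = 2" using d(5) by auto
  then show ?thesis using that[of a b] d(2) d1 d2 sq by simp
qed

text \<open>This case of the second supplementary law can be read off from a^2 = p b^2 + 2.\<close>

lemma two_residue:
  assumes p: "Factorial_Ring.prime p" "p mod 8 = 7"
  obtains s where "[s ^ 2 = 2] (mod int p)" "\<not> int p dvd s"
proof -
  obtain a b where ab: "a ^ 2 = p * b ^ 2 + (2 :: nat)" using prime_fundamental_unit[OF p] by blast
  have c: "[int a ^ 2 = 2] (mod int p)"
  proof -
    have "int a ^ 2 - 2 = int p * int b ^ 2" using arg_cong[OF ab, of int] by simp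
    then show ?thesis by (simp add: cong_iff_dvd_diff)
  qed
  have "\<not> int p dvd int a"
  proof
    assume "int p dvd int a"
    then have "int p dvd int a ^ 2" by (simp add: power2_eq_square)
    then have "int p dvd 2" using c cong_dvd_iff by blast
    then have "int p \<le> 2" by (rule zdvd_imp_le) simp
    then show False using prime_7_facts[OF p] by auto
  qed
  then show ?thesis using that c by blast
qed

text \<open>Modulo p the equation reads - d2 b^2 = e, and e is a square modulo p, whether it is 1 or
  2.\<close>

lemma residue_from_descent:
  assumes p: "Factorial_Ring.prime p" "p mod 8 = 7"
    and d: "d1 * a ^ 2 = d2 * b ^ 2 + (e :: nat)" "p dvd d1" "e = 1 \<or> e = 2"
  shows "QuadRes (int p) (- int d2)"
proof -
  have c: "[- int d2 * int b ^ 2 = int e] (mod int p)" by (rule cong_from_descent[OF d(1,2)])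
  from d(3) show ?thesis
  proof
    assume "e = 1"
    moreover have "\<not> int p dvd 1" using prime_7_facts(3)[OF p] by simp
    ultimately show ?thesis using QuadRes_of_mult_square[OF p(1), of "- int d2" "int b" 1] c by simp
  next
    assume "e = 2"
    moreover obtain s where "[s ^ 2 = 2] (mod int p)" "\<not> int p dvd s" using two_residue[OF p] by blast
    ultimately show ?thesis
      using QuadRes_of_mult_square[OF p(1), of "- int d2" "int b" s] c cong_sym cong_trans
      by (metis of_nat_numeral)
  qed
qed

lemma residue_from_descent':
  assumes p: "Factorial_Ring.prime p" and d: "d1 * a ^ 2 = d2 * b ^ 2 + (1 :: nat)" "p dvd d2"
  shows "QuadRes (int p) (int d1)"
proof -
  have "int d1 * int a ^ 2 - 1 = int (d2 * b ^ 2)" using arg_cong[OF d(1), of int] by simp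
  also have "int p dvd \<dots>" using d(2) by (simp only: int_dvd_int_iff) simp
  finally have "[int d1 * int a ^ 2 = 1 ^ 2] (mod int p)" by (simp add: cong_iff_dvd_diff)
  moreover have "\<not> int p dvd 1" using p by auto
  ultimately show ?thesis by (rule QuadRes_of_mult_square[OF p])
qed

lemma mod_8_mult_7:
  "(p :: nat) mod 8 = 7 \<Longrightarrow> q mod 8 = 7 \<Longrightarrow> p * q mod 8 = 1"
  "(p :: nat) mod 8 = 1 \<Longrightarrow> q mod 8 = 7 \<Longrightarrow> p * q mod 8 = 7"
  using mod_mult_eq[of p 8 q] by simp_all

text \<open>The factor d1 = 1 would make the unit a square, d1 = p q would make -1 a residue modulo
  p, and e = 2 would need x^2 = y^2 + 1 modulo 8 with x even. Which of the two remaining equations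
  holds is decided by Legendre symbols.\<close>

lemma two_primes_fundamental_unit_cases:
  assumes p: "Factorial_Ring.prime p" "p mod 8 = 7" and q: "Factorial_Ring.prime q" "q mod 8 = 7"
    and "p \<noteq> q"
  obtains a b where "p * a ^ 2 = q * b ^ 2 + (1 :: nat)"
    "(real a * sqrt p + real b * sqrt q) ^ 2 = fundamental_unit (p * q)"
  | a b where "q * a ^ 2 = p * b ^ 2 + (1 :: nat)"
    "(real a * sqrt q + real b * sqrt p) ^ 2 = fundamental_unit (p * q)"
proof -
  note pf = prime_7_facts[OF p] and qf = prime_7_facts[OF q]
  have sqf: "squarefree (p * q)"
    using p q \<open>p \<noteq> q\<close> pf(4) qf(4) by (intro squarefree_mult_coprime) (auto simp: primes_coprime)
  have gt: "p * q > 1" using pf(3) qf(3) by (metis less_1_mult)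
  have irr: "rt (int (p * q)) \<notin> \<rat>" by (rule rt_notin_Rats[OF sqf gt])
  have m8: "p * q mod 8 = 1" using mod_8_mult_7 p q by blast
  obtain x y where xy: "fundamental_unit (p * q) = real x + real y * sqrt (real (p * q))"
    "x ^ 2 = p * q * y ^ 2 + 1" "y > 0"
    using fundamental_unit_form[OF sqf _ p(1) _ pf(1)] m8 by auto
  have odd: "odd (p * q)" using pf qf by simp
  obtain d1 d2 a b e where d: "d1 * d2 = p * q" "d1 * a ^ 2 = d2 * b ^ 2 + e"
    "e * x = d1 * a ^ 2 + d2 * b ^ 2" "e * y = 2 * a * b" "odd x \<and> e = 1 \<or> even x \<and> e = 2"
    by (rule pell_descent[OF xy(2) odd xy(3)])
  have e: "e = 1"
  proof (rule ccontr)
    assume "e \<noteq> 1"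
    then have "even x" using d(5) by auto
    have "x ^ 2 mod 8 = ((p * q mod 8) * (y ^ 2 mod 8) + 1) mod 8"
      unfolding xy(2) by (metis mod_mult_eq mod_add_left_eq)
    then have "x ^ 2 mod 8 = (y ^ 2 mod 8 + 1) mod 8" using m8 by simp
    moreover have "x ^ 2 mod 8 = 0 \<or> x ^ 2 mod 8 = 4" using square_mod_8[of x] \<open>even x\<close> by auto
    ultimately show False using square_mod_8_cases[of y] by (elim disjE) simp_all
  qed
  have sq: "(real a * sqrt d1 + real b * sqrt d2) ^ 2 = fundamental_unit (p * q)"
    using sqrt_from_descent[OF d(1,3,4)] by (simp add: e xy(1))
  have "d1 dvd p * q" using d(1) by (metis dvd_triv_left)
  then consider "d1 = 1" | "d1 = p" | "d1 = q" | "d1 = p * q"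
    using dvd_two_primes[OF p(1) q(1)] by blast
  then show ?thesis
  proof cases
    case 1
    then have "d2 = p * q" using d(1) by simp
    then have "int (a ^ 2) = int (p * q * b ^ 2 + 1)" using d(2) 1 e by simp
    then show ?thesis
      using fundamental_unit_not_square[OF irr, of "int a" "int b"] sq 1 \<open>d2 = p * q\<close> by simp
  next
    case 2
    then have "d2 = q" using d(1) pf(3) by simp
    then show ?thesis using that(1)[of a b] d(2) 2 e sq by simp
  next
    case 3
    then have "d2 = p" using d(1) qf(3) by (simp add: mult.commute)
    then show ?thesis using that(2)[of a b] d(2) 3 e sq by simp
  next
    case 4
    then have "d2 = 1" using d(1) pf(3) qf(3) by simp
    then have "QuadRes (int p) (-1)" using residue_from_descent[OF p d(2)] 4 e by simp
    then show ?thesis using minus_one_nonresidue[OF p(1) pf(1)] by blast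
  qed
qed

lemma two_primes_fundamental_unit:
  assumes p: "Factorial_Ring.prime p" "p mod 8 = 7" and q: "Factorial_Ring.prime q" "q mod 8 = 7"
    and "p \<noteq> q" and nr: "\<not> QuadRes (int q) (- int p)"
  obtains a b where "p * a ^ 2 = q * b ^ 2 + (1 :: nat)"
    "(real a * sqrt p + real b * sqrt q) ^ 2 = fundamental_unit (p * q)"
proof (rule two_primes_fundamental_unit_cases[OF p q \<open>p \<noteq> q\<close>])
  fix a b assume "q * a ^ 2 = p * b ^ 2 + 1"
  then have "QuadRes (int q) (- int p)" using residue_from_descent[OF q, of q a p b 1] by simp
  then show thesis using nr by blast
qed (rule that)

text \<open>Modulo 8 only d1 = 1 and the products of two primes survive. The products p q, p r, q r
  would make -r a residue modulo p, -q modulo r, -p modulo q: exactly what the cyclic hypotheses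
  exclude.\<close>

lemma three_primes_fundamental_unit:
  assumes p: "Factorial_Ring.prime p" "p mod 8 = 7" and q: "Factorial_Ring.prime q" "q mod 8 = 7"
    and r: "Factorial_Ring.prime r" "r mod 8 = 7"
    and "p \<noteq> q" "p \<noteq> r" "q \<noteq> r" and nr: "\<not> QuadRes (int q) (- int p)" "\<not> QuadRes (int r) (- int q)"
    "\<not> QuadRes (int p) (- int r)"
  obtains a b where "a ^ 2 = p * q * r * b ^ 2 + (2 :: nat)"
    "(real a + real b * sqrt (p * q * r)) ^ 2 = 2 * fundamental_unit (p * q * r)"
proof -
  note pf = prime_7_facts[OF p] and qf = prime_7_facts[OF q] and rf = prime_7_facts[OF r]
  define m where "m = p * q * r"
  have sqf: "squarefree m" unfolding m_def
    using p q r assms(7-9) pf(4) qf(4) rf(4) by (intro squarefree_mult_coprime) (auto simp: primes_coprime)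
  have gt: "m > 1" unfolding m_def using pf(3) qf(3) rf(3) by (metis less_1_mult)
  have irr: "rt (int m) \<notin> \<rat>" by (rule rt_notin_Rats[OF sqf gt])
  have m8: "m mod 8 = 7" unfolding m_def by (intro mod_8_mult_7 p q r)
  have pm: "p dvd m" by (simp add: m_def)
  obtain x y where xy: "fundamental_unit m = real x + real y * sqrt (real m)"
    "x ^ 2 = m * y ^ 2 + 1" "y > 0"
    using fundamental_unit_form[OF sqf _ p(1) pm pf(1)] m8 by auto
  have odd: "odd m" using pf qf rf by (simp add: m_def)
  obtain d1 d2 a b e where d: "d1 * d2 = m" "d1 * a ^ 2 = d2 * b ^ 2 + e"
    "e * x = d1 * a ^ 2 + d2 * b ^ 2" "e * y = 2 * a * b" "odd x \<and> e = 1 \<or> even x \<and> e = 2"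
    by (rule pell_descent[OF xy(2) odd xy(3)])
  have e: "e = 1 \<or> e = 2" using d(5) by auto
  have sq: "(real a * sqrt d1 + real b * sqrt d2) ^ 2 = real e * fundamental_unit m"
    using sqrt_from_descent[OF d(1,3,4)] by (simp add: xy(1))
  have d18: "d1 mod 8 \<noteq> 7" using descent_first_factor[OF d(2)] d(1) e m8 by auto
  have "d1 dvd p * q * r" using d(1) by (metis dvd_triv_left m_def)
  from dvd_three_primes[OF p(1) q(1) r(1) this]
  have "d1 \<in> {1, p * q, p * r, q * r}" using d18 p(2) q(2) r(2) m8 by (auto simp: m_def)
  then consider "d1 = 1" | "d1 = p * q" | "d1 = p * r" | "d1 = q * r" by blast
  then have d1: "d1 = 1"
  proof cases
    case 2
    then have "d2 = r" using d(1) pf(3) qf(3) by (simp add: m_def)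
    then have "QuadRes (int p) (- int r)" using residue_from_descent[OF p d(2) _ e] 2 by simp
    then show ?thesis using nr by blast
  next
    case 3
    then have "d2 = q" using d(1) pf(3) rf(3) by (simp add: m_def)
    then have "QuadRes (int r) (- int q)" using residue_from_descent[OF r d(2) _ e] 3 by simp
    then show ?thesis using nr by blast
  next
    case 4
    then have "d2 = p" using d(1) qf(3) rf(3) by (simp add: m_def)
    then have "QuadRes (int q) (- int p)" using residue_from_descent[OF q d(2) _ e] 4 by simp
    then show ?thesis using nr by blast
  qed
  then have d2: "d2 = m" using d(1) by simp
  have "e \<noteq> 1"
  proof
    assume "e = 1"
    then have "int (a ^ 2) = int (m * b ^ 2 + 1)" using d(2) d1 d2 by simp
    then show False using fundamental_unit_not_square[OF irr, of "int a" "int b"] sq d1 d2 \<open>e = 1\<close> by simp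
  qed
  then have "e = 2" using e by auto
  then show ?thesis using that[of a b] d(2) d1 d2 sq by (simp add: m_def)
qed

subsection \<open>Square roots of units are unramified at primes not dividing the radicands\<close>

lemma algebraic_int_power: "algebraic_int (x :: complex) \<Longrightarrow> algebraic_int (x ^ n)"
  by (induction n) (auto intro: algebraic_int_mult)

lemma rational_algebraic_int_divide:
  assumes "algebraic_int (of_int k / of_int q :: complex)" "q \<noteq> 0"
  shows "q dvd k"
proof -
  have "(of_int k / of_int q :: complex) \<in> \<rat>" by simp
  then obtain j where "(of_int k / of_int q :: complex) = of_int j"
    using rational_algebraic_int_is_int[OF assms(1)] by (metis Ints_cases)
  then have "(of_int k :: complex) = of_int (q * j)" using assms(2) by (simp add: field_simps)
  then have "k = q * j" by (simp only: of_int_eq_iff)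
  then show ?thesis by simp
qed

text \<open>If \<open>y\<^sup>2 / q\<close> is integral, so is \<open>y y' / q\<close> for a conjugate \<open>y'\<close>, because its square is. Hence \<open>y + y'\<close> and
  \<open>(y - y') \<surd>d\<close>, which lie one step lower in the tower, inherit the hypothesis.\<close>

lemma multiquadratic_almost_reduced:
  assumes q: "Factorial_Ring.prime (q :: int)" "\<not> q dvd 2" and D: "finite D" "\<And>d. d \<in> D \<Longrightarrow> \<not> q dvd d"
  shows "\<exists>c. \<not> q dvd c \<and> (\<forall>y\<in>QF D. algebraic_int y \<longrightarrow> algebraic_int (y ^ 2 / of_int q) \<longrightarrow>
    algebraic_int (y * of_int c / of_int q))"
  using D
proof (induction D rule: finite_induct)
  case empty
  have "algebraic_int (y * of_int 1 / of_int q)"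
    if y: "y \<in> QF {}" "algebraic_int y" "algebraic_int (y ^ 2 / of_int q)" for y
  proof -
    obtain k where k: "y = of_int k"
      using y(1,2) rational_algebraic_int_is_int by (metis QF_empty Ints_cases)
    have "algebraic_int (of_int (k ^ 2) / of_int q :: complex)" using y(3) k by simp
    then have "q dvd k ^ 2" by (rule rational_algebraic_int_divide) (use q in auto)
    then have "q dvd k" using q(1) prime_dvd_power by blast
    then obtain j where "k = q * j" by blast
    then have "y * of_int 1 / of_int q = of_int j" using k q by auto
    then show ?thesis by (simp only: algebraic_int_of_int)
  qed
  moreover have "\<not> q dvd 1" using q(1) by auto
  ultimately show ?case by blast
next
  case (insert d D)
  then obtain c where c: "\<not> q dvd c" "\<And>y. y \<in> QF D \<Longrightarrow> algebraic_int y \<Longrightarrow> algebraic_int (y ^ 2 / of_int q) \<Longrightarrow>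
    algebraic_int (y * of_int c / of_int q)" by blast
  show ?case
  proof (cases "rt d \<in> QF D")
    case True
    then have "QF (insert d D) = QF D" using adj_trivial[OF closed_field_QF] by (simp add: QF_insert)
    then show ?thesis using c by blast
  next
    case False
    interpret quad_ext "QF D" "rt d"
      using False closed_field_QF QF_intros(11) by (intro quad_ext.intro) auto
    have q0: "q \<noteq> 0" using q(1) by auto
    \<comment> \<open>Origin of the constant: y is recovered from 2 d y = d (y + y') + w \<surd>d,
      which costs a factor 2 d prime to q.\<close>
    have "\<not> q dvd 2 * d * c"
      using q c(1) insert.prems[of d] by (simp add: prime_dvd_mult_iff)
    moreover have "algebraic_int (y * of_int (2 * d * c) / of_int q)"
      if y: "y \<in> QF (insert d D)" "algebraic_int y" "algebraic_int (y ^ 2 / of_int q)" for y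
    proof -
      have yE: "y \<in> adj (QF D) (rt d)" using y(1) by (simp add: QF_insert)
      define y' where "y' = cj y"
      have y'i: "algebraic_int y'" unfolding y'_def by (rule cj_algebraic_int[OF yE y(2)])
      note cE = closed_field_intros[OF closed_field_adj]
      have "cj (y ^ 2 / of_int q) = y' ^ 2 / of_int q"
      proof -
        have e1: "cj (y ^ 2 * inverse (of_int q)) = cj (y ^ 2) * cj (inverse (of_int q))"
          by (rule cj_mult[OF cE(9)[OF yE] cE(3)[OF cE(11)]])
        have e2: "cj (inverse (of_int q)) = inverse (of_int q)"
          by (rule cj_base[OF F_intros(3)[OF F_intros(11)]])
        show ?thesis unfolding divide_inverse e1 e2 cj_power[OF yE] y'_def ..
      qed
      moreover have "algebraic_int (cj (y ^ 2 / of_int q))"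
        by (rule cj_algebraic_int[OF _ y(3)]) (intro cE(8) cE(9) yE cE(11))
      ultimately have y'2: "algebraic_int (y' ^ 2 / of_int q)" by simp
      have "(y * y' / of_int q) ^ 2 = (y ^ 2 / of_int q) * (y' ^ 2 / of_int q)"
        by (simp add: power2_eq_square)
      then have yy': "algebraic_int (y * y' / of_int q)"
        using algebraic_int_mult[OF y(3) y'2] by (simp add: algebraic_int_of_power2)
      obtain x z where xz: "x \<in> QF D" "z \<in> QF D" "y = x + z * rt d" using yE by (rule adjE)
      have y'e: "y' = x - z * rt d" unfolding y'_def xz(3) using xz by (intro cj_eq)
      define w where "w = (y - y') * rt d"
      have sum_in: "y + y' \<in> QF D"
      proof -
        have "y + y' = 2 * x" unfolding y'e xz(3) by simp
        then show ?thesis using xz(1) F_intros(5,12) by simp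
      qed
      have w_in: "w \<in> QF D"
      proof -
        have "w = 2 * z * (rt d * rt d)" unfolding w_def y'e xz(3) by (simp add: algebra_simps)
        then have "w = 2 * z * of_int d" by simp
        then show ?thesis using xz(2) F_intros(5,11,12) by simp
      qed
      have "(y + y') ^ 2 / of_int q = y ^ 2 / of_int q + y' ^ 2 / of_int q + 2 * (y * y' / of_int q)"
        using q0 by (simp add: field_simps power2_eq_square)
      also have "algebraic_int \<dots>"
        using algebraic_int_of_int[of 2] by (intro algebraic_int_add algebraic_int_mult y(3) y'2 yy') simp
      finally have 1: "algebraic_int ((y + y') * of_int c / of_int q)"
        by (intro c(2) sum_in algebraic_int_add y(2) y'i)
      have "w ^ 2 / of_int q = (y - y') ^ 2 * (rt d) ^ 2 / of_int q"
        by (simp only: w_def power_mult_distrib)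
      also have "\<dots> = of_int d * (y ^ 2 / of_int q + y' ^ 2 / of_int q - 2 * (y * y' / of_int q))"
        using q0 by (simp add: field_simps power2_eq_square)
      also have "algebraic_int \<dots>"
        using algebraic_int_of_int[of 2]
        by (intro algebraic_int_diff algebraic_int_add algebraic_int_mult y(3) y'2 yy' algebraic_int_of_int) simp
      finally have 2: "algebraic_int (w * of_int c / of_int q)"
        unfolding w_def by (intro c(2) w_in[unfolded w_def] algebraic_int_mult algebraic_int_diff y(2) y'i algebraic_int_rt)
      have wr: "w * rt d = (y - y') * of_int d" unfolding w_def by (simp add: mult.assoc)
      have "y * of_int (2 * d * c) = of_int d * ((y + y') * of_int c) + (w * rt d) * of_int c"
        unfolding wr by (simp add: algebra_simps)
      then have "y * of_int (2 * d * c) / of_int q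
          = of_int d * ((y + y') * of_int c / of_int q) + (w * of_int c / of_int q) * rt d"
        by (simp add: add_divide_distrib mult_ac)
      then show ?thesis
        using algebraic_int_add algebraic_int_mult algebraic_int_of_int algebraic_int_rt 1 2 by metis
    qed
    ultimately show ?thesis by blast
  qed
qed

text \<open>If q divides c exactly once, then y^2 / q is integral, so q divides y up to a factor
  prime to q. Then q^2 divides y^2 up to such a factor and hence, \<eta> being a unit, also
  c.\<close>

lemma unit_times_ramified_nonsquare:
  assumes q: "Factorial_Ring.prime (q :: int)" "\<not> q dvd 2" and D: "finite D" "\<And>d. d \<in> D \<Longrightarrow> \<not> q dvd d"
    and c: "q dvd c" "\<not> q ^ 2 dvd c"
    and \<eta>: "algebraic_int \<eta>" "algebraic_int (inverse \<eta>)" "\<eta> \<noteq> 0" and y: "y \<in> QF D"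
  shows "y ^ 2 \<noteq> of_int c * \<eta>"
proof
  assume eq: "y ^ 2 = of_int c * \<eta>"
  obtain c' where c': "c = q * c'" using c(1) by blast
  have q0: "q \<noteq> 0" using q(1) by auto
  have nc': "\<not> q dvd c'" using c(2) q0 unfolding c' by (simp add: power2_eq_square)
  have y_int: "algebraic_int y"
    by (rule algebraic_int_of_power2) (unfold eq, intro algebraic_int_mult algebraic_int_of_int \<eta>(1))
  have "y ^ 2 / of_int q = of_int c' * \<eta>" using q0 by (simp add: eq c')
  then have "algebraic_int (y ^ 2 / of_int q)" using algebraic_int_mult[OF algebraic_int_of_int \<eta>(1)] by simp
  then obtain e where e: "\<not> q dvd e" "algebraic_int (y * of_int e / of_int q)"
    using multiquadratic_almost_reduced[OF q D] y y_int by blast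
  have "(y * of_int e / of_int q) ^ 2 * inverse \<eta> = y ^ 2 * of_int e ^ 2 / of_int q ^ 2 * inverse \<eta>"
    by (simp add: power_mult_distrib power_divide)
  also have "\<dots> = of_int (c' * e ^ 2) / of_int q"
    unfolding eq c' using q0 \<eta>(3) by (simp add: power2_eq_square)
  finally have "algebraic_int (of_int (c' * e ^ 2) / of_int q :: complex)"
    using algebraic_int_mult[OF algebraic_int_power[OF e(2)] \<eta>(2), of 2] by simp
  then have "q dvd c' * e ^ 2" using q0 by (intro rational_algebraic_int_divide)
  then show False using q(1) nc' e(1) by (auto simp: prime_dvd_mult_iff prime_dvd_power_iff)
qed

lemma rt_in_QF_of_prime_factors:
  assumes "n > 0" "\<And>q :: nat. Factorial_Ring.prime q \<Longrightarrow> q dvd n \<Longrightarrow> int q \<in> D"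
  shows "rt (int n) \<in> QF D"
  using assms
proof (induction n rule: less_induct)
  case (less n)
  show ?case
  proof (cases "n = 1")
    case True
    then show ?thesis using QF_intros(1) by (simp add: rt_nonneg)
  next
    case False
    then obtain q where q: "Factorial_Ring.prime q" "q dvd n" using prime_factor_nat by blast
    then obtain k where k: "n = q * k" by blast
    have "k < n" "k > 0" using k q less.prems(1) prime_gt_1_nat[OF q(1)] by auto
    then have "rt (int k) \<in> QF D" using less.prems(2) k by (intro less.IH) auto
    moreover have "rt (int q) \<in> QF D" using rt_in_QF less.prems(2) q by blast
    moreover have "rt (int n) = rt (int q) * rt (int k)" unfolding k by (simp add: rt_mult)
    ultimately show ?thesis using QF_intros(5) by simp
  qed
qed

text \<open>As \<open>2\<close> is a square once \<open>\<surd>2\<close> is adjoined, this trades \<open>a + b\<surd>m\<close> for \<open>a + \<surd>2\<close> up to squares.\<close>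

lemma norm_two_swap:
  fixes s r :: complex
  assumes "s ^ 2 = 2" "a ^ 2 = b ^ 2 * r ^ 2 + 2"
  shows "(a + s + b * r) ^ 2 = 2 * (a + s) * (a + b * r)"
proof -
  have "(a + s + b * r) ^ 2 - 2 * (a + s) * (a + b * r) = s ^ 2 - a ^ 2 + b ^ 2 * r ^ 2"
    by (simp add: power2_eq_square algebra_simps)
  then show ?thesis using assms by simp
qed

text \<open>Swapping replaces \<open>z0\<close>, up to squares in the field with \<surd>2, by the
  product \<gamma> of the four numbers a1 + \<surd>2, ..., a + \<surd>2. The norm of \<gamma> over
  \<rat> is a square because the radicands p1, p2, p3 and m multiply to m^2; this is the hypothesis
  of Hilbert 90.\<close>

lemma four_fold_product_square:
  fixes p1 p2 p3 a1 b1 a2 b2 a3 b3 a b :: nat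
  defines "m \<equiv> p1 * p2 * p3"
  assumes p: "Factorial_Ring.prime p1" "Factorial_Ring.prime p2" "Factorial_Ring.prime p3"
    and h: "a1 ^ 2 = p1 * b1 ^ 2 + 2" "a2 ^ 2 = p2 * b2 ^ 2 + 2" "a3 ^ 2 = p3 * b3 ^ 2 + 2" "a ^ 2 = m * b ^ 2 + 2"
    and pos: "b1 > 0" "b2 > 0" "b3 > 0" "b > 0"
  defines "z0 \<equiv> (of_nat a1 + of_nat b1 * rt p1) * (of_nat a2 + of_nat b2 * rt p2)
    * (of_nat a3 + of_nat b3 * rt p3) * (of_nat a + of_nat b * rt m)"
  assumes unit: "algebraic_int (z0 / 4)" "algebraic_int (inverse (z0 / 4))" "z0 \<noteq> 0"
  obtains w where "w \<in> QF {2, int p1, int p2, int p3}" "z0 = w ^ 2"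
proof -
  define L where "L = QF {2, int p1, int p2, int p3}"
  note LI = QF_intros[where D = "{2, int p1, int p2, int p3}", folded L_def]
  define s where "s = rt 2"
  have s2: "s ^ 2 = 2" by (simp add: s_def)
  have rtL: "s \<in> L" "rt p1 \<in> L" "rt p2 \<in> L" "rt p3 \<in> L"
    unfolding L_def s_def by (intro rt_in_QF; simp)+
  have rtm: "rt m = rt p1 * rt p2 * rt p3" by (simp add: m_def rt_mult)
  then have rtmL: "rt m \<in> L" using rtL LI(5) by simp
  define \<beta> where "\<beta> n = of_nat n + s" for n
  define \<beta>' where "\<beta>' n = of_nat n - s" for n
  have \<beta>L: "\<beta> n \<in> L" for n unfolding \<beta>_def by (intro LI(4) LI(10) rtL)
  have sr: "s = of_real (sqrt 2)" by (simp add: s_def rt_nonneg)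
  have nat_cong: "(of_nat a1 :: complex) ^ 2 = of_nat (a1 ^ 2)" for a1 by simp
  have norm: "\<beta> n * \<beta>' n = of_nat k * of_nat c ^ 2" if "n ^ 2 = k * c ^ 2 + 2" for n k c
  proof -
    have "\<beta> n * \<beta>' n = of_nat n ^ 2 - 2"
      unfolding \<beta>_def \<beta>'_def using s2 by (simp add: algebra_simps power2_eq_square)
    then show ?thesis unfolding nat_cong that by simp
  qed
  have swap: "2 * \<beta> n * (of_nat n + of_nat c * rt k) = (\<beta> n + of_nat c * rt k) ^ 2"
    if "n ^ 2 = k * c ^ 2 + 2" for n k c
  proof -
    have "of_nat n ^ 2 = of_nat c ^ 2 * rt k ^ 2 + 2"
      unfolding nat_cong that by simp
    from norm_two_swap[OF s2 this] show ?thesis unfolding \<beta>_def by simp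
  qed
  have big: "real n > sqrt 2" if "n ^ 2 = k * c ^ 2 + (2 :: nat)" "k > 0" "c > 0" for n k c
  proof (rule real_less_lsqrt)
    have "k * c ^ 2 > 0" using that by simp
    then have "n ^ 2 > 2" using that(1) by linarith
    then show "2 < (real n) ^ 2" by (metis of_nat_less_iff of_nat_numeral of_nat_power)
  qed simp
  have m0: "m > 0" unfolding m_def using p by (auto simp: prime_gt_0_nat)
  note bigs = big[OF h(1) prime_gt_0_nat[OF p(1)] pos(1)] big[OF h(2) prime_gt_0_nat[OF p(2)] pos(2)]
    big[OF h(3) prime_gt_0_nat[OF p(3)] pos(3)] big[OF h(4) m0 pos(4)]
  define \<gamma> where "\<gamma> = \<beta> a1 * \<beta> a2 * \<beta> a3 * \<beta> a"
  define \<gamma>' where "\<gamma>' = \<beta>' a1 * \<beta>' a2 * \<beta>' a3 * \<beta>' a"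
  define n where "n = m * b1 * b2 * b3 * b"
  have gg: "\<gamma> * \<gamma>' = of_nat n ^ 2"
  proof -
    have "\<gamma> * \<gamma>' = (\<beta> a1 * \<beta>' a1) * (\<beta> a2 * \<beta>' a2) * (\<beta> a3 * \<beta>' a3) * (\<beta> a * \<beta>' a)"
      by (simp add: \<gamma>_def \<gamma>'_def mult_ac)
    also have "\<dots> = of_nat n ^ 2"
      unfolding norm[OF h(1)] norm[OF h(2)] norm[OF h(3)] norm[OF h(4)]
      by (simp add: n_def m_def power2_eq_square mult_ac)
    finally show ?thesis .
  qed
  \<comment> \<open>Conjugates are multiplied in pairs, which yields integer coordinates for
    \<gamma> and \<gamma>' with the same A and B.\<close>
  have lin: "\<exists>A' B' :: int. x * \<beta> k = of_int A' + of_int B' * s \<and> x' * \<beta>' k = of_int A' - of_int B' * s"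
    if xx: "\<exists>A B :: int. x = of_int A + of_int B * s \<and> x' = of_int A - of_int B * s" for x x' k
  proof -
    obtain A B :: int where ab: "x = of_int A + of_int B * s" "x' = of_int A - of_int B * s" using xx by blast
    have "x * \<beta> k = of_int (A * int k + 2 * B) + of_int (A + B * int k) * s"
      "x' * \<beta>' k = of_int (A * int k + 2 * B) - of_int (A + B * int k) * s"
      unfolding ab \<beta>_def \<beta>'_def using s2 by (simp_all add: algebra_simps power2_eq_square)
    then show ?thesis by blast
  qed
  have "\<exists>A B :: int. \<beta> a1 = of_int A + of_int B * s \<and> \<beta>' a1 = of_int A - of_int B * s"
    by (intro exI[of _ "int a1"] exI[of _ 1]) (simp add: \<beta>_def \<beta>'_def)
  from lin[OF lin[OF lin[OF this, of a2], of a3], of a] obtain A B :: int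
    where AB: "\<gamma> = of_int A + of_int B * s" "\<gamma>' = of_int A - of_int B * s"
    unfolding \<gamma>_def \<gamma>'_def by blast
  define c where "c = 2 * A + 2 * int n"
  \<comment> \<open>Hilbert 90 in explicit form: since \<gamma> \<gamma>' = n^2, the square of
    \<gamma> + n is \<gamma> times \<gamma> + \<gamma>' + 2 n, and the trace is an integer.\<close>
  have gc: "(\<gamma> + of_nat n) ^ 2 = \<gamma> * of_int c"
  proof -
    have "(\<gamma> + of_nat n) ^ 2 = \<gamma> * (\<gamma> + \<gamma>' + 2 * of_nat n)"
      using gg by (simp add: power2_eq_square algebra_simps)
    also have "\<gamma> + \<gamma>' = 2 * of_int A" unfolding AB by simp
    finally show ?thesis by (simp add: c_def)
  qed
  \<comment> \<open>The numbers a1, a2, a3, a all exceed \<surd>2, so \<gamma> and \<gamma>' are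
    positive reals. Hence the trace and with it \<open>c\<close> are positive, and the square-free
    part of \<open>c\<close> carries no sign.\<close>
  define g where "g = (a1 + sqrt 2) * (a2 + sqrt 2) * (a3 + sqrt 2) * (a + sqrt 2)"
  define g' where "g' = (a1 - sqrt 2) * (a2 - sqrt 2) * (a3 - sqrt 2) * (a - sqrt 2)"
  have gr: "\<gamma> = of_real g" "\<gamma>' = of_real g'"
    by (simp_all add: \<gamma>_def \<gamma>'_def \<beta>_def \<beta>'_def g_def g'_def sr)
  have gpos: "g > 0" "g' > 0"
    unfolding g_def g'_def using bigs by (intro mult_pos_pos; simp add: add_nonneg_pos)+
  have "complex_of_real (g + g') = of_real (2 * of_int A)" using AB by (simp flip: gr)
  then have "g + g' = 2 * of_int A" by (simp only: of_real_eq_iff)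
  then have "of_int A > (0 :: real)" using gpos by linarith
  then have c0: "c > 0" by (simp add: c_def)
  have \<gamma>0: "\<gamma> \<noteq> 0" using gpos gr by simp
  have \<beta>0: "\<beta> a1 \<noteq> 0" "\<beta> a2 \<noteq> 0" "\<beta> a3 \<noteq> 0" "\<beta> a \<noteq> 0" using \<gamma>0 by (auto simp: \<gamma>_def)
  define V where "V = (\<beta> a1 + of_nat b1 * rt p1) * (\<beta> a2 + of_nat b2 * rt p2)
    * (\<beta> a3 + of_nat b3 * rt p3) * (\<beta> a + of_nat b * rt m)"
  have VL: "V \<in> L" unfolding V_def by (intro LI(4) LI(5) LI(10) \<beta>L rtL rtmL)
  have regroup: "2 * u1 * x1 * (2 * u2 * x2) * (2 * u3 * x3) * (2 * u4 * x4)
      = 16 * (u1 * u2 * u3 * u4) * (x1 * x2 * x3 * x4)" for u1 u2 u3 u4 x1 x2 x3 x4 :: complex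
    by (simp add: mult_ac)
  have V2: "V ^ 2 = 16 * \<gamma> * z0"
    unfolding V_def power_mult_distrib swap[OF h(1), symmetric] swap[OF h(2), symmetric]
      swap[OF h(3), symmetric] swap[OF h(4), symmetric]
    unfolding \<gamma>_def z0_def by (rule regroup)
  \<comment> \<open>The denominator 8 \<gamma> is chosen so that Z^2 = c (z0 / 4), an integer times
    a unit.\<close>
  define Z where "Z = V * (\<gamma> + of_nat n) / (8 * \<gamma>)"
  have \<gamma>L: "\<gamma> \<in> L" unfolding \<gamma>_def by (intro LI(5) \<beta>L)
  have ZL: "Z \<in> L" unfolding Z_def by (intro LI(4) LI(5) LI(8) LI(10) LI(12) VL \<gamma>L)
  have Z2: "Z ^ 2 = of_int c * (z0 / 4)"
    unfolding Z_def power_divide power_mult_distrib V2 gc using \<gamma>0 by (simp add: power2_eq_square)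
  define c1 where "c1 = squarefree_part (nat c)"
  define k where "k = square_part (nat c)"
  have ck: "nat c = c1 * k ^ 2" unfolding c1_def k_def by (rule squarefree_decompose)
  have cnz: "c1 > 0" "k > 0" using ck c0 by (auto intro: Nat.gr0I)
  have "int (nat c) = int (c1 * k ^ 2)" using ck by simp
  then have ck': "c = int c1 * int k ^ 2" using c0 by simp
  define Y where "Y = Z / of_nat k"
  have YL: "Y \<in> L" unfolding Y_def by (intro LI(8) LI(10) ZL)
  have Y2: "Y ^ 2 = of_int (int c1) * (z0 / 4)"
    unfolding Y_def power_divide Z2 ck' using cnz by simp
  \<comment> \<open>A prime divisor of \<open>c1\<close> other than 2, p1, p2, p3 would have to
    ramify in \<open>L\<close>.\<close>
  have "rt (int c1) \<in> L"
    unfolding L_def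
  proof (rule rt_in_QF_of_prime_factors[OF cnz(1)])
    fix q :: nat assume q: "Factorial_Ring.prime q" "q dvd c1"
    show "int q \<in> {2, int p1, int p2, int p3}"
    proof (rule ccontr)
      assume ni: "int q \<notin> {2, int p1, int p2, int p3}"
      have two: "Factorial_Ring.prime (2 :: nat)" by simp
      have "\<not> int q dvd 2"
        using primes_dvd_imp_eq[OF q(1) two] ni by (metis insertI1 int_dvd_int_iff of_nat_numeral)
      moreover have "\<not> int q dvd d" if "d \<in> {2, int p1, int p2, int p3}" for d
        using that ni primes_dvd_imp_eq[OF q(1) p(1)] primes_dvd_imp_eq[OF q(1) p(2)]
          primes_dvd_imp_eq[OF q(1) p(3)] \<open>\<not> int q dvd 2\<close> by auto
      moreover have "\<not> int q ^ 2 dvd int c1"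
      proof
        assume "int q ^ 2 dvd int c1"
        then have "q ^ 2 dvd c1" by (metis int_dvd_int_iff of_nat_power)
        then have "q dvd 1" using squarefreeD[of c1 q] squarefree_squarefree_part[of "nat c"] by (simp add: c1_def)
        then show False using q(1) by auto
      qed
      ultimately have "Y ^ 2 \<noteq> of_int (int c1) * (z0 / 4)"
        using q YL unit by (intro unit_times_ramified_nonsquare[of "int q" "{2, int p1, int p2, int p3}"]) (auto simp: L_def)
      then show False using Y2 by blast
    qed
  qed
  then have "2 * Y / rt (int c1) \<in> L" by (intro LI(8) LI(5) LI(12) YL)
  moreover have "z0 = (2 * Y / rt (int c1)) ^ 2"
    unfolding power_divide power_mult_distrib Y2 using cnz by simp
  ultimately show ?thesis using that by (simp add: L_def)
qed

subsection \<open>Square classes and relative norms\<close>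

lemma powi_even: "even k \<Longrightarrow> (x :: complex) powi k = (x powi (k div 2)) ^ 2"
  by (auto elim!: evenE simp: power_int_mult simp flip: power_int_numeral)
     (metis mult.commute power_int_mult power_int_numeral)

lemma powi_odd: "odd k \<Longrightarrow> x \<noteq> 0 \<Longrightarrow> (x :: complex) powi k = (x powi (k div 2)) ^ 2 * x"
proof -
  assume k: "odd k" and x: "x \<noteq> 0"
  have "x powi (2 * (k div 2) + 1) = x powi (2 * (k div 2)) * x"
    using x by (simp add: power_int_add_1)
  also have "x powi (2 * (k div 2)) = (x powi (k div 2)) ^ 2"
    using powi_even[of "2 * (k div 2)" x] by simp
  also have "2 * (k div 2) + 1 = k" using k by simp
  finally show ?thesis .
qed

text \<open>Zero is left out, so that for a field this is a subgroup of the multiplicative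
  group.\<close>

definition squares :: "complex set \<Rightarrow> complex set" where
  "squares F = {v ^ 2 | v. v \<in> F \<and> v \<noteq> 0}"

lemma squares_closed:
  assumes F: "closed_field F"
  shows "x \<in> squares F \<Longrightarrow> y \<in> squares F \<Longrightarrow> x * y \<in> squares F"
    "x \<in> squares F \<Longrightarrow> inverse x \<in> squares F" "x \<in> squares F \<Longrightarrow> x \<noteq> 0"
    "v \<in> F \<Longrightarrow> v \<noteq> 0 \<Longrightarrow> v ^ 2 \<in> squares F"
proof -
  note c = closed_field_intros[OF F]
  show "x * y \<in> squares F" if xy: "x \<in> squares F" "y \<in> squares F"
  proof -
    from xy obtain v w where "v \<in> F" "v \<noteq> 0" "x = v ^ 2" "w \<in> F" "w \<noteq> 0" "y = w ^ 2"
      by (auto simp: squares_def)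
    then have "x * y = (v * w) ^ 2" "v * w \<in> F" "v * w \<noteq> 0" using c(5) by (simp_all add: power_mult_distrib)
    then show ?thesis unfolding squares_def by blast
  qed
  show "inverse x \<in> squares F" if x: "x \<in> squares F"
  proof -
    from x obtain v where "v \<in> F" "v \<noteq> 0" "x = v ^ 2" by (auto simp: squares_def)
    then have "inverse x = (inverse v) ^ 2" "inverse v \<in> F" "inverse v \<noteq> 0" using c(3) by (simp_all add: power_inverse)
    then show ?thesis unfolding squares_def by blast
  qed
  show "x \<in> squares F \<Longrightarrow> x \<noteq> 0" by (auto simp: squares_def)
  show "v \<in> F \<Longrightarrow> v \<noteq> 0 \<Longrightarrow> v ^ 2 \<in> squares F" unfolding squares_def by blast
qed

lemma squares_cancel:
  assumes F: "closed_field F" and "y \<in> squares F"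
  shows "x * y \<in> squares F \<longleftrightarrow> x \<in> squares F" "y * x \<in> squares F \<longleftrightarrow> x \<in> squares F"
proof -
  show 1: "x * y \<in> squares F \<longleftrightarrow> x \<in> squares F"
  proof
    assume "x * y \<in> squares F"
    then have "(x * y) * inverse y \<in> squares F" using squares_closed[OF F] assms(2) by blast
    moreover have "y \<noteq> 0" by (rule squares_closed(3)[OF F assms(2)])
    ultimately show "x \<in> squares F" by (simp add: mult.assoc)
  qed (use squares_closed(1)[OF F] assms(2) in blast)
  then show "y * x \<in> squares F \<longleftrightarrow> x \<in> squares F" by (simp add: mult.commute)
qed

text \<open>Modulo squares only the parity of an exponent matters.\<close>

lemma squares_powi:
  assumes F: "closed_field F" and x: "x \<in> F" "x \<noteq> 0"
  shows "even k \<Longrightarrow> x powi k \<in> squares F" "odd k \<Longrightarrow> y * x powi k \<in> squares F \<longleftrightarrow> y * x \<in> squares F"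
proof -
  have h: "(x powi j) ^ 2 \<in> squares F" for j
    using x closed_field_intros(13)[OF F] by (intro squares_closed(4)[OF F]) auto
  show "even k \<Longrightarrow> x powi k \<in> squares F" using h by (simp add: powi_even)
  assume "odd k"
  then have e: "y * x powi k = (x powi (k div 2)) ^ 2 * (y * x)" using x by (simp add: powi_odd)
  show "y * x powi k \<in> squares F \<longleftrightarrow> y * x \<in> squares F"
    unfolding e by (rule squares_cancel(2)[OF F h])
qed

context quad_ext
begin

definition nm :: "complex \<Rightarrow> complex" where "nm z = z * cj z"

lemma nm_mult: "z \<in> adj F s \<Longrightarrow> w \<in> adj F s \<Longrightarrow> nm (z * w) = nm z * nm w"
  by (simp add: nm_def cj_mult mult_ac)

lemma nm_power: "z \<in> adj F s \<Longrightarrow> nm (z ^ n) = nm z ^ n"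
  by (simp add: nm_def cj_power power_mult_distrib)

lemma nm_powi: "z \<in> adj F s \<Longrightarrow> nm (z powi k) = nm z powi k"
  by (simp add: nm_def cj_powi power_int_mult_distrib)

lemma nm_base: "z \<in> F \<Longrightarrow> nm z = z ^ 2"
  by (simp add: nm_def cj_base power2_eq_square)

lemma nm_half: "z \<in> adj F s \<Longrightarrow> nm (z / 2) = nm z / 4"
proof -
  assume z: "z \<in> adj F s"
  have i: "inverse 2 \<in> F" by (rule F_intros(3)[OF F_intros(12)])
  show ?thesis
    unfolding divide_inverse nm_mult[OF z base_subset[OF i]] nm_base[OF i] by (simp add: power2_eq_square)
qed

lemma nm_coords: "x \<in> F \<Longrightarrow> y \<in> F \<Longrightarrow> nm (x + y * s) = x ^ 2 - y ^ 2 * s ^ 2"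
  by (simp add: nm_def cj_eq) (simp add: algebra_simps power2_eq_square)

lemma nm_nonzero: "z \<in> adj F s \<Longrightarrow> z \<noteq> 0 \<Longrightarrow> nm z \<noteq> 0"
proof (elim adjE)
  fix x y assume "z \<noteq> 0" "x \<in> F" "y \<in> F" "z = x + y * s"
  then show "nm z \<noteq> 0" using nonzero_norm[of x y] nm_coords[of x y] by simp
qed

text \<open>The tool for recognizing non-squares: the question is moved one level down the
  tower.\<close>

lemma nm_squares: "z \<in> squares (adj F s) \<Longrightarrow> nm z \<in> squares F"
  unfolding squares_def using nm_power nm_nonzero norm_in_base by (auto simp: nm_def[symmetric])

end

section \<open>Signs, valuation characters and the real octic field\<close>

definition pos_real :: "complex \<Rightarrow> bool" where "pos_real z \<longleftrightarrow> (\<exists>x > 0. z = of_real x)"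

lemma pos_real_intros:
  "pos_real z \<Longrightarrow> pos_real w \<Longrightarrow> pos_real (z * w)" "pos_real z \<Longrightarrow> pos_real (z powi k)"
  "pos_real z \<Longrightarrow> pos_real (z ^ n)" "pos_real 1" "pos_real z \<Longrightarrow> pos_real (inverse z)"
  unfolding pos_real_def by (auto simp flip: of_real_mult of_real_power_int of_real_power of_real_inverse
     intro: exI[of _ 1])

lemma pos_real_uminus: "pos_real z \<Longrightarrow> \<not> pos_real (- z)"
  unfolding pos_real_def by (auto simp flip: of_real_minus)

lemma pos_real_nonzero: "pos_real z \<Longrightarrow> z \<noteq> 0"
  by (auto simp: pos_real_def)

lemma pos_real_square: "x \<in> \<real> \<Longrightarrow> x \<noteq> 0 \<Longrightarrow> pos_real (x ^ 2)"
  by (auto elim!: Reals_cases simp: pos_real_def simp flip: of_real_power)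

lemma minus_one_powi: "(-1 :: complex) powi k = (if even k then 1 else -1)"
  by (simp add: power_int_minus_left)

text \<open>The parity of the p-adic valuation; it detects \<surd>p among square roots of
  integers.\<close>

definition vchar :: "nat \<Rightarrow> int \<Rightarrow> int" where "vchar p n = (-1) ^ multiplicity (int p) n"

lemma vchar_char: "Factorial_Ring.prime p \<Longrightarrow> mult_char (vchar p)"
  unfolding vchar_def by (rule mult_char_valuation) simp

lemma vchar_prime:
  assumes "Factorial_Ring.prime p" "Factorial_Ring.prime q"
  shows "vchar p (int q) = (if p = q then -1 else 1)" "vchar p (-1) = 1" "vchar p 1 = 1"
    "vchar p (- n) = vchar p n"
  using assms unfolding vchar_def
  by (auto simp: prime_multiplicity_other multiplicity_uminus_right) 

text \<open>Collects the outcome of the descents. The Legendre symbols enter only through the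
  orientation of the last three equations, which run cyclically from p1 to p2 to p3 and back to
  p1.\<close>

locale prime_triple =
  fixes p1 p2 p3 a1 b1 a2 b2 a3 b3 a b c1 d1 c2 d2 c3 d3 :: nat
  assumes primes: "Factorial_Ring.prime p1" "Factorial_Ring.prime p2" "Factorial_Ring.prime p3"
    and mod8: "p1 mod 8 = 7" "p2 mod 8 = 7" "p3 mod 8 = 7"
    and distinct: "p1 \<noteq> p2" "p1 \<noteq> p3" "p2 \<noteq> p3"
    and norm1: "a1 ^ 2 = p1 * b1 ^ 2 + 2" and sq1: "(real a1 + real b1 * sqrt p1) ^ 2 = 2 * fundamental_unit p1"
    and norm2: "a2 ^ 2 = p2 * b2 ^ 2 + 2" and sq2: "(real a2 + real b2 * sqrt p2) ^ 2 = 2 * fundamental_unit p2"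
    and norm3: "a3 ^ 2 = p3 * b3 ^ 2 + 2" and sq3: "(real a3 + real b3 * sqrt p3) ^ 2 = 2 * fundamental_unit p3"
    and normm: "a ^ 2 = p1 * p2 * p3 * b ^ 2 + 2"
    and sqm: "(real a + real b * sqrt (p1 * p2 * p3)) ^ 2 = 2 * fundamental_unit (p1 * p2 * p3)"
    and norm12: "p1 * c1 ^ 2 = p2 * d1 ^ 2 + 1" and sq12: "(real c1 * sqrt p1 + real d1 * sqrt p2) ^ 2 = fundamental_unit (p1 * p2)"
    and norm23: "p2 * c2 ^ 2 = p3 * d2 ^ 2 + 1" and sq23: "(real c2 * sqrt p2 + real d2 * sqrt p3) ^ 2 = fundamental_unit (p2 * p3)"
    and norm31: "p3 * c3 ^ 2 = p1 * d3 ^ 2 + 1" and sq31: "(real c3 * sqrt p3 + real d3 * sqrt p1) ^ 2 = fundamental_unit (p1 * p3)"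
begin

definition Kp :: "complex set" where "Kp = QF {int p1, int p2, int p3}"
text \<open>Roots of units: \<open>\<alpha>1\<close>, \<open>\<alpha>2\<close>,
  \<open>\<alpha>3\<close>, \<open>\<alpha>m\<close> are \<surd>(2 \<epsilon>) for p1, p2, p3 and p1
  p2 p3. \<open>T12\<close>, \<open>T23\<close>, \<open>T31\<close> are \<surd>\<epsilon> for
  products of two primes. \<open>A12\<close>, \<open>A13\<close>, \<open>A1m\<close> are
  \<surd>(\<epsilon>_p1 \<epsilon>) with the second unit for p2, p3 and p1 p2 p3; here the two
  factors 2 cancel.\<close>

definition \<alpha>1 :: real where "\<alpha>1 = real a1 + real b1 * sqrt p1"
definition \<alpha>2 :: real where "\<alpha>2 = real a2 + real b2 * sqrt p2"
definition \<alpha>3 :: real where "\<alpha>3 = real a3 + real b3 * sqrt p3"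
definition \<alpha>m :: real where "\<alpha>m = real a + real b * sqrt (p1 * p2 * p3)"
definition T12 :: real where "T12 = real c1 * sqrt p1 + real d1 * sqrt p2"
definition T23 :: real where "T23 = real c2 * sqrt p2 + real d2 * sqrt p3"
definition T31 :: real where "T31 = real c3 * sqrt p3 + real d3 * sqrt p1"
definition A12 :: real where "A12 = \<alpha>1 * \<alpha>2 / 2"
definition A13 :: real where "A13 = \<alpha>1 * \<alpha>3 / 2"
definition A1m :: real where "A1m = \<alpha>1 * \<alpha>m / 2"

lemmas Kp_intros = QF_intros[where D = "{int p1, int p2, int p3}", folded Kp_def]
lemma cKp: "closed_field Kp" unfolding Kp_def by (rule closed_field_QF)

lemma rt_real: "rt (int n) = of_real (sqrt (real n))"
  by (simp add: rt_nonneg)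

lemma rt_Kp: "rt (int p1) \<in> Kp" "rt (int p2) \<in> Kp" "rt (int p3) \<in> Kp"
  unfolding Kp_def by (intro rt_in_QF; simp)+

lemma sqrt_Kp: "of_real (sqrt (real p1)) \<in> Kp" "of_real (sqrt (real p2)) \<in> Kp" "of_real (sqrt (real p3)) \<in> Kp"
  using rt_Kp by (simp_all only: rt_real)

lemma pgt: "p1 > 0" "p2 > 0" "p3 > 0"
  using primes prime_gt_0_nat by auto

lemma notin1: "rt (int p1) \<notin> QF {int p2, int p3}"
  by (rule rt_notin_QF[OF vchar_char[OF primes(1)]])
     (use vchar_prime[OF primes(1)] primes distinct pgt in auto)
lemma notin2: "rt (int p2) \<notin> QF {int p1, int p3}"
  by (rule rt_notin_QF[OF vchar_char[OF primes(2)]])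
     (use vchar_prime[OF primes(2)] primes distinct pgt in auto)
lemma notin3: "rt (int p3) \<notin> QF {int p1, int p2}"
  by (rule rt_notin_QF[OF vchar_char[OF primes(3)]])
     (use vchar_prime[OF primes(3)] primes distinct pgt in auto)

text \<open>The octic field is quadratic over a biquadratic field in three ways; the conjugations of
  \<open>s1\<close>, \<open>s2\<close>, \<open>s3\<close> negate only \<surd>p1, \<surd>p2,
  \<surd>p3, respectively.\<close>

sublocale s1: quad_ext "QF {int p2, int p3}" "rt (int p1)"
  by (intro quad_ext.intro closed_field_QF notin1) (simp only: rt_square QF_intros(11))
sublocale s2: quad_ext "QF {int p1, int p3}" "rt (int p2)"
  by (intro quad_ext.intro closed_field_QF notin2) (simp only: rt_square QF_intros(11))
sublocale s3: quad_ext "QF {int p1, int p2}" "rt (int p3)"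
  by (intro quad_ext.intro closed_field_QF notin3) (simp only: rt_square QF_intros(11))

lemma Kp_adj:
  "adj (QF {int p2, int p3}) (rt (int p1)) = Kp"
  "adj (QF {int p1, int p3}) (rt (int p2)) = Kp"
  "adj (QF {int p1, int p2}) (rt (int p3)) = Kp"
  unfolding QF_insert[symmetric] Kp_def by (simp_all add: insert_commute)

lemma Kp_real: "Kp \<subseteq> \<real>"
proof -
  have "closed_field \<real>" by (auto simp: closed_field_def)
  then show ?thesis unfolding Kp_def QF_def
    by (rule rat_adjoin_subset) (auto simp: rt_real)
qed

lemma squares_pos: "x \<in> squares Kp \<Longrightarrow> pos_real x"
  unfolding squares_def using Kp_real by (auto intro: pos_real_square)

lemma two_not_square: "2 \<notin> squares Kp"
proof
  assume "2 \<in> squares Kp"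
  then obtain v where v: "v \<in> Kp" "v ^ 2 = of_int 2" by (auto simp: squares_def)
  have two: "Factorial_Ring.prime (2 :: nat)" by simp
  have ne: "2 \<noteq> p1" "2 \<noteq> p2" "2 \<noteq> p3" using mod8 by auto
  have "vchar 2 2 = -1" using vchar_prime(1)[OF two two] by simp
  then have "v ^ 2 \<noteq> of_int 2"
    by (rule nonsquare_QF[OF vchar_char[OF two]])
       (use vchar_prime(1)[OF two] primes ne pgt v(1) in \<open>auto simp: Kp_def\<close>)
  then show False using v(2) by blast
qed

lemma in_Kp:
  "of_real \<alpha>1 \<in> Kp" "of_real \<alpha>2 \<in> Kp" "of_real \<alpha>3 \<in> Kp" "of_real \<alpha>m \<in> Kp"
  "of_real T12 \<in> Kp" "of_real T23 \<in> Kp" "of_real T31 \<in> Kp"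
  "of_real A12 \<in> Kp" "of_real A13 \<in> Kp" "of_real A1m \<in> Kp"
proof -
  note i = Kp_intros(4,5,10) sqrt_Kp
  show "of_real \<alpha>1 \<in> Kp" "of_real \<alpha>2 \<in> Kp" "of_real \<alpha>3 \<in> Kp" "of_real T12 \<in> Kp" "of_real T23 \<in> Kp" "of_real T31 \<in> Kp"
    unfolding \<alpha>1_def \<alpha>2_def \<alpha>3_def T12_def T23_def T31_def of_real_add of_real_mult of_real_of_nat_eq
    by (intro i)+
  show "of_real \<alpha>m \<in> Kp"
    unfolding \<alpha>m_def of_nat_mult real_sqrt_mult of_real_add of_real_mult of_real_of_nat_eq by (intro i)
  then show "of_real A12 \<in> Kp" "of_real A13 \<in> Kp" "of_real A1m \<in> Kp"
    unfolding A12_def A13_def A1m_def of_real_divide of_real_mult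
    using \<open>of_real \<alpha>1 \<in> Kp\<close> \<open>of_real \<alpha>2 \<in> Kp\<close> \<open>of_real \<alpha>3 \<in> Kp\<close> Kp_intros(5,8,12) by auto
qed

lemma nats_pos: "a1 > 0" "a2 > 0" "a3 > 0" "a > 0" "c1 > 0" "c2 > 0" "c3 > 0"
  using norm1 norm2 norm3 normm norm12 norm23 norm31 by (auto intro!: Nat.gr0I)

lemma pos: "\<alpha>1 > 0" "\<alpha>2 > 0" "\<alpha>3 > 0" "\<alpha>m > 0" "T12 > 0" "T23 > 0" "T31 > 0" "A12 > 0" "A13 > 0" "A1m > 0"
  using nats_pos pgt
  by (auto simp: \<alpha>1_def \<alpha>2_def \<alpha>3_def \<alpha>m_def T12_def T23_def T31_def A12_def A13_def A1m_def
      intro!: add_pos_nonneg mult_pos_pos mult_nonneg_nonneg)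

lemma b_pos: "b1 > 0" "b2 > 0" "b3 > 0" "b > 0"
proof -
  have "n ^ 2 \<noteq> k * 0 ^ 2 + (2 :: nat)" for n k
  proof
    assume "n ^ 2 = k * 0 ^ 2 + 2"
    then have "n ^ 2 = 2" by simp
    from square_mod_8_cases[of n, unfolded this] show False by simp
  qed
  then show "b1 > 0" "b2 > 0" "b3 > 0" "b > 0" using norm1 norm2 norm3 normm by (metis gr0I)+
qed

end

lemma unit_group_mono: "closed_field F \<Longrightarrow> closed_field F' \<Longrightarrow> F \<subseteq> F' \<Longrightarrow> unit_group F \<subseteq> unit_group F'"
  by (auto simp: mem_unit_group_iff)

lemma squares_mono: "F \<subseteq> F' \<Longrightarrow> squares F \<subseteq> squares F'"
  by (auto simp: squares_def)

lemma fundamental_unit_in_unit_group: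
  assumes "squarefree m" "m > 1"
  shows "of_real (fundamental_unit m) \<in> unit_group (QF {int m})"
  unfolding fundamental_unit(2)[OF rt_notin_Rats[OF assms]] using mult_span_incl by blast

context prime_triple
begin

text \<open>This is \<epsilon>_p1, in a form that shows it to lie in the square class of 2.\<close>

definition E1 :: real where "E1 = \<alpha>1 ^ 2 / 2"

lemma E1_pos: "E1 > 0" using pos by (simp add: E1_def)

lemma E1_Kp: "of_real E1 \<in> Kp"
  unfolding E1_def using in_Kp(1) Kp_intros(8,9,12) by simp

lemma fu_eq: "fundamental_unit p1 = E1" "fundamental_unit p2 = \<alpha>2 ^ 2 / 2" "fundamental_unit p3 = \<alpha>3 ^ 2 / 2"
  "fundamental_unit (p1 * p2 * p3) = \<alpha>m ^ 2 / 2" "fundamental_unit (p1 * p2) = T12 ^ 2"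
  "fundamental_unit (p2 * p3) = T23 ^ 2" "fundamental_unit (p1 * p3) = T31 ^ 2"
  using sq1 sq2 sq3 sqm sq12 sq23 sq31
  by (simp_all add: E1_def \<alpha>1_def \<alpha>2_def \<alpha>3_def \<alpha>m_def T12_def T23_def T31_def)

lemma fields_sub_Kp: "QF {int p2, int p3} \<subseteq> Kp" "QF {int p1, int p3} \<subseteq> Kp" "QF {int p1, int p2} \<subseteq> Kp"
  unfolding Kp_def by (intro QF_mono; blast)+

lemma sqrt_sub: "of_real (sqrt (real p2)) \<in> QF {int p2, int p3}" "of_real (sqrt (real p3)) \<in> QF {int p2, int p3}"
  "of_real (sqrt (real p1)) \<in> QF {int p1, int p3}" "of_real (sqrt (real p3)) \<in> QF {int p1, int p3}"
  "of_real (sqrt (real p1)) \<in> QF {int p1, int p2}" "of_real (sqrt (real p2)) \<in> QF {int p1, int p2}"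
  unfolding rt_real[symmetric] by (intro rt_in_QF; simp)+

lemma sqrt_sq: "(of_real (sqrt (real n)) :: complex) ^ 2 = of_nat n"
  by (simp flip: of_real_power)

lemma nm_two_roots:
  assumes "quad_ext (QF D) (rt (int q))" "complex_of_real (sqrt (real p)) \<in> QF D"
  shows "quad_ext.nm (QF D) (rt (int q)) (of_real (real x * sqrt p + real y * sqrt q)) = of_int (int (p * x ^ 2) - int (q * y ^ 2))"
proof -
  interpret quad_ext "QF D" "rt (int q)" by (rule assms(1))
  have "nm (of_nat x * of_real (sqrt p) + of_nat y * rt (int q)) = (of_nat x * of_real (sqrt p)) ^ 2 - of_nat y ^ 2 * of_nat q"
    using nm_coords[OF QF_intros(5)[OF QF_intros(10) assms(2)] QF_intros(10), of x y] by simp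
  then show ?thesis unfolding power_mult_distrib sqrt_sq by (simp add: rt_nonneg mult.commute)
qed

lemma nm_one_root:
  assumes "quad_ext (QF D) (rt (int q))" "x ^ 2 = q * y ^ 2 + 2"
  shows "quad_ext.nm (QF D) (rt (int q)) (of_real (real x + real y * sqrt q)) = 2"
  using nm_two_roots[OF assms(1), of 1 x y] QF_intros(1) assms(2) by simp

lemmas sub_intros = QF_intros(4,5,10)

text \<open>The sign pattern behind the test for squares: among \<open>T12\<close>,
  \<open>T31\<close>, \<open>T23\<close> only \<open>T12\<close> has norm -1 here. For
  \<open>s2\<close> it is \<open>T23\<close>, and for \<open>s3\<close> it is
  \<open>T31\<close>.\<close>

lemma nm1_\<alpha>:
  "s1.nm (of_real \<alpha>1) = 2" "s1.nm (of_real \<alpha>2) = of_real (\<alpha>2 ^ 2)" "s1.nm (of_real \<alpha>3) = of_real (\<alpha>3 ^ 2)"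
  "s1.nm (of_real \<alpha>m) = 2" "s1.nm (of_real T12) = -1" "s1.nm (of_real T31) = 1" "s1.nm (of_real T23) = of_real (T23 ^ 2)"
proof -
  note two = nm_two_roots[OF s1.quad_ext_axioms]
  show "s1.nm (of_real \<alpha>1) = 2" unfolding \<alpha>1_def by (rule nm_one_root[OF s1.quad_ext_axioms norm1])
  have "s1.nm (of_nat a + (of_nat b * (of_real (sqrt p2) * of_real (sqrt p3))) * rt p1)
      = of_nat a ^ 2 - (of_nat b * (of_real (sqrt p2) * of_real (sqrt p3))) ^ 2 * of_nat p1"
    using s1.nm_coords[of "of_nat a" "of_nat b * (of_real (sqrt p2) * of_real (sqrt p3))"] sub_intros sqrt_sub by simp
  also have "\<dots> = of_int (int (a ^ 2) - int (p1 * p2 * p3 * b ^ 2))"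
    unfolding power_mult_distrib sqrt_sq by simp
  also have "\<dots> = 2" unfolding normm by simp
  finally show "s1.nm (of_real \<alpha>m) = 2" by (simp add: \<alpha>m_def rt_real real_sqrt_mult mult_ac)
  show "s1.nm (of_real T12) = -1" using two[OF sqrt_sub(1), of d1 c1] unfolding norm12 by (simp add: T12_def add.commute)
  show "s1.nm (of_real T31) = 1" using two[OF sqrt_sub(2), of c3 d3] unfolding norm31 by (simp add: T31_def)
  have "of_real \<alpha>2 \<in> QF {int p2, int p3}" "of_real \<alpha>3 \<in> QF {int p2, int p3}" "of_real T23 \<in> QF {int p2, int p3}"
    unfolding \<alpha>2_def \<alpha>3_def T23_def of_real_add of_real_mult of_real_of_nat_eq by (intro sub_intros sqrt_sub)+
  then show "s1.nm (of_real \<alpha>2) = of_real (\<alpha>2 ^ 2)" "s1.nm (of_real \<alpha>3) = of_real (\<alpha>3 ^ 2)" "s1.nm (of_real T23) = of_real (T23 ^ 2)"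
    by (simp_all add: s1.nm_base)
qed

lemma nm2_\<alpha>:
  "s2.nm (of_real \<alpha>2) = 2" "s2.nm (of_real \<alpha>1) = of_real (\<alpha>1 ^ 2)" "s2.nm (of_real \<alpha>3) = of_real (\<alpha>3 ^ 2)"
  "s2.nm (of_real T12) = 1" "s2.nm (of_real T23) = -1" "s2.nm (of_real T31) = of_real (T31 ^ 2)"
proof -
  note two = nm_two_roots[OF s2.quad_ext_axioms]
  show "s2.nm (of_real \<alpha>2) = 2" unfolding \<alpha>2_def by (rule nm_one_root[OF s2.quad_ext_axioms norm2])
  show "s2.nm (of_real T23) = -1" using two[OF sqrt_sub(4), of d2 c2] unfolding norm23 by (simp add: T23_def add.commute)
  show "s2.nm (of_real T12) = 1" using two[OF sqrt_sub(3), of c1 d1] unfolding norm12 by (simp add: T12_def)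
  have "of_real \<alpha>1 \<in> QF {int p1, int p3}" "of_real \<alpha>3 \<in> QF {int p1, int p3}" "of_real T31 \<in> QF {int p1, int p3}"
    unfolding \<alpha>1_def \<alpha>3_def T31_def of_real_add of_real_mult of_real_of_nat_eq by (intro sub_intros sqrt_sub)+
  then show "s2.nm (of_real \<alpha>1) = of_real (\<alpha>1 ^ 2)" "s2.nm (of_real \<alpha>3) = of_real (\<alpha>3 ^ 2)" "s2.nm (of_real T31) = of_real (T31 ^ 2)"
    by (simp_all add: s2.nm_base)
qed

lemma nm3_\<alpha>:
  "s3.nm (of_real \<alpha>3) = 2" "s3.nm (of_real \<alpha>1) = of_real (\<alpha>1 ^ 2)" "s3.nm (of_real \<alpha>2) = of_real (\<alpha>2 ^ 2)"
  "s3.nm (of_real T23) = 1" "s3.nm (of_real T31) = -1" "s3.nm (of_real T12) = of_real (T12 ^ 2)"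
proof -
  note two = nm_two_roots[OF s3.quad_ext_axioms]
  show "s3.nm (of_real \<alpha>3) = 2" unfolding \<alpha>3_def by (rule nm_one_root[OF s3.quad_ext_axioms norm3])
  show "s3.nm (of_real T31) = -1" using two[OF sqrt_sub(5), of d3 c3] unfolding norm31 by (simp add: T31_def add.commute)
  show "s3.nm (of_real T23) = 1" using two[OF sqrt_sub(6), of c2 d2] unfolding norm23 by (simp add: T23_def)
  have "of_real \<alpha>1 \<in> QF {int p1, int p2}" "of_real \<alpha>2 \<in> QF {int p1, int p2}" "of_real T12 \<in> QF {int p1, int p2}"
    unfolding \<alpha>1_def \<alpha>2_def T12_def of_real_add of_real_mult of_real_of_nat_eq by (intro sub_intros sqrt_sub)+
  then show "s3.nm (of_real \<alpha>1) = of_real (\<alpha>1 ^ 2)" "s3.nm (of_real \<alpha>2) = of_real (\<alpha>2 ^ 2)" "s3.nm (of_real T12) = of_real (T12 ^ 2)"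
    by (simp_all add: s3.nm_base)
qed

lemmas nmK1 = s1.nm_mult[unfolded Kp_adj] s1.nm_powi[unfolded Kp_adj] s1.nm_power[unfolded Kp_adj]
lemmas nmK2 = s2.nm_mult[unfolded Kp_adj] s2.nm_powi[unfolded Kp_adj] s2.nm_power[unfolded Kp_adj]
lemmas nmK3 = s3.nm_mult[unfolded Kp_adj] s3.nm_powi[unfolded Kp_adj] s3.nm_power[unfolded Kp_adj]

lemma product_expand:
  "complex_of_real E1 = of_real \<alpha>1 ^ 2 / 2"
  "complex_of_real A12 = of_real \<alpha>1 * of_real \<alpha>2 / 2"
  "complex_of_real A13 = of_real \<alpha>1 * of_real \<alpha>3 / 2"
  "complex_of_real A1m = of_real \<alpha>1 * of_real \<alpha>m / 2"
  by (simp_all add: E1_def A12_def A13_def A1m_def)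

lemmas nm_half = s1.nm_half[unfolded Kp_adj] s2.nm_half[unfolded Kp_adj] s3.nm_half[unfolded Kp_adj]

lemmas mem_simps = in_Kp E1_Kp Kp_intros(5) Kp_intros(9) Kp_intros(13)

lemma nm1_units:
  "s1.nm (of_real E1) = 1" "s1.nm (of_real A12) = of_real (\<alpha>2 ^ 2 / 2)" "s1.nm (of_real A13) = of_real (\<alpha>3 ^ 2 / 2)"
  "s1.nm (of_real A1m) = 1"
  unfolding product_expand by (simp_all add: nm_half nmK1 mem_simps nm1_\<alpha>)

lemma nm2_units:
  "s2.nm (of_real E1) = of_real (E1 ^ 2)" "s2.nm (of_real A12) = of_real E1" "s2.nm (of_real A13) = of_real (A13 ^ 2)"
  unfolding product_expand of_real_power
  by (simp_all add: nm_half nmK2 mem_simps nm2_\<alpha> power_divide power_mult_distrib)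

lemma nm3_units:
  "s3.nm (of_real E1) = of_real (E1 ^ 2)" "s3.nm (of_real A12) = of_real (A12 ^ 2)" "s3.nm (of_real A13) = of_real E1"
  unfolding product_expand of_real_power
  by (simp_all add: nm_half nmK3 mem_simps nm3_\<alpha> power_divide power_mult_distrib)

lemma posr: "x > 0 \<Longrightarrow> pos_real (of_real x)"
  by (auto simp: pos_real_def)

text \<open>Squares in a real field are positive.\<close>

lemma sign_even:
  assumes "(-1) powi j * z \<in> squares Kp" "pos_real z"
  shows "even j" "z \<in> squares Kp"
proof -
  show "even j"
  proof (rule ccontr)
    assume "odd j"
    then have "- z \<in> squares Kp" using assms(1) by (simp add: minus_one_powi)
    then show False using squares_pos pos_real_uminus[OF assms(2)] by blast
  qed
  then show "z \<in> squares Kp" using assms(1) by (simp add: minus_one_powi)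
qed

text \<open>Since \<alpha>1^2 = 2 \<epsilon>_p1, a square \<epsilon>_p1 would make 2 a square, which
  the valuation at 2 forbids.\<close>

lemma E1_not_square: "of_real E1 \<notin> squares Kp"
proof
  assume "of_real E1 \<in> squares Kp"
  moreover have "of_real \<alpha>1 ^ 2 \<in> squares Kp"
    using pos by (intro squares_closed(4)[OF cKp] in_Kp) simp
  moreover have "of_real \<alpha>1 ^ 2 = 2 * complex_of_real E1" by (simp add: E1_def)
  ultimately have "2 \<in> squares Kp" using squares_cancel(1)[OF cKp, of "of_real E1" 2] by simp
  then show False using two_not_square by blast
qed

lemma E1_power_square: "of_real E1 powi m \<in> squares Kp \<Longrightarrow> even m"
  using squares_powi(2)[OF cKp E1_Kp, of m 1] E1_pos E1_not_square by auto

text \<open>The norms are compared in \<open>Kp\<close> rather than in the subfields. Their signs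
  make j, l and k even; modulo squares the second and the third norm leave a power of
  \<open>E1\<close> with exponent m and n, so these are even as well. Then only the power of
  \<open>E1\<close> with exponent i remains in the word itself.\<close>

lemma square_exponents:
  assumes g: "of_real E1 powi i * of_real T12 powi j * of_real T31 powi k * of_real T23 powi l
    * of_real A12 powi m * of_real A13 powi n \<in> squares Kp" (is "?g \<in> _")
  shows "even i \<and> even j \<and> even k \<and> even l \<and> even m \<and> even n"
proof -
  have nz: "complex_of_real E1 \<noteq> 0" "complex_of_real T12 \<noteq> 0" "complex_of_real T31 \<noteq> 0" "complex_of_real T23 \<noteq> 0"
    "complex_of_real A12 \<noteq> 0" "complex_of_real A13 \<noteq> 0" using pos E1_pos by auto
  note sp = squares_powi(1)[OF cKp]
  have sq: "of_real (x ^ 2) powi r \<in> squares Kp" if "of_real x \<in> Kp" "x > 0" for x r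
  proof -
    have "complex_of_real (x ^ 2) powi r = (of_real x powi r) ^ 2"
      by (simp add: power2_eq_square power_int_mult_distrib)
    then show ?thesis using squares_closed(4)[OF cKp, of "of_real x powi r"] that Kp_intros(13) by simp
  qed
  have "s1.nm ?g \<in> squares (QF {int p2, int p3})" using s1.nm_squares g by (simp add: Kp_adj)
  then have "s1.nm ?g \<in> squares Kp" using squares_mono fields_sub_Kp by blast
  also have "s1.nm ?g = (-1) powi j * (of_real (T23 ^ 2) powi l * of_real (\<alpha>2 ^ 2 / 2) powi m * of_real (\<alpha>3 ^ 2 / 2) powi n)"
    by (simp add: nmK1 mem_simps nm1_\<alpha> nm1_units del: of_real_power of_real_divide)
  finally have j: "even j" by (rule sign_even) (intro pos_real_intros posr; use pos in simp)+
  have "s2.nm ?g \<in> squares (QF {int p1, int p3})" using s2.nm_squares g by (simp add: Kp_adj)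
  then have "s2.nm ?g \<in> squares Kp" using squares_mono fields_sub_Kp by blast
  also have "s2.nm ?g = (-1) powi l * (of_real (E1 ^ 2) powi i * of_real (T31 ^ 2) powi k * of_real E1 powi m * of_real (A13 ^ 2) powi n)"
    by (simp add: nmK2 mem_simps nm2_\<alpha> nm2_units del: of_real_power of_real_divide)
  finally have l: "even l" and m': "of_real (E1 ^ 2) powi i * of_real (T31 ^ 2) powi k * of_real E1 powi m * of_real (A13 ^ 2) powi n \<in> squares Kp"
    by (rule sign_even; intro pos_real_intros posr; use pos E1_pos in simp)+
  from m' have m: "even m"
    using E1_power_square sq[OF E1_Kp E1_pos] sq[OF in_Kp(7) pos(7)] sq[OF in_Kp(9) pos(9)]
    by (simp add: squares_cancel[OF cKp] del: of_real_power)
  have "s3.nm ?g \<in> squares (QF {int p1, int p2})" using s3.nm_squares g by (simp add: Kp_adj)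
  then have "s3.nm ?g \<in> squares Kp" using squares_mono fields_sub_Kp by blast
  also have "s3.nm ?g = (-1) powi k * (of_real (E1 ^ 2) powi i * of_real (T12 ^ 2) powi j * of_real (A12 ^ 2) powi m * of_real E1 powi n)"
    by (simp add: nmK3 mem_simps nm3_\<alpha> nm3_units del: of_real_power of_real_divide)
  finally have k: "even k" and n': "of_real (E1 ^ 2) powi i * of_real (T12 ^ 2) powi j * of_real (A12 ^ 2) powi m * of_real E1 powi n \<in> squares Kp"
    by (rule sign_even; intro pos_real_intros posr; use pos E1_pos in simp)+
  from n' have n: "even n"
    using E1_power_square sq[OF E1_Kp E1_pos] sq[OF in_Kp(5) pos(5)] sq[OF in_Kp(8) pos(8)]
    by (simp add: squares_cancel[OF cKp] del: of_real_power)
  from g have "of_real E1 powi i \<in> squares Kp"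
    using sp[OF in_Kp(5) nz(2) j] sp[OF in_Kp(7) nz(3) k] sp[OF in_Kp(6) nz(4) l] sp[OF in_Kp(8) nz(5) m] sp[OF in_Kp(9) nz(6) n]
    by (simp add: squares_cancel[OF cKp])
  then show ?thesis using E1_power_square j k l m n by blast
qed

lemma \<alpha>_units: "squarefree p1" "squarefree p2" "squarefree p3" "squarefree (p1 * p2 * p3)"
  "squarefree (p1 * p2)" "squarefree (p2 * p3)" "squarefree (p1 * p3)"
  "p1 > 1" "p2 > 1" "p3 > 1" "p1 * p2 * p3 > 1" "p1 * p2 > 1" "p2 * p3 > 1" "p1 * p3 > 1"
proof -
  show gt: "p1 > 1" "p2 > 1" "p3 > 1" using primes prime_gt_1_nat by auto
  then show "p1 * p2 * p3 > 1" "p1 * p2 > 1" "p2 * p3 > 1" "p1 * p3 > 1" by (metis less_1_mult)+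
  show "squarefree p1" "squarefree p2" "squarefree p3" using primes squarefree_prime by auto
  then show "squarefree (p1 * p2 * p3)" "squarefree (p1 * p2)" "squarefree (p2 * p3)" "squarefree (p1 * p3)"
    using primes distinct by (auto intro!: squarefree_mult_coprime simp: primes_coprime)
qed

text \<open>With z the four-fold product, A12 A13 A1m = \<alpha>1^2 z / 8 is a square in
  Kp(\<surd>2), hence 1 or 2 times a square in \<open>Kp\<close>. In the second case the factor
  \<epsilon>_p1 = \<alpha>1^2 / 2 cancels the 2; the choice of \<eta> records which case
  occurs.\<close>

lemma xi_exists:
  obtains \<eta> \<xi> :: real where "\<eta> = 1 \<or> \<eta> = E1" "\<xi> > 0" "of_real \<xi> \<in> Kp" "\<xi> ^ 2 = \<eta> * (A12 * A13 * A1m)"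
proof -
  define z where "z = (of_nat a1 + of_nat b1 * rt p1) * (of_nat a2 + of_nat b2 * rt p2)
    * (of_nat a3 + of_nat b3 * rt p3) * (of_nat a + of_nat b * rt (p1 * p2 * p3))"
  have z: "z = of_real (\<alpha>1 * \<alpha>2 * \<alpha>3 * \<alpha>m)"
    unfolding z_def rt_real by (simp add: \<alpha>1_def \<alpha>2_def \<alpha>3_def \<alpha>m_def)
  define \<epsilon> where "\<epsilon> = fundamental_unit p1 * fundamental_unit p2 * fundamental_unit p3 * fundamental_unit (p1 * p2 * p3)"
  \<comment> \<open>So z / 4 is a square root of a product of units and thus itself a unit.\<close>
  have z2: "(z / 4) ^ 2 = of_real \<epsilon>"
    unfolding z \<epsilon>_def fu_eq E1_def by (simp add: power_divide power_mult_distrib)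
  have u: "algebraic_int (complex_of_real (fundamental_unit m)) \<and> algebraic_int (inverse (complex_of_real (fundamental_unit m)))"
    if "squarefree m" "m > 1" for m
    using fundamental_unit_in_unit_group[OF that] mem_unit_group_iff[OF closed_field_QF] by blast
  note us = u[OF \<alpha>_units(1,8)] u[OF \<alpha>_units(2,9)] u[OF \<alpha>_units(3,10)] u[OF \<alpha>_units(4,11)]
  have "algebraic_int (complex_of_real \<epsilon>)" "algebraic_int (inverse (complex_of_real \<epsilon>))"
    unfolding \<epsilon>_def of_real_mult inverse_mult_distrib using us by (blast intro: algebraic_int_mult)+
  then have "algebraic_int ((z / 4) ^ 2)" "algebraic_int ((inverse (z / 4)) ^ 2)"
    unfolding power_inverse z2 by auto
  then have zi: "algebraic_int (z / 4)" "algebraic_int (inverse (z / 4))" by (auto dest: algebraic_int_of_power2)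
  have z0: "z \<noteq> 0" using pos by (simp add: z)
  obtain w where w: "w \<in> QF {2, int p1, int p2, int p3}" "z = w ^ 2"
    by (rule four_fold_product_square[OF primes norm1 norm2 norm3 normm b_pos, folded z_def, OF zi z0])
  have rt2: "rt 2 \<notin> Kp"
  proof
    assume "rt 2 \<in> Kp"
    moreover have "rt 2 \<noteq> 0" by (simp add: rt_nonneg)
    ultimately have "rt 2 ^ 2 \<in> squares Kp" by (rule squares_closed(4)[OF cKp])
    then show False using two_not_square by simp
  qed
  interpret L: quad_ext Kp "rt 2"
    by (intro quad_ext.intro cKp rt2) (simp only: rt_square Kp_intros(11))
  have Lw: "w \<in> adj Kp (rt 2)" using w(1) unfolding Kp_def QF_insert .
  note LI = closed_field_intros[OF L.closed_field_adj]
  define v where "v = of_real \<alpha>1 * w * inverse (2 * rt 2)"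
  have v: "v \<in> adj Kp (rt 2)"
    unfolding v_def by (intro LI(5) LI(3) LI(12) L.base_subset in_Kp Lw L.gen_in)
  have v2: "of_real (A12 * A13 * A1m) = v ^ 2"
    unfolding v_def power_mult_distrib w(2)[symmetric] z power_inverse rt_square A12_def A13_def A1m_def
    by (simp add: power2_eq_square power3_eq_cube)
  have "of_real (A12 * A13 * A1m) \<in> Kp" using in_Kp Kp_intros(5) by simp
  then obtain x where x: "x \<in> Kp" "of_real (A12 * A13 * A1m) = x ^ 2 \<or> of_real (A12 * A13 * A1m) = x ^ 2 * (rt 2) ^ 2"
    using L.square_in_ext[OF _ v2 v] by blast
  obtain t where t: "x = of_real t" using x(1) Kp_real by (auto elim!: Reals_cases)
  have abs_in: "of_real \<bar>r\<bar> \<in> Kp" if "of_real r \<in> Kp" for r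
    using that Kp_intros(2)[OF that] by (cases "r \<ge> 0") (auto simp: abs_if)
  have P: "A12 * A13 * A1m > 0" using pos by simp
  from x(2) show ?thesis
  proof
    assume "of_real (A12 * A13 * A1m) = x ^ 2"
    then have "complex_of_real (A12 * A13 * A1m) = of_real (t ^ 2)" by (simp add: t)
    then have e: "A12 * A13 * A1m = t ^ 2" by (simp only: of_real_eq_iff)
    then have "\<bar>t\<bar> > 0" using P by auto
    then show ?thesis using that[of 1 "\<bar>t\<bar>"] abs_in[of t] x(1) t e by simp
  next
    assume "of_real (A12 * A13 * A1m) = x ^ 2 * (rt 2) ^ 2"
    then have "complex_of_real (A12 * A13 * A1m) = of_real (t ^ 2 * 2)" by (simp add: t)
    then have e: "A12 * A13 * A1m = t ^ 2 * 2" by (simp only: of_real_eq_iff)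
    then have "t \<noteq> 0" using P by auto
    then have "\<bar>\<alpha>1 * t\<bar> > 0" using pos by simp
    moreover have "of_real (\<alpha>1 * t) \<in> Kp" using in_Kp(1) x(1) t Kp_intros(5) by simp
    moreover have "\<bar>\<alpha>1 * t\<bar> ^ 2 = E1 * (A12 * A13 * A1m)" unfolding e E1_def by (simp add: power_mult_distrib)
    ultimately show ?thesis using that[of E1 "\<bar>\<alpha>1 * t\<bar>"] abs_in by blast
  qed
qed

end

subsection \<open>The unit group of the real field\<close>

text \<open>Square roots are taken one at a time: the exponent 2^n comes down to 1, since each
  intermediate power of \<open>u\<close> is a unit whose square is already in the span.\<close>

lemma unit_group_subset_mult_span:
  assumes F: "closed_field F" and S: "0 \<notin> S"
    and tors: "\<And>u. u \<in> unit_group F \<Longrightarrow> u ^ (2 ^ n) \<in> mult_span S"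
    and root: "\<And>u. u \<in> unit_group F \<Longrightarrow> u ^ 2 \<in> mult_span S \<Longrightarrow> u \<in> mult_span S"
  shows "unit_group F \<subseteq> mult_span S"
proof
  fix u assume u: "u \<in> unit_group F"
  have pw: "v ^ k \<in> unit_group F" if "v \<in> unit_group F" for v k
    using unit_group_closed(5)[OF F that, of "int k"] by (simp add: power_int_of_nat)
  have "u ^ (2 ^ (n - k)) \<in> mult_span S" if "k \<le> n" for k
    using that
  proof (induction k)
    case 0
    then show ?case using tors[OF u] by simp
  next
    case (Suc k)
    have "n - k = Suc (n - Suc k)" using Suc.prems by simp
    then have "(u ^ (2 ^ (n - Suc k))) ^ 2 = u ^ (2 ^ (n - k))"
      by (simp add: power_mult[symmetric] mult.commute)
    then show ?case using root[OF pw[OF u, of "2 ^ (n - Suc k)"]] Suc by simp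
  qed
  from this[of n] show "u \<in> mult_span S" by simp
qed

text \<open>From x^2 + d y^2 = 1 with 2 x = t integral, \<bar>t\<bar> is at most 2. The value 1
  means d (2 y)^2 = 3, which singles out d = 3; the value 0 gives u^2 = -1, and 2 gives u^2 =
  1.\<close>

lemma imaginary_quadratic_units:
  assumes d: "squarefree d" "d \<noteq> 3" "d > 0" and u: "u \<in> unit_group (QF {- int d})"
  shows "u ^ 4 = 1"
proof -
  have rtd: "rt (- int d) = \<i> * of_real (sqrt d)"
    unfolding rt_def using csqrt_of_real_nonpos[of "- real d"] by simp
  have "rt (- int d) \<notin> \<rat>"
  proof
    assume "rt (- int d) \<in> \<rat>"
    then have "Im (rt (- int d)) = 0" by (auto elim!: Rats_cases')
    then show False using d(3) by (simp add: rtd)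
  qed
  then obtain x y :: real and t n :: int where xy: "x \<in> \<rat>" "y \<in> \<rat>" "u = of_real x + of_real y * rt (- int d)"
    "2 * x = of_int t" "x ^ 2 - of_int (- int d) * y ^ 2 = of_int n" "\<bar>n\<bar> = 1"
    using u by (rule quadratic_unit_form)
  have s: "x ^ 2 + d * y ^ 2 = of_int n" using xy(5) by simp
  moreover have "x ^ 2 + d * y ^ 2 \<ge> 0" by simp
  ultimately have "n = 1" using xy(6) by linarith
  then have s: "x ^ 2 + d * y ^ 2 = 1" using s by simp
  have dy: "d * y ^ 2 \<ge> 0" by simp
  have t4: "real_of_int (t ^ 2) + d * (2 * y) ^ 2 = 4"
    using s unfolding of_int_power xy(4)[symmetric] by (simp add: power_mult_distrib)
  moreover have "d * (2 * y) ^ 2 \<ge> 0" by simp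
  ultimately have "real_of_int (t ^ 2) \<le> 4" by linarith
  then have "real_of_int (t ^ 2) \<le> real_of_int (2 ^ 2)" by simp
  then have "t ^ 2 \<le> 2 ^ 2" by (simp only: of_int_le_iff)
  then have "\<bar>t\<bar> \<le> 2" using abs_le_square_iff[of t 2] by simp
  then have "t = 0 \<or> \<bar>t\<bar> = 1 \<or> \<bar>t\<bar> = 2" by linarith
  have y2: "2 * y \<in> \<rat>" using xy(2) by simp
  consider "t = 0" | "\<bar>t\<bar> = 1" | "\<bar>t\<bar> = 2" using \<open>t = 0 \<or> \<bar>t\<bar> = 1 \<or> \<bar>t\<bar> = 2\<close> by blast
  then show ?thesis
  proof cases
    case 1
    then have x0: "x = 0" using xy(4) by simp
    then have "(of_real y * of_real (sqrt d) :: complex) ^ 2 = 1"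
      using s by (simp add: power_mult_distrib mult.commute flip: of_real_mult of_real_power)
    then have "u ^ 2 = -1" unfolding xy(3) rtd x0 by (simp add: power_mult_distrib mult.left_commute)
    then have "(u ^ 2) ^ 2 = 1" by simp
    then show ?thesis by (simp flip: power_mult)
  next
    case 2
    then have "t ^ 2 = 1" by (metis one_power2 power2_abs)
    then have e: "d * (2 * y) ^ 2 = of_int 3" using t4 by simp
    then obtain k :: int where k: "2 * y = of_int k"
      using rational_of_squarefree_mult_square[OF d(1) y2] by blast
    have "real_of_int (int d * k ^ 2) = real_of_int 3" using e unfolding k by simp
    then have dk: "int d * k ^ 2 = 3" by (simp only: of_int_eq_iff)
    then have "k ^ 2 dvd 3" by (metis dvd_triv_right)
    then have "k ^ 2 \<le> 3" by (rule zdvd_imp_le) simp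
    then have "\<bar>k\<bar> < 2" using abs_less_iff power2_less_imp_less[of "\<bar>k\<bar>" 2] by simp
    moreover have "k \<noteq> 0" using dk by auto
    ultimately have "\<bar>k\<bar> = 1" by linarith
    then have "k ^ 2 = 1" by (metis one_power2 power2_abs)
    then show ?thesis using dk d(2) by simp
  next
    case 3
    then have "t ^ 2 = 4" by (metis power2_abs four_x_squared mult.right_neutral one_power2 numeral_times_numeral power2_eq_square semiring_norm(11) semiring_norm(13))
    then have "d * (2 * y) ^ 2 = 0" using t4 by simp
    then have "y = 0" using d(3) by simp
    then have "u = of_real x" "x ^ 2 = 1" using xy(3) s by simp_all
    then have "u ^ 2 = 1" by (simp flip: of_real_power)
    then have "(u ^ 2) ^ 2 = 1" by simp
    then show ?thesis by (simp flip: power_mult)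
  qed
qed

lemma mult_span_insertE:
  assumes "x \<in> mult_span (insert g S)" "0 \<notin> S" "g \<noteq> 0"
  obtains k y where "x = g powi k * y" "y \<in> mult_span S"
  using assms by (auto simp: mult_span_insert)

locale prime_triple_root = prime_triple +
  fixes \<eta> \<xi> :: real
  assumes eta: "\<eta> = 1 \<or> \<eta> = E1" and xi_pos: "\<xi> > 0" and xi_Kp: "of_real \<xi> \<in> Kp"
    and xi_sq: "\<xi> ^ 2 = \<eta> * (A12 * A13 * A1m)"
begin

definition Sp :: "complex set" where
  "Sp = {-1, of_real E1, of_real T12, of_real A12, of_real T31, of_real A13, of_real T23, of_real \<xi>}"

text \<open>The sign is kept apart, so that every word is a positive real.\<close>

definition word :: "int \<Rightarrow> int \<Rightarrow> int \<Rightarrow> int \<Rightarrow> int \<Rightarrow> int \<Rightarrow> int \<Rightarrow> complex" where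
  "word i j k l m n h = of_real E1 powi i * of_real T12 powi j * of_real T31 powi k * of_real T23 powi l
    * of_real A12 powi m * of_real A13 powi n * of_real \<xi> powi h"

lemma gens_nonzero: "complex_of_real E1 \<noteq> 0" "complex_of_real T12 \<noteq> 0" "complex_of_real T31 \<noteq> 0"
  "complex_of_real T23 \<noteq> 0" "complex_of_real A12 \<noteq> 0" "complex_of_real A13 \<noteq> 0" "complex_of_real \<xi> \<noteq> 0"
  using pos E1_pos xi_pos by auto

lemma word_pos: "pos_real (word i j k l m n h)"
  unfolding word_def by (intro pos_real_intros posr pos E1_pos xi_pos)

lemma word_Kp: "word i j k l m n h \<in> Kp"
  unfolding word_def by (intro Kp_intros(5) Kp_intros(13) in_Kp E1_Kp xi_Kp)

lemma word_double: "word (2 * i) (2 * j) (2 * k) (2 * l) (2 * m) (2 * n) (2 * h) = word i j k l m n h ^ 2"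
proof -
  have p: "x powi (2 * q) = (x powi q) ^ 2" for x :: complex and q
    using powi_even[of "2 * q" x] by simp
  show ?thesis unfolding word_def p power_mult_distrib ..
qed

text \<open>Suppose h is odd. The norm of \<xi> to Q(\<surd>p2, \<surd>p3) is, by squaring,
  \<plusminus>\<alpha>2 \<alpha>3 / 2. This equals \<plusminus>A12 A13 / E1, and it makes the
  exponents of \<open>A12\<close> and \<open>A13\<close> in the norm of the word odd, against
  \<open>square_exponents\<close>.\<close>

lemma word_square_exponents:
  assumes g: "word i j k l m n h \<in> squares Kp"
  shows "even i \<and> even j \<and> even k \<and> even l \<and> even m \<and> even n \<and> even h"
proof -
  define g0 :: complex where "g0 = of_real E1 powi i * of_real T12 powi j * of_real T31 powi k * of_real T23 powi l
    * of_real A12 powi m * of_real A13 powi n"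
  have g': "g0 * of_real \<xi> powi h \<in> squares Kp" using g by (simp add: word_def g0_def)
  have "even h"
  proof (rule ccontr)
    assume "odd h"
    then have gx: "g0 * of_real \<xi> \<in> squares Kp"
      using g' squares_powi(2)[OF cKp xi_Kp] gens_nonzero by simp
    have "s1.nm (g0 * of_real \<xi>) \<in> squares (QF {int p2, int p3})" using s1.nm_squares gx by (simp add: Kp_adj)
    then have sq: "s1.nm (g0 * of_real \<xi>) \<in> squares Kp" using squares_mono fields_sub_Kp by blast
    have nm_one: "s1.nm 1 = 1" using s1.nm_base[OF QF_intros(1)] by simp
    have "(s1.nm (of_real \<xi>)) ^ 2 = s1.nm (of_real (\<xi> ^ 2))"
      using nmK1(3)[OF xi_Kp, of 2] by simp
    also have "\<dots> = s1.nm (of_real \<eta>) * (s1.nm (of_real A12) * s1.nm (of_real A13) * s1.nm (of_real A1m))"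
      using eta E1_Kp Kp_intros(1) unfolding xi_sq of_real_mult by (auto simp: nmK1 mem_simps nm_one)
    also have "s1.nm (of_real \<eta>) = 1"
      using eta nm1_units(1) nm_one by auto
    also have "1 * (s1.nm (of_real A12) * s1.nm (of_real A13) * s1.nm (of_real A1m)) = (of_real (\<alpha>2 * \<alpha>3 / 2)) ^ 2"
      unfolding nm1_units by (simp add: power_mult_distrib power_divide)
    finally have "s1.nm (of_real \<xi>) = of_real (\<alpha>2 * \<alpha>3 / 2) \<or> s1.nm (of_real \<xi>) = - of_real (\<alpha>2 * \<alpha>3 / 2)"
      by (simp only: power2_eq_iff)
    \<comment> \<open>The sign of the norm of \<xi> stays undetermined; it joins the sign (-1)^j,
      and positivity of squares disposes of both.\<close>
    then obtain e where e: "s1.nm (of_real \<xi>) = (-1) powi e * of_real (\<alpha>2 * \<alpha>3 / 2)"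
      by (metis minus_one_powi even_zero odd_one mult_1 mult_minus1)
    define D where "D = of_real (T23 ^ 2) powi l * of_real (\<alpha>2 ^ 2 / 2) powi m * of_real (\<alpha>3 ^ 2 / 2) powi n
      * complex_of_real (\<alpha>2 * \<alpha>3 / 2)"
    have g0in: "g0 \<in> Kp" unfolding g0_def by (intro Kp_intros(5) Kp_intros(13) in_Kp E1_Kp)
    have "s1.nm (g0 * of_real \<xi>) = (-1) powi (j + e) * D"
    proof -
      have "s1.nm g0 = (-1) powi j * (of_real (T23 ^ 2) powi l * of_real (\<alpha>2 ^ 2 / 2) powi m * of_real (\<alpha>3 ^ 2 / 2) powi n)"
        unfolding g0_def by (simp add: nmK1 mem_simps nm1_\<alpha> nm1_units del: of_real_power of_real_divide)
      then show ?thesis unfolding nmK1(1)[OF g0in xi_Kp] e D_def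
        by (simp add: power_int_add mult_ac del: of_real_power of_real_divide)
    qed
    with sq have "(-1) powi (j + e) * D \<in> squares Kp" by simp
    then have D: "D \<in> squares Kp"
      by (rule sign_even(2)) (unfold D_def, intro pos_real_intros posr; use pos in simp)
    \<comment> \<open>\<open>square_exponents\<close> speaks of words in the generators, so what is
      left of \<alpha>2 and \<alpha>3 is expressed through \<open>A12\<close>, \<open>A13\<close>
      and \<open>E1\<close>.\<close>
    have e2: "complex_of_real (\<alpha>2 ^ 2 / 2) = of_real A12 ^ 2 * inverse (of_real E1)"
      "complex_of_real (\<alpha>3 ^ 2 / 2) = of_real A13 ^ 2 * inverse (of_real E1)"
      "complex_of_real (\<alpha>2 * \<alpha>3 / 2) = of_real A12 * of_real A13 * inverse (of_real E1)"
      using pos by (simp_all add: A12_def A13_def E1_def field_simps power2_eq_square)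
    have pw: "(x ^ 2) powi q = x powi (2 * q)" for x :: complex and q
      using powi_even[of "2 * q" x] by (simp add: power2_eq_square power_int_mult_distrib)
    have odd1: "x powi (2 * q) * x = x powi (2 * q + 1)" if "x \<noteq> 0" for x :: complex and q
      using that by (simp add: power_int_add_1)
    have inv1: "inverse x powi q * inverse x powi r * inverse x = x powi (- (q + r + 1))" if "x \<noteq> 0" for x :: complex and q r
      using that by (simp add: power_int_add power_int_diff power_int_minus power_int_inverse field_simps)
    have "D = of_real T23 powi (2 * l) * (of_real A12 powi (2 * m) * of_real A12) * (of_real A13 powi (2 * n) * of_real A13)
      * (inverse (of_real E1) powi m * inverse (of_real E1) powi n * inverse (of_real E1))"
      unfolding D_def e2 power_int_mult_distrib of_real_power pw by (simp only: mult_ac)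
    also have "\<dots> = of_real E1 powi (- (m + n + 1)) * of_real T12 powi 0 * of_real T31 powi 0 * of_real T23 powi (2 * l)
      * of_real A12 powi (2 * m + 1) * of_real A13 powi (2 * n + 1)"
      unfolding odd1[OF gens_nonzero(5)] odd1[OF gens_nonzero(6)] inv1[OF gens_nonzero(1)] by simp
    finally have "even (2 * m + 1)" using D square_exponents by metis
    then show False by simp
  qed
  then have "g0 \<in> squares Kp"
    using g' squares_powi(1)[OF cKp xi_Kp gens_nonzero(7)] squares_cancel(1)[OF cKp] by blast
  then show ?thesis using square_exponents \<open>even h\<close> unfolding g0_def by blast
qed

lemma Sp_nonzero: "0 \<notin> Sp" using gens_nonzero by (auto simp: Sp_def)

lemmas Sp_closed = mult_span_closed[OF Sp_nonzero] mult_span_powi[OF Sp_nonzero]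

lemma Sp_gens: "-1 \<in> mult_span Sp" "of_real E1 \<in> mult_span Sp" "of_real T12 \<in> mult_span Sp" "of_real A12 \<in> mult_span Sp"
  "of_real T31 \<in> mult_span Sp" "of_real A13 \<in> mult_span Sp" "of_real T23 \<in> mult_span Sp" "of_real \<xi> \<in> mult_span Sp"
  using mult_span_incl[of Sp] unfolding Sp_def by blast+

lemma word_Sp: "word i j k l m n h \<in> mult_span Sp"
  unfolding word_def by (intro Sp_closed(4,5) Sp_gens)

text \<open>The six generators common to both unit groups; the groups differ in the root of unity
  and in having \<open>E1\<close> or \<zeta>.\<close>

lemma core_words:
  assumes "x \<in> mult_span {of_real T12, of_real A12, of_real T31, of_real A13, of_real T23, of_real \<xi>}"
  obtains j k l m n h where "x = word 0 j k l m n h"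
proof -
  note E = mult_span_insertE
  obtain j x3 where 3: "x = of_real T12 powi j * x3" and m3: "x3 \<in> mult_span {of_real A12,
      of_real T31, of_real A13, of_real T23, of_real \<xi>}"
    using E[OF assms] gens_nonzero by auto
  obtain m x4 where 4: "x3 = of_real A12 powi m * x4" and m4: "x4 \<in> mult_span {of_real T31, of_real A13, of_real T23, of_real \<xi>}"
    using E[OF m3] gens_nonzero by auto
  obtain k x5 where 5: "x4 = of_real T31 powi k * x5" and m5: "x5 \<in> mult_span {of_real A13, of_real T23, of_real \<xi>}"
    using E[OF m4] gens_nonzero by auto
  obtain n x6 where 6: "x5 = of_real A13 powi n * x6" and m6: "x6 \<in> mult_span {of_real T23, of_real \<xi>}"
    using E[OF m5] gens_nonzero by auto
  obtain l x7 where 7: "x6 = of_real T23 powi l * x7" and m7: "x7 \<in> mult_span {of_real \<xi>}"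
    using E[OF m6] gens_nonzero by auto
  obtain h where 8: "x7 = of_real \<xi> powi h"
    using E[OF m7] gens_nonzero by (auto simp: mult_span_empty)
  have "x = word 0 j k l m n h"
    unfolding 3 4 5 6 7 8 word_def power_int_0_right mult_1_left by (simp only: mult_ac)
  then show ?thesis by (rule that)
qed

lemma Sp_words:
  assumes "x \<in> mult_span Sp"
  obtains s i j k l m n h where "x = (-1) powi s * word i j k l m n h"
proof -
  obtain s x1 where 1: "x = (-1) powi s * x1" and m1: "x1 \<in> mult_span {of_real E1, of_real T12, of_real A12,
      of_real T31, of_real A13, of_real T23, of_real \<xi>}"
    using mult_span_insertE[OF assms[unfolded Sp_def]] gens_nonzero by auto
  obtain i x2 where 2: "x1 = of_real E1 powi i * x2" and m2: "x2 \<in> mult_span {of_real T12, of_real A12,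
      of_real T31, of_real A13, of_real T23, of_real \<xi>}"
    using mult_span_insertE[OF m1] gens_nonzero by auto
  obtain j k l m n h where 3: "x2 = word 0 j k l m n h" using m2 by (rule core_words)
  have "x = (-1) powi s * word i j k l m n h"
    unfolding 1 2 3 word_def by (simp add: mult.assoc)
  then show ?thesis by (rule that)
qed

text \<open>The units for p2 and p3 are A12^2 / E1 and A13^2 / E1. For p1 p2 p3, the relation
  \<xi>^2 = \<eta> A12 A13 A1m is solved for \<open>A1m\<close>.\<close>

lemma unit_squares_in: "of_real (fundamental_unit p1) \<in> mult_span Sp" "of_real (fundamental_unit p2) \<in> mult_span Sp"
  "of_real (fundamental_unit p3) \<in> mult_span Sp" "of_real (fundamental_unit (p1 * p2)) \<in> mult_span Sp"
  "of_real (fundamental_unit (p2 * p3)) \<in> mult_span Sp" "of_real (fundamental_unit (p1 * p3)) \<in> mult_span Sp"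
  "of_real (fundamental_unit (p1 * p2 * p3)) \<in> mult_span Sp"
proof -
  have pw: "x ^ q \<in> mult_span Sp" if "x \<in> mult_span Sp" for x q
    using Sp_closed(5)[OF that, of "int q"] by (simp add: power_int_of_nat)
  show "of_real (fundamental_unit p1) \<in> mult_span Sp" unfolding fu_eq by (rule Sp_gens)
  have 2: "complex_of_real (fundamental_unit p2) = of_real A12 ^ 2 * inverse (of_real E1)"
    "complex_of_real (fundamental_unit p3) = of_real A13 ^ 2 * inverse (of_real E1)"
    using pos unfolding fu_eq by (simp_all add: A12_def A13_def E1_def field_simps power2_eq_square)
  show "of_real (fundamental_unit p2) \<in> mult_span Sp" "of_real (fundamental_unit p3) \<in> mult_span Sp"
    unfolding 2 by (intro Sp_closed(3,4) pw Sp_gens)+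
  show "of_real (fundamental_unit (p1 * p2)) \<in> mult_span Sp" "of_real (fundamental_unit (p2 * p3)) \<in> mult_span Sp"
    "of_real (fundamental_unit (p1 * p3)) \<in> mult_span Sp"
    unfolding fu_eq of_real_power by (intro pw Sp_gens)+
  have "A1m = \<xi> ^ 2 * inverse (\<eta> * A12 * A13)"
    unfolding xi_sq using pos eta E1_pos by (auto simp: field_simps)
  moreover have "\<alpha>m ^ 2 / 2 = A1m ^ 2 * inverse E1" using pos by (simp add: A1m_def E1_def field_simps power2_eq_square)
  ultimately have m: "complex_of_real (fundamental_unit (p1 * p2 * p3)) = (of_real \<xi> ^ 2 * inverse (of_real \<eta> * of_real A12 * of_real A13)) ^ 2 * inverse (of_real E1)"
    unfolding fu_eq by simp
  have "of_real \<eta> \<in> mult_span Sp" using eta Sp_gens(2) Sp_closed(1) by auto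
  then show "of_real (fundamental_unit (p1 * p2 * p3)) \<in> mult_span Sp"
    unfolding m by (intro Sp_closed(3,4) pw Sp_gens)
qed

lemma quadratic_units_in:
  assumes "squarefree m" "m > 1" "of_real (fundamental_unit m) \<in> mult_span Sp" "u \<in> unit_group (QF {int m})"
  shows "u \<in> mult_span Sp"
proof -
  have "mult_span {-1, complex_of_real (fundamental_unit m)} \<subseteq> mult_span Sp"
    using fundamental_unit(1)[OF rt_notin_Rats[OF assms(1,2)]] assms(3) Sp_gens(1) Sp_closed
    by (intro mult_span_subset) auto
  then show ?thesis using assms(4) unfolding fundamental_unit(2)[OF rt_notin_Rats[OF assms(1,2)]] by blast
qed

lemma vchar_values:
  "vchar p1 (int p1) = -1" "vchar p1 (int p2) = 1" "vchar p1 (int p3) = 1"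
  "vchar p2 (int p1) = 1" "vchar p2 (int p2) = -1" "vchar p2 (int p3) = 1"
  "vchar p3 (int p1) = 1" "vchar p3 (int p2) = 1" "vchar p3 (int p3) = -1"
  "vchar p1 (-1) = 1" "vchar p2 (-1) = 1" "vchar p3 (-1) = 1" "vchar p1 1 = 1" "vchar p2 1 = 1" "vchar p3 1 = 1"
  using vchar_prime primes distinct by auto

lemma vchar_mult: "x \<noteq> 0 \<Longrightarrow> y \<noteq> 0 \<Longrightarrow> vchar p1 (x * y) = vchar p1 x * vchar p1 y"
  "x \<noteq> 0 \<Longrightarrow> y \<noteq> 0 \<Longrightarrow> vchar p2 (x * y) = vchar p2 x * vchar p2 y"
  "x \<noteq> 0 \<Longrightarrow> y \<noteq> 0 \<Longrightarrow> vchar p3 (x * y) = vchar p3 x * vchar p3 y"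
  by (intro mult_charD(1) vchar_char primes; assumption)+

lemma vchar_neg: "vchar p1 (- x) = vchar p1 x" "vchar p2 (- x) = vchar p2 x" "vchar p3 (- x) = vchar p3 x"
  using vchar_prime(4) primes by auto

lemmas pnz = pgt[THEN gr_implies_not0]

text \<open>These are the three fields between Q(\<surd>p1) and the octic field; the square of a
  unit in any of them is a product of units of quadratic fields.\<close>

lemma real_biquadratic_units:
  assumes "u \<in> unit_group (QF {int p1, int p2}) \<or> u \<in> unit_group (QF {int p1, int p3})
    \<or> u \<in> unit_group (QF {int p1, int p2 * int p3})"
  shows "u ^ 2 \<in> mult_span Sp"
proof -
  note vs = vchar_values vchar_mult pgt pnz
  note qu = quadratic_units_in[OF \<alpha>_units(1,8) unit_squares_in(1)] quadratic_units_in[OF \<alpha>_units(2,9) unit_squares_in(2)]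
    quadratic_units_in[OF \<alpha>_units(3,10) unit_squares_in(3)] quadratic_units_in[OF \<alpha>_units(4,11) unit_squares_in(7)]
    quadratic_units_in[OF \<alpha>_units(5,12) unit_squares_in(4)] quadratic_units_in[OF \<alpha>_units(6,13) unit_squares_in(5)]
    quadratic_units_in[OF \<alpha>_units(7,14) unit_squares_in(6)]
  note chars = vchar_char[OF primes(1)] vchar_char[OF primes(2)] vchar_char[OF primes(3)]
  from assms show ?thesis
  proof (elim disjE)
    assume u: "u \<in> unit_group (QF {int p1, int p2})"
    obtain x y z where "x \<in> unit_group (QF {int p1})" "y \<in> unit_group (QF {int p2})"
      "z \<in> unit_group (QF {int p1 * int p2})" "u ^ 2 = x * y * z"
      by (rule biquadratic_QF[of "{}" "int p1" "int p2" "vchar p1" "vchar p2" u]) (assumption | simp add: vs chars u)+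
    then show ?thesis using qu Sp_closed(4) by simp
  next
    assume u: "u \<in> unit_group (QF {int p1, int p3})"
    obtain x y z where "x \<in> unit_group (QF {int p1})" "y \<in> unit_group (QF {int p3})"
      "z \<in> unit_group (QF {int p1 * int p3})" "u ^ 2 = x * y * z"
      by (rule biquadratic_QF[of "{}" "int p1" "int p3" "vchar p1" "vchar p3" u]) (assumption | simp add: vs chars u)+
    then show ?thesis using qu Sp_closed(4) by simp
  next
    assume u: "u \<in> unit_group (QF {int p1, int p2 * int p3})"
    obtain x y z where "x \<in> unit_group (QF {int p1})" "y \<in> unit_group (QF {int p2 * int p3})"
      "z \<in> unit_group (QF {int p1 * (int p2 * int p3)})" "u ^ 2 = x * y * z"
      by (rule biquadratic_QF[of "{}" "int p1" "int p2 * int p3" "vchar p1" "vchar p2" u]) (assumption | simp add: vs chars u)+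
    then show ?thesis using qu Sp_closed(4) by (simp add: mult.assoc)
  qed
qed

text \<open>Another application of the biquadratic identity, now over Q(\<surd>p1), doubles the
  exponent.\<close>

lemma Kp_units_fourth_power:
  assumes u: "u \<in> unit_group Kp"
  shows "u ^ 4 \<in> mult_span Sp"
proof -
  note vs = vchar_values vchar_mult pgt pnz
  note chars = vchar_char[OF primes(1)] vchar_char[OF primes(2)] vchar_char[OF primes(3)]
  have u': "u \<in> unit_group (QF {int p2, int p3, int p1})" using u by (simp add: Kp_def insert_commute)
  obtain x y z where xyz: "x \<in> unit_group (QF {int p2, int p1})" "y \<in> unit_group (QF {int p3, int p1})"
      "z \<in> unit_group (QF {int p2 * int p3, int p1})" "u ^ 2 = x * y * z"
    by (rule biquadratic_QF[of "{int p1}" "int p2" "int p3" "vchar p2" "vchar p3" u]) (assumption | simp add: vs chars u')+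
  have "u ^ 4 = (u ^ 2) ^ 2" by (simp flip: power_mult)
  also have "\<dots> = x ^ 2 * y ^ 2 * z ^ 2" by (simp add: xyz(4) power_mult_distrib)
  also have "\<dots> \<in> mult_span Sp"
    using xyz(1-3) by (intro Sp_closed(4) real_biquadratic_units) (simp_all add: insert_commute)
  finally show ?thesis .
qed

lemma Sp_units: "mult_span Sp \<subseteq> unit_group Kp"
proof -
  note m = mem_unit_group_iff[OF cKp]
  have e1: "of_real (fundamental_unit m) \<in> Kp \<Longrightarrow> squarefree m \<Longrightarrow> m > 1 \<Longrightarrow> of_real (fundamental_unit m) \<in> unit_group Kp" for m
    using fundamental_unit_in_unit_group[of m] unfolding m mem_unit_group_iff[OF closed_field_QF] by blast
  have root: "x \<in> unit_group Kp" if "x \<in> Kp" "x ^ 2 \<in> unit_group Kp" for x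
  proof -
    have "algebraic_int (inverse x ^ 2)" using that(2) unfolding m by (simp add: power_inverse)
    then have "algebraic_int (inverse x)" by (rule algebraic_int_of_power2)
    then show ?thesis using that unfolding m by (auto intro: algebraic_int_of_power2)
  qed
  note Uc = unit_group_closed[OF cKp]
  have fK: "of_real (fundamental_unit p1) \<in> Kp" "of_real (fundamental_unit p2) \<in> Kp" "of_real (fundamental_unit p3) \<in> Kp"
    "of_real (fundamental_unit (p1 * p2)) \<in> Kp" "of_real (fundamental_unit (p2 * p3)) \<in> Kp" "of_real (fundamental_unit (p1 * p3)) \<in> Kp"
    "of_real (fundamental_unit (p1 * p2 * p3)) \<in> Kp"
    unfolding fu_eq of_real_power of_real_divide of_real_numeral by (intro Kp_intros(8) Kp_intros(9) Kp_intros(12) in_Kp E1_Kp)+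
  note fU = e1[OF fK(1) \<alpha>_units(1,8)] e1[OF fK(2) \<alpha>_units(2,9)] e1[OF fK(3) \<alpha>_units(3,10)]
    e1[OF fK(4) \<alpha>_units(5,12)] e1[OF fK(5) \<alpha>_units(6,13)] e1[OF fK(6) \<alpha>_units(7,14)] e1[OF fK(7) \<alpha>_units(4,11)]
  have E1U: "of_real E1 \<in> unit_group Kp" using fU(1) by (simp add: fu_eq)
  have TU: "of_real T12 \<in> unit_group Kp" "of_real T23 \<in> unit_group Kp" "of_real T31 \<in> unit_group Kp"
    using fU(4-6) root in_Kp unfolding fu_eq of_real_power by blast+
  have A2: "(of_real A12) ^ 2 = complex_of_real (fundamental_unit p1) * of_real (fundamental_unit p2)"
    "(of_real A13) ^ 2 = complex_of_real (fundamental_unit p1) * of_real (fundamental_unit p3)"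
    "(of_real A1m) ^ 2 = complex_of_real (fundamental_unit p1) * of_real (fundamental_unit (p1 * p2 * p3))"
    unfolding fu_eq by (simp_all add: A12_def A13_def A1m_def E1_def power_mult_distrib power_divide)
  have "of_real A12 ^ 2 \<in> unit_group Kp" "of_real A13 ^ 2 \<in> unit_group Kp" "of_real A1m ^ 2 \<in> unit_group Kp"
    unfolding A2 using Uc(2) fU by blast+
  then have AU: "of_real A12 \<in> unit_group Kp" "of_real A13 \<in> unit_group Kp" "of_real A1m \<in> unit_group Kp"
    using root in_Kp by blast+
  have "of_real \<eta> \<in> unit_group Kp" using eta E1U Uc(1) by auto
  then have "of_real \<xi> ^ 2 \<in> unit_group Kp"
    unfolding of_real_power[symmetric] xi_sq of_real_mult using AU by (intro Uc(2))
  then have "of_real \<xi> \<in> unit_group Kp" by (rule root[OF xi_Kp])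
  then show ?thesis
    using E1U TU AU Uc Sp_nonzero by (intro mult_span_subset) (auto simp: Sp_def)
qed

text \<open>The square of a unit of the real field is positive, so a word without sign; its
  exponents are even, and halving them determines the unit up to sign.\<close>

theorem unit_group_Kp: "unit_group Kp = mult_span Sp"
proof
  show "unit_group Kp \<subseteq> mult_span Sp"
  proof (rule unit_group_subset_mult_span[OF cKp Sp_nonzero, of 2])
    show "u ^ (2 ^ 2) \<in> mult_span Sp" if "u \<in> unit_group Kp" for u
      using Kp_units_fourth_power[OF that] by simp
    fix u assume u: "u \<in> unit_group Kp" and "u ^ 2 \<in> mult_span Sp"
    then obtain s i j k l m n h where w: "u ^ 2 = (-1) powi s * word i j k l m n h" by (elim Sp_words)
    have "u \<in> Kp" "u \<noteq> 0" using u mem_unit_group_iff[OF cKp] by auto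
    then have "u ^ 2 \<in> squares Kp" by (rule squares_closed(4)[OF cKp])
    then have sq: "(-1) powi s * word i j k l m n h \<in> squares Kp" by (simp add: w)
    note se = sign_even[OF sq word_pos]
    have "even i \<and> even j \<and> even k \<and> even l \<and> even m \<and> even n \<and> even h"
      by (rule word_square_exponents[OF se(2)])
    then obtain i' j' k' l' m' n' h' where "i = 2 * i'" "j = 2 * j'" "k = 2 * k'" "l = 2 * l'" "m = 2 * m'" "n = 2 * n'" "h = 2 * h'"
      by (auto elim!: evenE)
    then have "u ^ 2 = word i' j' k' l' m' n' h' ^ 2" using w se(1) by (simp add: minus_one_powi word_double)
    then have "u = word i' j' k' l' m' n' h' \<or> u = (-1) * word i' j' k' l' m' n' h'"
      by (simp add: power2_eq_iff)
    then show "u \<in> mult_span Sp" using word_Sp Sp_gens(1) Sp_closed(4) by metis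
  qed
  show "mult_span Sp \<subseteq> unit_group Kp" by (rule Sp_units)
qed

end

subsection \<open>The unit group of the imaginary field\<close>

context prime_triple_root
begin

definition Kc :: "complex set" where "Kc = QF {int p1, int p2, int p3, -1}"

text \<open>A square root of \<i> \<epsilon>_p1: the factors (1 + \<i>)^2 = 2 \<i> and \<alpha>1^2 =
  2 \<epsilon>_p1 together cancel the denominator 4. Separately, the square roots of \<i> and
  \<epsilon>_p1 would require \<surd>2.\<close>

definition \<zeta> :: complex where "\<zeta> = (1 + \<i>) * of_real \<alpha>1 / 2"

definition Sc :: "complex set" where
  "Sc = {\<i>, of_real T12, of_real A12, of_real T31, of_real A13, of_real T23, of_real \<xi>, \<zeta>}"

lemma rt_minus_one: "rt (-1) = \<i>"
  by (simp add: rt_def)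

lemma i_notin_Kp: "\<i> \<notin> Kp"
  using Kp_real by (auto simp: complex_is_Real_iff)

sublocale cc: quad_ext Kp \<i>
  by (intro quad_ext.intro cKp i_notin_Kp) (use Kp_intros(2)[OF Kp_intros(1)] in simp)

lemma Kc_adj: "Kc = adj Kp \<i>"
proof -
  have "Kc = QF (insert (-1) {int p1, int p2, int p3})" by (simp add: Kc_def insert_commute)
  then show ?thesis unfolding QF_insert rt_minus_one Kp_def .
qed

lemma cKc: "closed_field Kc" unfolding Kc_def by (rule closed_field_QF)

lemmas Kc_intros = closed_field_intros[OF cKc]

lemma Kp_sub_Kc: "Kp \<subseteq> Kc" using cc.base_subset by (auto simp: Kc_adj)

lemma i_Kc: "\<i> \<in> Kc" using cc.gen_in by (simp add: Kc_adj)

lemma zeta_sq: "\<zeta> ^ 2 = \<i> * of_real E1"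
proof -
  have "(1 + \<i>) ^ 2 = 2 * \<i>" by (simp add: power2_eq_square algebra_simps)
  then show ?thesis unfolding \<zeta>_def E1_def power_divide power_mult_distrib by (simp add: power_divide)
qed

text \<open>The real part of \<zeta> is positive, which selects the principal root.\<close>

lemma zeta_csqrt: "csqrt (\<i> * of_real E1) = \<zeta>"
proof (rule csqrt_unique)
  show "\<zeta> ^ 2 = \<i> * of_real E1" by (rule zeta_sq)
  show "0 < Re \<zeta> \<or> Re \<zeta> = 0 \<and> 0 \<le> Im \<zeta>" using pos(1) by (simp add: \<zeta>_def)
qed

lemma zeta_Kc: "\<zeta> \<in> Kc"
  unfolding \<zeta>_def using Kp_sub_Kc in_Kp(1) by (intro Kc_intros(8) Kc_intros(5) Kc_intros(4) Kc_intros(1) i_Kc Kc_intros(12)) auto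

lemma zeta_nonzero: "\<zeta> \<noteq> 0" using pos(1) by (simp add: \<zeta>_def complex_eq_iff)

lemma Sc_nonzero: "0 \<notin> Sc" using gens_nonzero zeta_nonzero by (auto simp: Sc_def)

lemmas Sc_closed = mult_span_closed[OF Sc_nonzero] mult_span_powi[OF Sc_nonzero]

lemma Sc_gens: "\<i> \<in> mult_span Sc" "of_real T12 \<in> mult_span Sc" "of_real A12 \<in> mult_span Sc"
  "of_real T31 \<in> mult_span Sc" "of_real A13 \<in> mult_span Sc" "of_real T23 \<in> mult_span Sc" "of_real \<xi> \<in> mult_span Sc"
  "\<zeta> \<in> mult_span Sc"
  using mult_span_incl[of Sc] unfolding Sc_def by blast+

lemma Sc_power: "x \<in> mult_span Sc \<Longrightarrow> x ^ q \<in> mult_span Sc"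
  using Sc_closed(5)[of x "int q"] by (simp add: power_int_of_nat)

lemma Sp_sub_Sc: "mult_span Sp \<subseteq> mult_span Sc"
proof (rule mult_span_subset[OF Sp_nonzero])
  have "-1 = \<i> ^ 2" "of_real E1 = inverse \<i> * \<zeta> ^ 2" by (simp_all add: zeta_sq)
  then have "-1 \<in> mult_span Sc" "of_real E1 \<in> mult_span Sc"
    using Sc_power Sc_gens Sc_closed by metis+
  then show "Sp \<subseteq> mult_span Sc" using Sc_gens by (auto simp: Sp_def)
qed (use Sc_closed in auto)

lemma Sc_words:
  assumes "x \<in> mult_span Sc"
  obtains s j k l m n h z where "x = \<i> powi s * word 0 j k l m n h * \<zeta> powi z"
proof -
  have "Sc = insert \<i> (insert \<zeta> {of_real T12, of_real A12, of_real T31, of_real A13, of_real T23, of_real \<xi>})"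
    unfolding Sc_def by blast
  note mem = assms[unfolded this]
  obtain s x1 where 1: "x = \<i> powi s * x1"
    and m1: "x1 \<in> mult_span (insert \<zeta> {of_real T12, of_real A12, of_real T31, of_real A13, of_real T23, of_real \<xi>})"
    using mult_span_insertE[OF mem] gens_nonzero zeta_nonzero by auto
  obtain z x2 where 2: "x1 = \<zeta> powi z * x2"
    and m2: "x2 \<in> mult_span {of_real T12, of_real A12, of_real T31, of_real A13, of_real T23, of_real \<xi>}"
    using mult_span_insertE[OF m1] gens_nonzero zeta_nonzero by auto
  obtain j k l m n h where 3: "x2 = word 0 j k l m n h" using m2 by (rule core_words)
  have "x = \<i> powi s * word 0 j k l m n h * \<zeta> powi z"
    unfolding 1 2 3 by (simp only: mult_ac)
  then show ?thesis by (rule that)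
qed

lemma imaginary_units_in:
  assumes "squarefree d" "d > 0" "d \<noteq> 3" "u \<in> unit_group (QF {- int d})"
  shows "u \<in> mult_span Sc"
proof -
  have "u ^ 4 = 1" by (rule imaginary_quadratic_units[OF assms(1,3,2,4)])
  then have "(u ^ 2) ^ 2 = 1" by (simp flip: power_mult)
  then have "u ^ 2 = 1 \<or> u ^ 2 = -1" by (simp only: power2_eq_1_iff)
  then have "u ^ 2 = 1 \<or> u ^ 2 = \<i> ^ 2" by simp
  then have "u = 1 \<or> u = -1 \<or> u = \<i> \<or> u = (-1) * \<i>"
    by (metis power2_eq_1_iff power2_eq_iff mult_minus1)
  moreover have "-1 \<in> mult_span Sc" using Sp_sub_Sc Sp_gens(1) by blast
  ultimately show ?thesis using Sc_closed(1,4) Sc_gens(1) by metis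
qed

text \<open>The sign is the second character: \<open>sgn\<close> is -1 on t and 1 on p1. Neither
  imaginary quadratic subfield has radicand -3, because the primes are 7 modulo 8; so their units
  are powers of \<i>.\<close>

lemma complex_biquadratic_units:
  assumes t: "t \<in> {- 1, - int p2, - int p3, - (int p2 * int p3)}" and u: "u \<in> unit_group (QF {int p1, t})"
  shows "u ^ 2 \<in> mult_span Sc"
proof -
  have p3: "p1 \<noteq> 3" "p2 \<noteq> 3" "p3 \<noteq> 3" using mod8 by auto
  have n3: "p1 * p2 * p3 \<noteq> 3" "p1 * p2 \<noteq> 3" "p2 * p3 \<noteq> 3" "p1 * p3 \<noteq> 3"
    using mod_8_mult_7(1)[OF mod8(1,2)] mod_8_mult_7(1)[OF mod8(2,3)] mod_8_mult_7(1)[OF mod8(1,3)]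
      mod_8_mult_7(2)[OF mod_8_mult_7(1)[OF mod8(1,2)] mod8(3)] by auto
  have t0: "t \<noteq> 0" "sgn t = -1" "vchar p1 t = 1"
    using t pgt by (auto simp: vchar_neg vchar_mult vchar_values mult_pos_pos)
  obtain x y z where xyz: "x \<in> unit_group (QF {int p1})" "y \<in> unit_group (QF {t})"
      "z \<in> unit_group (QF {int p1 * t})" "u ^ 2 = x * y * z"
    by (rule biquadratic_QF[of "{}" "int p1" t "vchar p1" sgn u])
       (assumption | simp add: t0 u vchar_values pgt vchar_char primes mult_char_sgn)+
  have "x \<in> mult_span Sp" by (rule quadratic_units_in[OF \<alpha>_units(1,8) unit_squares_in(1) xyz(1)])
  then have x: "x \<in> mult_span Sc" using Sp_sub_Sc by blast
  obtain d where d: "t = - int d" "d \<in> {1, p2, p3, p2 * p3}"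
    using t by (auto intro: that[of 1] that[of p2] that[of p3] that[of "p2 * p3"])
  have sq1: "squarefree (1 :: nat)" by simp
  have "squarefree d \<and> d > 0 \<and> d \<noteq> 3 \<and> squarefree (p1 * d) \<and> p1 * d > 0 \<and> p1 * d \<noteq> 3"
    using d(2) by (elim insertE emptyE; hypsubst) (simp_all add: \<alpha>_units sq1 p3 n3 pgt flip: mult.assoc)
  moreover have "int p1 * t = - int (p1 * d)" using d(1) by simp
  ultimately have "y \<in> mult_span Sc" "z \<in> mult_span Sc"
    using imaginary_units_in xyz(2,3) d(1) by metis+
  then show ?thesis unfolding xyz(4) using x Sc_closed(4) by blast
qed

lemma complex_triquadratic_units:
  assumes t: "t = -1 \<or> t = - int p3" and u: "u \<in> unit_group (QF {int p1, int p2, t})"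
  shows "u ^ 4 \<in> mult_span Sc"
proof -
  have t0: "t \<noteq> 0" "sgn t = -1" "vchar p2 t = 1"
    using t pgt by (auto simp: vchar_neg vchar_values)
  have u': "u \<in> unit_group (QF {int p2, t, int p1})" using u by (simp add: insert_commute)
  obtain x y z where xyz: "x \<in> unit_group (QF {int p2, int p1})" "y \<in> unit_group (QF {t, int p1})"
      "z \<in> unit_group (QF {int p2 * t, int p1})" "u ^ 2 = x * y * z"
    by (rule biquadratic_QF[of "{int p1}" "int p2" t "vchar p2" sgn u])
       (assumption | simp add: t0 u' vchar_values pgt pnz vchar_char primes mult_char_sgn)+
  have "x ^ 2 \<in> mult_span Sp" using xyz(1) by (intro real_biquadratic_units) (simp add: insert_commute)
  then have x: "x ^ 2 \<in> mult_span Sc" using Sp_sub_Sc by blast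
  have y: "y ^ 2 \<in> mult_span Sc" using xyz(2) t by (intro complex_biquadratic_units[of t]) (auto simp: insert_commute)
  have z: "z ^ 2 \<in> mult_span Sc" using xyz(3) t
    by (intro complex_biquadratic_units[of "int p2 * t"]) (auto simp: insert_commute)
  have "u ^ 4 = (u ^ 2) ^ 2" by (simp flip: power_mult)
  also have "\<dots> = x ^ 2 * y ^ 2 * z ^ 2" by (simp add: xyz(4) power_mult_distrib)
  also have "\<dots> \<in> mult_span Sc" using x y z Sc_closed(4) by blast
  finally show ?thesis .
qed

text \<open>Three layers of the biquadratic identity, over Q(\<surd>p1, \<surd>p2), Q(\<surd>p1) and
  \<rat>, account for the exponent 8. One of the three fields in the top layer is the real octic
  field, whose units are known by now.\<close>

lemma Kc_units_eighth_power:
  assumes u: "u \<in> unit_group Kc"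
  shows "u ^ 8 \<in> mult_span Sc"
proof -
  have u': "u \<in> unit_group (QF {int p3, -1, int p1, int p2})" using u by (simp add: Kc_def insert_commute)
  obtain x y z where xyz: "x \<in> unit_group (QF {int p3, int p1, int p2})" "y \<in> unit_group (QF {-1, int p1, int p2})"
      "z \<in> unit_group (QF {int p3 * -1, int p1, int p2})" "u ^ 2 = x * y * z"
    by (rule biquadratic_QF[of "{int p1, int p2}" "int p3" "-1" "vchar p3" sgn u])
       (assumption | (auto simp: u' vchar_values pgt pnz vchar_char primes mult_char_sgn)[1])+
  have "x \<in> unit_group Kp" using xyz(1) by (simp add: Kp_def insert_commute)
  then have x: "x \<in> mult_span Sc" using unit_group_Kp Sp_sub_Sc by blast
  have "y \<in> unit_group (QF {int p1, int p2, -1})" using xyz(2) by (simp add: insert_commute)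
  then have y: "y ^ 4 \<in> mult_span Sc" by (intro complex_triquadratic_units[of "-1"]) simp_all
  have "z \<in> unit_group (QF {int p1, int p2, - int p3})" using xyz(3) by (simp add: insert_commute)
  then have z: "z ^ 4 \<in> mult_span Sc" by (intro complex_triquadratic_units[of "- int p3"]) simp_all
  have "u ^ 8 = (u ^ 2) ^ 4" by (simp flip: power_mult)
  also have "\<dots> = x ^ 4 * y ^ 4 * z ^ 4" by (simp add: xyz(4) power_mult_distrib)
  also have "\<dots> \<in> mult_span Sc" using Sc_power[OF x] y z Sc_closed(4) by blast
  finally show ?thesis .
qed

lemma Sc_units: "mult_span Sc \<subseteq> unit_group Kc"
proof -
  note Uc = unit_group_closed[OF cKc]
  have Kp: "unit_group Kp \<subseteq> unit_group Kc" by (rule unit_group_mono[OF cKp cKc Kp_sub_Kc])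
  have "Sp \<subseteq> unit_group Kc" using Kp unit_group_Kp mult_span_incl by blast
  then have s: "of_real T12 \<in> unit_group Kc" "of_real A12 \<in> unit_group Kc" "of_real T31 \<in> unit_group Kc"
    "of_real A13 \<in> unit_group Kc" "of_real T23 \<in> unit_group Kc" "of_real \<xi> \<in> unit_group Kc" "of_real E1 \<in> unit_group Kc"
    by (auto simp: Sp_def)
  have i: "\<i> \<in> unit_group Kc" using i_Kc mem_unit_group_iff[OF cKc] by simp
  have "\<zeta> ^ 2 \<in> unit_group Kc" unfolding zeta_sq by (rule Uc(2)[OF i s(7)])
  then have "algebraic_int (\<zeta> ^ 2)" "algebraic_int (inverse \<zeta> ^ 2)"
    using mem_unit_group_iff[OF cKc] by (simp_all add: power_inverse)
  then have z: "\<zeta> \<in> unit_group Kc"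
    using zeta_Kc zeta_nonzero mem_unit_group_iff[OF cKc] algebraic_int_of_power2 by blast
  show ?thesis using s i z Uc by (intro mult_span_subset[OF Sc_nonzero]) (auto simp: Sc_def)
qed

text \<open>The norm to the real field removes \<i> and sends \<zeta> to the non-square
  \<epsilon>_p1, which makes the parity of the exponent of \<zeta> visible.\<close>

lemma nm_complex: "cc.nm \<i> = 1" "cc.nm \<zeta> = of_real E1"
proof -
  show i: "cc.nm \<i> = 1" using cc.nm_coords[of 0 1] Kp_intros by simp
  have z: "\<zeta> = of_real \<alpha>1 / 2 + of_real \<alpha>1 / 2 * \<i>" by (simp add: \<zeta>_def algebra_simps add_divide_distrib)
  have h: "of_real \<alpha>1 / 2 \<in> Kp" using in_Kp(1) Kp_intros(8,12) by blast
  show "cc.nm \<zeta> = of_real E1"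
    unfolding z cc.nm_coords[OF h h] by (simp add: E1_def power_divide)
qed

text \<open>The norm makes the exponent of \<zeta> even. After division by powers of \<zeta> and
  \<i>, either v^2 = r or v^2 = \<i> r, where r is a positive word free of \<open>E1\<close>. In the
  second case r is 2 times a square in \<open>Kp\<close>, so E1 r is a square although
  \<open>E1\<close> occurs in it to the first power.\<close>

lemma Kc_square_root_in:
  assumes u: "u \<in> unit_group Kc" and "u ^ 2 \<in> mult_span Sc"
  shows "u \<in> mult_span Sc"
proof -
  obtain s j k l m n h z where w: "u ^ 2 = \<i> powi s * word 0 j k l m n h * \<zeta> powi z"
    using Sc_words[OF assms(2)] .
  define r where "r = word 0 j k l m n h"
  have r: "r \<in> Kp" "pos_real r" unfolding r_def by (rule word_Kp, rule word_pos)
  have uK: "u \<in> adj Kp \<i>" "u \<noteq> 0" using u mem_unit_group_iff[OF cKc] by (auto simp: Kc_adj)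
  note iK = i_Kc[unfolded Kc_adj] and zK = zeta_Kc[unfolded Kc_adj]
  note cl = closed_field_intros[OF cc.closed_field_adj]
  have "cc.nm (u ^ 2) = r ^ 2 * of_real E1 powi z"
    unfolding w r_def[symmetric]
    using iK zK r(1) cl(5,13) cc.base_subset nm_complex
    by (simp add: cc.nm_mult cc.nm_powi cc.nm_base)
  moreover have "u ^ 2 \<in> squares (adj Kp \<i>)" using uK by (intro squares_closed(4)[OF cc.closed_field_adj])
  ultimately have "r ^ 2 * of_real E1 powi z \<in> squares Kp" using cc.nm_squares by metis
  moreover have "r ^ 2 \<in> squares Kp" using r pos_real_nonzero by (intro squares_closed(4)[OF cKp]) auto
  ultimately have "of_real E1 powi z \<in> squares Kp" using squares_cancel(2)[OF cKp] by blast
  then have "even z" by (rule E1_power_square)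
  define v where "v = u * inverse (\<zeta> powi (z div 2)) * inverse (\<i> powi (s div 2))"
  have v: "v \<in> adj Kp \<i>" unfolding v_def by (intro cl(3) cl(5) cl(13) uK iK zK)
  have uv: "u = v * \<zeta> powi (z div 2) * \<i> powi (s div 2)" using zeta_nonzero by (simp add: v_def field_simps)
  have v2: "v ^ 2 = \<i> powi s * r * inverse ((\<i> powi (s div 2)) ^ 2)"
    unfolding v_def power_mult_distrib w r_def[symmetric] powi_even[OF \<open>even z\<close>] power_inverse
    using zeta_nonzero by simp
  have "v \<in> mult_span Sc"
  proof (cases "even s")
    case True
    then have vr: "v ^ 2 = r" using v2 by (simp add: powi_even)
    obtain x where x: "x \<in> Kp" "r = x ^ 2 \<or> r = x ^ 2 * \<i> ^ 2"
      using cc.square_in_ext[OF r(1) vr[symmetric] v] by blast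
    have "x \<noteq> 0" using x(2) pos_real_nonzero[OF r(2)] by auto
    then have px: "pos_real (x ^ 2)" using x(1) Kp_real by (intro pos_real_square) auto
    \<comment> \<open>The alternative r = - x^2 fails by positivity.\<close>
    then have "r = x ^ 2" using x(2) r(2) pos_real_uminus[OF px] by auto
    then have "word 0 j k l m n h \<in> squares Kp"
      using squares_closed(4)[OF cKp x(1) \<open>x \<noteq> 0\<close>] by (simp add: r_def)
    from word_square_exponents[OF this] obtain j' k' l' m' n' h' where
      "j = 2 * j'" "k = 2 * k'" "l = 2 * l'" "m = 2 * m'" "n = 2 * n'" "h = 2 * h'"
      by (auto elim!: evenE)
    then have "v ^ 2 = word 0 j' k' l' m' n' h' ^ 2" using vr word_double[of 0 j' k' l' m' n' h'] by (simp add: r_def)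
    then have "v = word 0 j' k' l' m' n' h' \<or> v = (-1) * word 0 j' k' l' m' n' h'"
      by (simp add: power2_eq_iff)
    then have "v \<in> mult_span Sp" using word_Sp Sp_gens(1) Sp_closed(4) by metis
    then show ?thesis using Sp_sub_Sc by blast
  next
    case False
    then have vr: "v ^ 2 = \<i> * r" using v2 by (simp add: powi_odd)
    obtain x y where xy: "x \<in> Kp" "y \<in> Kp" "v = x + y * \<i>" using v by (rule adjE)
    have "(x ^ 2 - y ^ 2) + (2 * x * y) * \<i> = 0 + r * \<i>"
      using vr unfolding xy(3) by (simp add: power2_eq_square algebra_simps)
    then have "x ^ 2 - y ^ 2 = 0 \<and> 2 * x * y = r"
      by (rule cc.coords_unique) (use xy r(1) Kp_intros in auto)
    then have e: "x ^ 2 = y ^ 2" "2 * x * y = r" by auto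
    have "x \<noteq> 0" using e pos_real_nonzero[OF r(2)] by auto
    then have px: "pos_real (x ^ 2)" using xy(1) Kp_real by (intro pos_real_square) auto
    have p2: "pos_real (2 * x ^ 2)" using pos_real_intros(1)[OF posr[of 2] px] by simp
    have "y = x \<or> y = - x" using e(1) by (metis power2_eq_iff)
    then have "r = 2 * x ^ 2 \<or> r = - (2 * x ^ 2)" using e(2) by (auto simp: power2_eq_square)
    then have "r = 2 * x ^ 2" using r(2) pos_real_uminus[OF p2] by auto
    then have "of_real E1 * r = (of_real \<alpha>1 * x) ^ 2" by (simp add: E1_def power_mult_distrib)
    moreover have "(of_real \<alpha>1 * x) ^ 2 \<in> squares Kp"
      using in_Kp(1) xy(1) \<open>x \<noteq> 0\<close> pos(1) by (intro squares_closed(4)[OF cKp] Kp_intros(5)) auto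
    moreover have "word 1 j k l m n h = of_real E1 * r" by (simp add: word_def r_def mult.assoc)
    ultimately have "even (1 :: int)" using word_square_exponents[of 1 j k l m n h] by simp
    then show ?thesis by simp
  qed
  then show ?thesis unfolding uv by (intro Sc_closed(4) Sc_closed(5) Sc_gens)
qed

theorem unit_group_Kc: "unit_group Kc = mult_span Sc"
proof
  show "unit_group Kc \<subseteq> mult_span Sc"
  proof (rule unit_group_subset_mult_span[OF cKc Sc_nonzero, of 3])
    show "u ^ (2 ^ 3) \<in> mult_span Sc" if "u \<in> unit_group Kc" for u
      using Kc_units_eighth_power[OF that] by simp
  qed (rule Kc_square_root_in)
qed (rule Sc_units)

lemma root_formula:
  "root 4 (\<eta> ^ 2 * fundamental_unit p1 ^ 3 * fundamental_unit p2 * fundamental_unit p3 * fundamental_unit (p1 * p2 * p3)) = \<xi>"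
proof -
  have "\<xi> ^ 4 = (\<xi> ^ 2) ^ 2" by (simp flip: power_mult)
  also have "\<dots> = \<eta> ^ 2 * fundamental_unit p1 ^ 3 * fundamental_unit p2 * fundamental_unit p3 * fundamental_unit (p1 * p2 * p3)"
    unfolding xi_sq fu_eq by (simp add: A12_def A13_def A1m_def E1_def power_mult_distrib power_divide flip: power_mult power_add)
  finally show ?thesis using xi_pos real_root_pos2[of 4 \<xi>] by simp
qed

lemma sqrt_formulas:
  "sqrt (fundamental_unit (p1 * p2)) = T12" "sqrt (fundamental_unit (p1 * p3)) = T31" "sqrt (fundamental_unit (p2 * p3)) = T23"
  "sqrt (fundamental_unit p1 * fundamental_unit p2) = A12" "sqrt (fundamental_unit p1 * fundamental_unit p3) = A13"
proof -
  show "sqrt (fundamental_unit (p1 * p2)) = T12" "sqrt (fundamental_unit (p1 * p3)) = T31" "sqrt (fundamental_unit (p2 * p3)) = T23"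
    unfolding fu_eq using pos by simp_all
  have "fundamental_unit p1 * fundamental_unit p2 = A12 ^ 2" "fundamental_unit p1 * fundamental_unit p3 = A13 ^ 2"
    unfolding fu_eq by (simp_all add: A12_def A13_def E1_def power_mult_distrib power_divide)
  then show "sqrt (fundamental_unit p1 * fundamental_unit p2) = A12" "sqrt (fundamental_unit p1 * fundamental_unit p3) = A13"
    using pos by simp_all
qed

end

section \<open>From the Legendre symbols to the cyclic equations and both unit groups\<close>

theorem lemma4p16:
  fixes p1 p2 p3 :: nat
  assumes "Factorial_Ring.prime p1" "Factorial_Ring.prime p2" "Factorial_Ring.prime p3"
    and "p1 \<noteq> p2" "p1 \<noteq> p3" "p2 \<noteq> p3"
    and "[p1 = 3] (mod 4)" "[p2 = 3] (mod 4)" "[p3 = 3] (mod 4)"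
    and "kronecker_symbol (- int p1) p2 = -1"
        "kronecker_symbol (- int p2) p3 = -1"
    and "kronecker_symbol (- int p1) p3 = 1"
        "kronecker_symbol (- int p1) 2 = 1"
        "kronecker_symbol (- int p2) 2 = 1"
        "kronecker_symbol (- int p3) 2 = 1"
  defines "\<epsilon> \<equiv> fundamental_unit"
  defines "Kplus \<equiv> rat_adjoin
      {complex_of_real (sqrt p1), complex_of_real (sqrt p2), complex_of_real (sqrt p3)}"
    and "K \<equiv> rat_adjoin
      {complex_of_real (sqrt p1), complex_of_real (sqrt p2), complex_of_real (sqrt p3), \<i>}"
  shows "\<exists>\<eta> \<in> {1, \<epsilon> p1}.
     unit_group Kplus = mult_span
       {-1,
        complex_of_real (\<epsilon> p1),
        complex_of_real (sqrt (\<epsilon> (p1 * p2))),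
        complex_of_real (sqrt (\<epsilon> p1 * \<epsilon> p2)),
        complex_of_real (sqrt (\<epsilon> (p1 * p3))),
        complex_of_real (sqrt (\<epsilon> p1 * \<epsilon> p3)),
        complex_of_real (sqrt (\<epsilon> (p2 * p3))),
        complex_of_real (root 4 (\<eta>^2 * \<epsilon> p1 ^ 3 * \<epsilon> p2 * \<epsilon> p3 * \<epsilon> (p1 * p2 * p3)))} \<and>
     unit_group K = mult_span
       {\<i>,
        complex_of_real (sqrt (\<epsilon> (p1 * p2))),
        complex_of_real (sqrt (\<epsilon> p1 * \<epsilon> p2)),
        complex_of_real (sqrt (\<epsilon> (p1 * p3))),
        complex_of_real (sqrt (\<epsilon> p1 * \<epsilon> p3)),
        complex_of_real (sqrt (\<epsilon> (p2 * p3))),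
        complex_of_real (root 4 (\<eta>^2 * \<epsilon> p1 ^ 3 * \<epsilon> p2 * \<epsilon> p3 * \<epsilon> (p1 * p2 * p3))),
        csqrt (\<i> * complex_of_real (\<epsilon> p1))}"
proof -
  \<comment> \<open>-p = 1 or -1 modulo 8 together with p = 3 modulo 4 leaves p = 7 modulo
    8.\<close>
  have mod8: "p mod 8 = 7" if "[p = 3] (mod 4)" "kronecker_symbol (- int p) 2 = 1" for p :: nat
  proof -
    have "[- int p = 1] (mod 8) \<or> [- int p = -1] (mod 8)"
      using that(2) by (auto simp: kronecker_symbol_def split: if_splits)
    then have "8 dvd - int p - 1 \<or> 8 dvd - int p + 1" by (simp add: cong_iff_dvd_diff)
    moreover have "p mod 4 = 3" using that(1) by (simp add: cong_def)
    ultimately show ?thesis by presburger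
  qed
  note m8 = mod8[OF assms(7,13)] mod8[OF assms(8,14)] mod8[OF assms(9,15)]
  have ne2: "p2 \<noteq> 2" "p3 \<noteq> 2" using m8 by auto
  have nr12: "\<not> QuadRes (int p2) (- int p1)"
    using assms(10) ne2 by (auto simp: kronecker_symbol_def Legendre_def split: if_splits)
  have nr23: "\<not> QuadRes (int p3) (- int p2)"
    using assms(11) ne2 by (auto simp: kronecker_symbol_def Legendre_def split: if_splits)
  have r13: "QuadRes (int p3) (- int p1)"
    using assms(12) ne2 by (auto simp: kronecker_symbol_def Legendre_def split: if_splits)
  have ndvd: "\<not> int p dvd int q" if "Factorial_Ring.prime p" "Factorial_Ring.prime q" "p \<noteq> q" for p q :: nat
    using that primes_dvd_imp_eq by auto
  have n13: "\<not> QuadRes (int p3) (int p1)"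
    using QuadRes_neg_cancel[OF assms(3) _ r13] ndvd[OF assms(3) assms(1)] assms(5)
      minus_one_nonresidue[OF assms(3)] prime_7_facts(1)[OF assms(3) m8(3)] by auto
  \<comment> \<open>The third cyclic condition, an instance of quadratic reciprocity, comes from the
    descent for p1 p3. One equation makes p1 a residue modulo p3, against the hypothesis on -p1; the
    other makes p3 a residue modulo p1, and together with -p3 also -1.\<close>
  have nr31: "\<not> QuadRes (int p1) (- int p3)"
  proof
    assume r: "QuadRes (int p1) (- int p3)"
    show False
    proof (rule two_primes_fundamental_unit_cases[OF assms(1) m8(1) assms(3) m8(3) assms(5)])
      fix a b assume "p1 * a ^ 2 = p3 * b ^ 2 + 1"
      then have "QuadRes (int p3) (int p1)" by (rule residue_from_descent'[OF assms(3)]) simp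
      then show False using n13 by blast
    next
      fix a b assume "p3 * a ^ 2 = p1 * b ^ 2 + 1"
      then have "QuadRes (int p1) (int p3)" by (rule residue_from_descent'[OF assms(1)]) simp
      then have "QuadRes (int p1) (-1)"
        using QuadRes_neg_cancel[OF assms(1) _ r] ndvd[OF assms(1) assms(3)] assms(5) by blast
      then show False using minus_one_nonresidue[OF assms(1)] prime_7_facts(1)[OF assms(1) m8(1)] by blast
    qed
  qed
  obtain a1 b1 where 1: "a1 ^ 2 = p1 * b1 ^ 2 + 2" "(real a1 + real b1 * sqrt p1) ^ 2 = 2 * fundamental_unit p1"
    by (rule prime_fundamental_unit[OF assms(1) m8(1)])
  obtain a2 b2 where 2: "a2 ^ 2 = p2 * b2 ^ 2 + 2" "(real a2 + real b2 * sqrt p2) ^ 2 = 2 * fundamental_unit p2"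
    by (rule prime_fundamental_unit[OF assms(2) m8(2)])
  obtain a3 b3 where 3: "a3 ^ 2 = p3 * b3 ^ 2 + 2" "(real a3 + real b3 * sqrt p3) ^ 2 = 2 * fundamental_unit p3"
    by (rule prime_fundamental_unit[OF assms(3) m8(3)])
  obtain a b where m: "a ^ 2 = p1 * p2 * p3 * b ^ 2 + 2"
    "(real a + real b * sqrt (p1 * p2 * p3)) ^ 2 = 2 * fundamental_unit (p1 * p2 * p3)"
    by (rule three_primes_fundamental_unit[OF assms(1) m8(1) assms(2) m8(2) assms(3) m8(3) assms(4,5,6) nr12 nr23 nr31])
  obtain c1 d1 where 12: "p1 * c1 ^ 2 = p2 * d1 ^ 2 + 1"
    "(real c1 * sqrt p1 + real d1 * sqrt p2) ^ 2 = fundamental_unit (p1 * p2)"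
    by (rule two_primes_fundamental_unit[OF assms(1) m8(1) assms(2) m8(2) assms(4) nr12])
  obtain c2 d2 where 23: "p2 * c2 ^ 2 = p3 * d2 ^ 2 + 1"
    "(real c2 * sqrt p2 + real d2 * sqrt p3) ^ 2 = fundamental_unit (p2 * p3)"
    by (rule two_primes_fundamental_unit[OF assms(2) m8(2) assms(3) m8(3) assms(6) nr23])
  \<comment> \<open>The order p3, p1 closes the cycle and fixes the orientation of the
    equation.\<close>
  obtain c3 d3 where 31: "p3 * c3 ^ 2 = p1 * d3 ^ 2 + 1"
    "(real c3 * sqrt p3 + real d3 * sqrt p1) ^ 2 = fundamental_unit (p3 * p1)"
    by (rule two_primes_fundamental_unit[OF assms(3) m8(3) assms(1) m8(1) assms(5)[symmetric] nr31])
  interpret T: prime_triple p1 p2 p3 a1 b1 a2 b2 a3 b3 a b c1 d1 c2 d2 c3 d3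
    by (intro prime_triple.intro assms(1-6) m8 1 2 3 m 12 23 31(1) 31(2)[unfolded mult.commute[of p3 p1]])
  obtain \<eta> \<xi> where xi: "\<eta> = 1 \<or> \<eta> = T.E1" "\<xi> > 0" "of_real \<xi> \<in> T.Kp" "\<xi> ^ 2 = \<eta> * (T.A12 * T.A13 * T.A1m)"
    by (rule T.xi_exists)
  interpret R: prime_triple_root p1 p2 p3 a1 b1 a2 b2 a3 b3 a b c1 d1 c2 d2 c3 d3 \<eta> \<xi>
    using xi by unfold_locales
  have K: "Kplus = T.Kp" "K = R.Kc"
    unfolding Kplus_def K_def T.Kp_def R.Kc_def QF_def by (simp_all add: T.rt_real R.rt_minus_one)
  have "\<eta> \<in> {1, \<epsilon> p1}" using xi(1) by (auto simp: \<epsilon>_def T.fu_eq)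
  then show ?thesis
    unfolding K \<epsilon>_def R.root_formula R.sqrt_formulas R.unit_group_Kp R.unit_group_Kc
    using R.root_formula
    by (intro bexI[of _ \<eta>]) (simp_all add: R.Sp_def R.Sc_def R.sqrt_formulas T.fu_eq(1) R.zeta_csqrt)
qed

end
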